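(* Let $G=SL_{r+1}(\mathbb C)$, let $w_0$ be the longest element of $W=S_{r+1}$, and let $\mathbf i_0=(1,2,\dots,r,\,1,2,\dots,r-1,\,\dots,\,1,2,\,1)$ be the reduced word of $w_0$ of length $n=\frac{r(r+1)}2$. Let $A\in\mathcal A_{\Sigma_{\mathbf i_0}}$ with coordinates $A_{-r},\dots,A_{-1}$ and $A_{m,d}$ ($1\le m\le r$, $1\le d\le r-m+1$), and let $P=p_M(A)$ with coordinates $P_{-r},\dots,P_{-1}$ and $P_{m,d}$. Then for $j\in\{1,\dots,r\}$, $c\in\mathbb C^\times$, $m\in\{1,\dots,r\}$ and $d\in\{1,\dots,r-m+1\}$, as rational functions, $$\bigl(a_{\Sigma_{\mathbf i_0}}^{-1}\circ(\iota\circ\zeta^{w_0,e})^{-1}\circ e_j^c\circ(\iota\circ\zeta^{w_0,e})\circ a_{\Sigma_{\mathbf i_0}}A\bigr)_{m,d}=\begin{cases}A_{m,d}\cdot\dfrac{c\sum_{s=1}^{m}\prod_{t=s}^{r-d}P_{t,d}+\sum_{s=m+1}^{r-d+1}\prod_{t=s}^{r-d}P_{t,d}}{\sum_{s=1}^{r-d+1}\prod_{t=s}^{r-d}P_{t,d}}&\text{if }j=d,\\[2mm]A_{m,d}&\text{if }j\ne d,\end{cases}$$ where the empty product ($s=r-d+1$) is $1$.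
   Context: $G=SL_{r+1}(\mathbb C)$, $H$ the diagonal torus, $N$ (resp. $N^-$) the upper (resp. lower) unitriangular matrices, $B=HN$, $B^-=HN^-$. $x_i(c)=I+cE_{i,i+1}$, $y_i(c)=I+cE_{i+1,i}$ ($1\le i\le r$). $\alpha_i(\mathrm{diag}(t_1,\dots,t_{r+1}))=t_i/t_{i+1}$. $(a_{i,j})$ is the Cartan matrix of type $A_r$: $a_{i,i}=2$, $a_{i,j}=-1$ if $|i-j|=1$, and $0$ otherwise. $\overline{s_i}=x_i(-1)y_i(1)x_i(-1)$, $\overline{w}=\overline{s_{j_1}}\cdots\overline{s_{j_m}}$ for a reduced expression $w=s_{j_1}\cdots s_{j_m}$. $G^{w_0,e}=B\overline{w_0}B\cap B^-$. For $x\in N^-HN$ write $x=[x]_-[x]_0[x]_+$. $D_{J,K}(x)$ denotes the ordinary minor of the matrix $x$ with row set $J$ and column set $K$. Geometric crystal action on $G^{w_0,e}$: $\gamma_i(x)=\alpha_i(t)$ where $x=nt$, $n\in N^-$, $t\in H$. Each $n\in N^-$ is uniquely $n=y_i(a)n'$ with $a\in\mathbb C$, $n'\in N^-\cap\overline{s_i}N^-\overline{s_i}^{-1}$; set $\chi_i(nt)=\chi_i(n)=a$. Then $\varphi_i=1/\chi_i$, $\varepsilon_i=\varphi_i/\gamma_i$, $e_i^c(x)=x_i((c-1)\varphi_i(x))\,x\,x_i((c^{-1}-1)\varepsilon_i(x))$ (rational). Twist: $\theta$ is the automorphism of $G$ with $\theta(a)=a^{-1}$ ($a\in H$), $\theta(x_i(T))=y_i(T)$,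 $\theta(y_i(T))=x_i(T)$; $\iota$ is the antiautomorphism with $\iota(a)=a^{-1}$ ($a\in H$), $\iota(x_i(T))=x_i(T)$, $\iota(y_i(T))=y_i(T)$. $\zeta^{w_0,e}(x)=\theta([\overline{w_0}^{-1}x]_-^{-1}\overline{w_0}^{-1}x)$ for $x\in G^{w_0,e}$ (one has $\overline{w_0}^{-1}x\in N^-HN$); $\iota\circ\zeta^{w_0,e}:G^{w_0,e}\to G^{w_0,e}$ is a biregular isomorphism. Cluster tori: $I=\{-r,\dots,-1\}\cup\{1,\dots,n\}$, $i_k$ is the $k$-th letter of $\mathbf i_0$ for $k\ge1$, $i_{-m}=-m$, $k^+=\min(\{l\in I\mid l>k,|i_l|=|i_k|\}\cup\{n+1\})$. With $[\,\cdot\,]$ equal to $1$ for a true proposition and $0$ for a false one, $B=(b_{j,k})_{j,k\in I}$ and $M=(M_{j,k})_{j,k\in I}$ are $$b_{j,k}=\tfrac{a_{|i_k|,|i_j|}}2\bigl(-[j=k^+]+[j^+=k]-[k<j<k^+][j>0]+[k<j^+<k^+][j^+\le n]+[j<k<j^+][k>0]-[j<k^+<j^+][k^+\le n]\bigr),$$ $$M_{j,k}=\tfrac{a_{|i_k|,|i_j|}}2\bigl([j^+,k^+>n]+[j,k<0]\bigr),$$ and $\tilde B=B+M$ (an integer matrix). $\mathcal A_{\Sigma_{\mathbf i_0}}=(\mathbb C^\times)^I$ with coordinates $(A_k)_{k\in I}$, and $p_M(A)_i=\prod_{k\in I}A_k^{\tilde B_{i,k}}$. The positive indices are relabelled as pairs: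 $(m,d)$ stands for the index $k\ge1$ of the $m$-th occurrence of the letter $d$ in $\mathbf i_0$ (i.e. the letter $d$ in the $m$-th cycle), so $(A_1,\dots,A_n)=(A_{1,1},\dots,A_{1,r},A_{2,1},\dots,A_{2,r-1},\dots,A_{r-1,1},A_{r-1,2},A_{r,1})$, and similarly for $P=p_M(A)$. $a_{\Sigma_{\mathbf i_0}}:\mathcal A_{\Sigma_{\mathbf i_0}}\to G^{w_0,e}$ is the open immersion with $a_{\Sigma_{\mathbf i_0}}^*D_{\{1,\dots,d\},\{1,\dots,d\}}=A_{-d}$ and $a_{\Sigma_{\mathbf i_0}}^*D_{\{m+1,\dots,m+d\},\{1,\dots,d\}}=A_{m,d}$. *)

theory Defs
  imports
    "HOL-Algebra.Group"
    "Jordan_Normal_Form.Determinant"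
    "Jordan_Normal_Form.DL_Submatrix"
begin

text \<open>
  Mathematical indices are 1-based throughout, library matrix entries are 0-based:
  the \<open>(p,q)\<close> entry of \<open>x\<close> is \<open>x $$ (p - 1, q - 1)\<close>.
  The parameter \<open>r\<close> is the rank, so matrices have size \<open>r + 1\<close>.
\<close>

section \<open>The group and its subgroups\<close>

definition SL :: "nat \<Rightarrow> complex mat monoid" where
  "SL r = \<lparr>carrier = {x \<in> carrier_mat (r + 1) (r + 1). det x = 1},
           monoid.mult = (*), one = 1\<^sub>m (r + 1)\<rparr>"

definition torus_H :: "nat \<Rightarrow> complex mat set" where
  "torus_H r = {t \<in> carrier (SL r). diagonal_mat t}"

definition N_plus :: "nat \<Rightarrow> complex mat set" where
  "N_plus r = {x \<in> carrier (SL r). upper_triangular x \<and> (\<forall>i<r + 1. x $$ (i, i) = 1)}"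

definition N_minus :: "nat \<Rightarrow> complex mat set" where
  "N_minus r = {x \<in> carrier (SL r). transpose_mat x \<in> N_plus r}"

definition B_plus :: "nat \<Rightarrow> complex mat set" where
  "B_plus r = {t * n | t n. t \<in> torus_H r \<and> n \<in> N_plus r}"

definition B_minus :: "nat \<Rightarrow> complex mat set" where
  "B_minus r = {t * n | t n. t \<in> torus_H r \<and> n \<in> N_minus r}"

definition unit_mat :: "nat \<Rightarrow> nat \<Rightarrow> nat \<Rightarrow> complex mat" where
  "unit_mat r p q = mat (r + 1) (r + 1) (\<lambda>(a, b). if a = p - 1 \<and> b = q - 1 then 1 else 0)"

definition x_gen :: "nat \<Rightarrow> nat \<Rightarrow> complex \<Rightarrow> complex mat" where
  "x_gen r i c = 1\<^sub>m (r + 1) + c \<cdot>\<^sub>m unit_mat r i (i + 1)"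

definition y_gen :: "nat \<Rightarrow> nat \<Rightarrow> complex \<Rightarrow> complex mat" where
  "y_gen r i c = 1\<^sub>m (r + 1) + c \<cdot>\<^sub>m unit_mat r (i + 1) i"

definition simple_root :: "nat \<Rightarrow> complex mat \<Rightarrow> complex" where
  "simple_root i t = t $$ (i - 1, i - 1) / t $$ (i, i)"

definition minor :: "nat set \<Rightarrow> nat set \<Rightarrow> complex mat \<Rightarrow> complex" where
  "minor J K x = det (submatrix x ((\<lambda>j. j - 1) ` J) ((\<lambda>k. k - 1) ` K))"

definition s_bar :: "nat \<Rightarrow> nat \<Rightarrow> complex mat" where
  "s_bar r i = x_gen r i (-1) * y_gen r i 1 * x_gen r i (-1)"

text \<open>The reduced word \<open>(1,\<dots>,r, 1,\<dots>,r-1, \<dots>, 1,2, 1)\<close> of the longest element; its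
  \<open>p\<close>-th cycle is \<open>1,\<dots>,r+1-p\<close>.\<close>

definition w0_word :: "nat \<Rightarrow> nat list" where
  "w0_word r = concat (map (\<lambda>p. [1..<r + 2 - p]) [1..<r + 1])"

definition w0_bar :: "nat \<Rightarrow> complex mat" where
  "w0_bar r = foldr (\<lambda>i x. s_bar r i * x) (w0_word r) (1\<^sub>m (r + 1))"

definition double_cell :: "nat \<Rightarrow> complex mat set" where
  "double_cell r = {b * w0_bar r * b' | b b'. b \<in> B_plus r \<and> b' \<in> B_plus r} \<inter> B_minus r"

text \<open>The factor \<open>[x]\<^sub>-\<close> of the Gauss decomposition of \<open>x \<in> N\<^sup>-HN\<close>.\<close>

definition gauss_minus :: "nat \<Rightarrow> complex mat \<Rightarrow> complex mat" where
  "gauss_minus r x =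
    (THE n. n \<in> N_minus r \<and> (\<exists>t \<in> torus_H r. \<exists>u \<in> N_plus r. x = n * t * u))"

section \<open>The geometric crystal\<close>

definition gamma_cr :: "nat \<Rightarrow> nat \<Rightarrow> complex mat \<Rightarrow> complex" where
  "gamma_cr r i x = simple_root i (THE t. t \<in> torus_H r \<and> (\<exists>n \<in> N_minus r. x = n * t))"

definition chi_N :: "nat \<Rightarrow> nat \<Rightarrow> complex mat \<Rightarrow> complex" where
  "chi_N r i n =
    (THE a. \<exists>n'. n' \<in> N_minus r
                \<and> n' \<in> {s_bar r i * u * (inv\<^bsub>SL r\<^esub> (s_bar r i)) | u. u \<in> N_minus r}
                \<and> n = y_gen r i a * n')"

definition chi_cr :: "nat \<Rightarrow> nat \<Rightarrow> complex mat \<Rightarrow> complex" where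
  "chi_cr r i x = chi_N r i (THE n. n \<in> N_minus r \<and> (\<exists>t \<in> torus_H r. x = n * t))"

definition phi_cr :: "nat \<Rightarrow> nat \<Rightarrow> complex mat \<Rightarrow> complex" where
  "phi_cr r i x = 1 / chi_cr r i x"

definition epsilon_cr :: "nat \<Rightarrow> nat \<Rightarrow> complex mat \<Rightarrow> complex" where
  "epsilon_cr r i x = phi_cr r i x / gamma_cr r i x"

text \<open>A rational map is a partial function, undefined (\<open>None\<close>) where a denominator vanishes.\<close>

definition crystal_e :: "nat \<Rightarrow> nat \<Rightarrow> complex \<Rightarrow> complex mat \<rightharpoonup> complex mat" where
  "crystal_e r i c x =
    (if x \<in> double_cell r \<and> chi_cr r i x \<noteq> 0
     then Some (x_gen r i ((c - 1) * phi_cr r i x) * x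
                * x_gen r i ((inverse c - 1) * epsilon_cr r i x))
     else None)"

section \<open>The twist\<close>

text \<open>The conditions determine both maps on \<open>carrier (SL r)\<close>, as the root subgroups generate;
  the choice operator only fixes irrelevant values outside.\<close>

definition theta_aut :: "nat \<Rightarrow> complex mat \<Rightarrow> complex mat" where
  "theta_aut r = (SOME f. f \<in> iso (SL r) (SL r)
     \<and> (\<forall>a \<in> torus_H r. f a = inv\<^bsub>SL r\<^esub> a)
     \<and> (\<forall>i \<in> {1..r}. \<forall>T. f (x_gen r i T) = y_gen r i T \<and> f (y_gen r i T) = x_gen r i T))"

definition iota_anti :: "nat \<Rightarrow> complex mat \<Rightarrow> complex mat" where
  "iota_anti r = (SOME f. bij_betw f (carrier (SL r)) (carrier (SL r))
     \<and> (\<forall>x \<in> carrier (SL r). \<forall>y \<in> carrier (SL r). f (x * y) = f y * f x)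
     \<and> (\<forall>a \<in> torus_H r. f a = inv\<^bsub>SL r\<^esub> a)
     \<and> (\<forall>i \<in> {1..r}. \<forall>T. f (x_gen r i T) = x_gen r i T \<and> f (y_gen r i T) = y_gen r i T))"

definition zeta_twist :: "nat \<Rightarrow> complex mat \<Rightarrow> complex mat" where
  "zeta_twist r x =
    (let z = inv\<^bsub>SL r\<^esub> (w0_bar r) * x
     in theta_aut r ((inv\<^bsub>SL r\<^esub> (gauss_minus r z)) * z))"

section \<open>Cluster coordinates\<close>

definition n_len :: "nat \<Rightarrow> nat" where
  "n_len r = r * (r + 1) div 2"

definition index_set :: "nat \<Rightarrow> int set" where
  "index_set r = {- int r..-1} \<union> {1..int (n_len r)}"

definition letter :: "nat \<Rightarrow> int \<Rightarrow> int" where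
  "letter r k = (if k < 0 then k else int (w0_word r ! nat (k - 1)))"

definition next_index :: "nat \<Rightarrow> int \<Rightarrow> int" where
  "next_index r k =
    Min ({l \<in> index_set r. l > k \<and> \<bar>letter r l\<bar> = \<bar>letter r k\<bar>} \<union> {int (n_len r) + 1})"

definition cartan :: "int \<Rightarrow> int \<Rightarrow> rat" where
  "cartan i j = (if i = j then 2 else if \<bar>i - j\<bar> = 1 then -1 else 0)"

definition b_entry :: "nat \<Rightarrow> int \<Rightarrow> int \<Rightarrow> rat" where
  "b_entry r j k =
    (let n = int (n_len r); j' = next_index r j; k' = next_index r k in
     cartan \<bar>letter r k\<bar> \<bar>letter r j\<bar> / 2 *
      (- of_bool (j = k') + of_bool (j' = k)
       - of_bool (k < j \<and> j < k') * of_bool (j > 0)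
       + of_bool (k < j' \<and> j' < k') * of_bool (j' \<le> n)
       + of_bool (j < k \<and> k < j') * of_bool (k > 0)
       - of_bool (j < k' \<and> k' < j') * of_bool (k' \<le> n)))"

definition M_entry :: "nat \<Rightarrow> int \<Rightarrow> int \<Rightarrow> rat" where
  "M_entry r j k =
    cartan \<bar>letter r k\<bar> \<bar>letter r j\<bar> / 2 *
      (of_bool (next_index r j > int (n_len r) \<and> next_index r k > int (n_len r))
       + of_bool (j < 0 \<and> k < 0))"

text \<open>The sum is an integer (see \<open>of_int_Btilde\<close>), so the floor only changes its type.\<close>

definition Btilde :: "nat \<Rightarrow> int \<Rightarrow> int \<Rightarrow> int" where
  "Btilde r j k = \<lfloor>b_entry r j k + M_entry r j k\<rfloor>"

lemma finite_index_set: "finite (index_set r)"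
  by (simp add: index_set_def)

lemma next_index_cases:
  "(next_index r k \<in> index_set r \<and> \<bar>letter r (next_index r k)\<bar> = \<bar>letter r k\<bar>
      \<and> k < next_index r k)
   \<or> next_index r k = int (n_len r) + 1"
proof -
  let ?S = "{l \<in> index_set r. l > k \<and> \<bar>letter r l\<bar> = \<bar>letter r k\<bar>} \<union> {int (n_len r) + 1}"
  have "finite ?S" using finite_index_set[of r] by simp
  hence "Min ?S \<in> ?S" by (intro Min_in) auto
  thus ?thesis unfolding next_index_def by auto
qed

text \<open>The total of all brackets in the \<open>(j,k)\<close> entries of \<open>B\<close> and \<open>M\<close>: integrality needs it to be even
  when the Cartan entry is \<open>-1\<close>.\<close>

definition bracket_sum :: "int \<Rightarrow> int \<Rightarrow> int \<Rightarrow> int \<Rightarrow> int \<Rightarrow> int" where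
  "bracket_sum n j k j' k' =
      (- of_bool (j = k') + of_bool (j' = k)
       - of_bool (k < j \<and> j < k') * of_bool (j > 0)
       + of_bool (k < j' \<and> j' < k') * of_bool (j' \<le> n)
       + of_bool (j < k \<and> k < j') * of_bool (k > 0)
       - of_bool (j < k' \<and> k' < j') * of_bool (k' \<le> n))
      + (of_bool (j' > n \<and> k' > n) + of_bool (j < 0 \<and> k < 0))"

lemma even_bracket_sum:
  assumes "j \<noteq> k" "j' \<noteq> k" "k' \<noteq> j" "j' = k' \<longrightarrow> j' = n + 1" "j < j'" "k < k'"
    "j' \<le> n + 1" "k' \<le> n + 1" "j \<noteq> 0" "k \<noteq> 0" "j \<le> n" "k \<le> n"
    "j < 0 \<longrightarrow> j' > 0" "k < 0 \<longrightarrow> k' > 0"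
  shows "even (bracket_sum n j k j' k')"
proof (cases "j < k")
  case True
  show ?thesis
  proof (cases "j' < k")
    case True
    with assms \<open>j < k\<close> show ?thesis unfolding bracket_sum_def by (auto simp: of_bool_def)
  next
    case False
    consider "j' < k'" | "k' < j'" | "j' = n + 1 \<and> k' = n + 1" using assms(4) by linarith
    thus ?thesis
    proof cases
      case 1
      with assms False \<open>j < k\<close> show ?thesis unfolding bracket_sum_def by (auto simp: of_bool_def)
    next
      case 2
      with assms False \<open>j < k\<close> show ?thesis unfolding bracket_sum_def by (auto simp: of_bool_def)
    next
      case 3
      with assms(1,9-12) \<open>j < k\<close> show ?thesis unfolding bracket_sum_def by (auto simp: of_bool_def)
    qed
  qed
next
  case F: False
  show ?thesis
  proof (cases "k' < j")
    case True
    with assms F show ?thesis unfolding bracket_sum_def by (auto simp: of_bool_def)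
  next
    case False
    consider "j' < k'" | "k' < j'" | "j' = n + 1 \<and> k' = n + 1" using assms(4) by linarith
    thus ?thesis
    proof cases
      case 1
      with assms False F show ?thesis unfolding bracket_sum_def by (auto simp: of_bool_def)
    next
      case 2
      with assms False F show ?thesis unfolding bracket_sum_def by (auto simp: of_bool_def)
    next
      case 3
      with assms(1,9-12) F show ?thesis unfolding bracket_sum_def by (auto simp: of_bool_def)
    qed
  qed
qed

lemma of_int_Btilde:
  assumes j: "j \<in> index_set r" and k: "k \<in> index_set r"
  shows "of_int (Btilde r j k) = b_entry r j k + M_entry r j k"
proof -
  let ?n = "int (n_len r)" and ?j' = "next_index r j" and ?k' = "next_index r k"
  let ?S = "bracket_sum ?n j k ?j' ?k'" and ?c = "cartan \<bar>letter r k\<bar> \<bar>letter r j\<bar>"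
  have le: "i \<le> ?n" "i \<noteq> 0" if "i \<in> index_set r" for i
    using that by (auto simp: index_set_def)
  have gt: "i < next_index r i" "next_index r i \<le> ?n + 1" if i: "i \<in> index_set r" for i
    using next_index_cases[of r i] le(1)[OF i] le(1)[of "next_index r i"] by linarith+
  have pos: "i < 0 \<longrightarrow> next_index r i > 0" if i: "i \<in> index_set r" for i
  proof (rule impI, rule ccontr)
    assume "i < 0" and "\<not> next_index r i > 0"
    with next_index_cases[of r i] le(2)[of "next_index r i"]
    have "next_index r i < 0" "\<bar>letter r (next_index r i)\<bar> = \<bar>letter r i\<bar>" by linarith+
    with \<open>i < 0\<close> gt(1)[OF i] show False by (simp add: letter_def)
  qed
  have eq: "b_entry r j k + M_entry r j k = ?c / 2 * of_int ?S"
    unfolding b_entry_def M_entry_def bracket_sum_def Let_def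
    by (simp add: distrib_left)
  have "\<exists>z::int. ?c / 2 * of_int ?S = of_int z"
  proof (cases "\<bar>\<bar>letter r k\<bar> - \<bar>letter r j\<bar>\<bar> = 1")
    case False
    hence "?c / 2 = of_int 1 \<or> ?c / 2 = of_int 0" by (auto simp: cartan_def)
    thus ?thesis by (metis of_int_mult)
  next
    case True
    hence c: "?c = -1" by (auto simp: cartan_def)
    have ne: "\<bar>letter r j\<bar> \<noteq> \<bar>letter r k\<bar>" using True by linarith
    have "even ?S"
    proof (rule even_bracket_sum)
      show "j \<noteq> k" using ne by auto
      show "?j' \<noteq> k" using ne next_index_cases[of r j] le[OF k] by auto
      show "?k' \<noteq> j" using ne next_index_cases[of r k] le[OF j] by auto
      show "?j' = ?k' \<longrightarrow> ?j' = ?n + 1"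
        using ne next_index_cases[of r j] next_index_cases[of r k] by metis
    qed (use gt[OF j] gt[OF k] le[OF j] le[OF k] pos[OF j] pos[OF k] in simp_all)
    then obtain z where "?S = 2 * z" by (rule evenE)
    hence "?c / 2 * of_int ?S = of_int (- z)" by (simp add: c)
    thus ?thesis by blast
  qed
  thus ?thesis unfolding Btilde_def eq by (metis floor_of_int)
qed

definition cluster_torus :: "nat \<Rightarrow> (int \<Rightarrow> complex) set" where
  "cluster_torus r = (index_set r \<rightarrow>\<^sub>E (UNIV - {0}))"

definition p_M :: "nat \<Rightarrow> (int \<Rightarrow> complex) \<Rightarrow> int \<Rightarrow> complex" where
  "p_M r A i = (\<Prod>k \<in> index_set r. A k powi Btilde r i k)"

text \<open>The relabelling: \<open>pos r m d\<close> is the index written as the pair \<open>(m,d)\<close>, i.e. the position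
  of the \<open>m\<close>-th occurrence of the letter \<open>d\<close>.\<close>

definition pos :: "nat \<Rightarrow> nat \<Rightarrow> nat \<Rightarrow> int" where
  "pos r m d = (THE k. k \<in> {1..int (n_len r)} \<and> letter r k = int d
                       \<and> card {l \<in> {1..k}. letter r l = int d} = m)"

text \<open>On \<open>cluster_torus r\<close>, the open immersion with the prescribed pullbacks of minors: these
  minors do not vanish on its image and determine the point of \<open>double_cell r\<close>.\<close>

definition a_cluster :: "nat \<Rightarrow> (int \<Rightarrow> complex) \<Rightarrow> complex mat" where
  "a_cluster r A = (THE x. x \<in> double_cell r
     \<and> (\<forall>d \<in> {1..r}. minor {1..d} {1..d} x = A (- int d))
     \<and> (\<forall>d \<in> {1..r}. \<forall>m \<in> {1..r - d + 1}. minor {m + 1..m + d} {1..d} x = A (pos r m d)))"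

section \<open>Rational maps\<close>

text \<open>The inverse of an injection on \<open>S\<close>, as a partial map defined on the image.\<close>

definition partial_inv :: "'a set \<Rightarrow> ('a \<Rightarrow> 'b) \<Rightarrow> 'b \<rightharpoonup> 'a" where
  "partial_inv S f y = (if y \<in> f ` S then Some (the_inv_into S f y) else None)"

definition cluster_crystal ::
    "nat \<Rightarrow> nat \<Rightarrow> complex \<Rightarrow> (int \<Rightarrow> complex) \<rightharpoonup> (int \<Rightarrow> complex)" where
  "cluster_crystal r j c =
     partial_inv (cluster_torus r) (a_cluster r)
     \<circ>\<^sub>m partial_inv (double_cell r) (iota_anti r \<circ> zeta_twist r)
     \<circ>\<^sub>m crystal_e r j c
     \<circ>\<^sub>m (Some \<circ> (iota_anti r \<circ> zeta_twist r) \<circ> a_cluster r)"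

definition quot_opt :: "complex \<Rightarrow> complex \<Rightarrow> complex option" where
  "quot_opt a b = (if b = 0 then None else Some (a / b))"

inductive_set poly_funs :: "nat \<Rightarrow> ((int \<Rightarrow> complex) \<Rightarrow> complex) set" for r where
  const: "(\<lambda>A. a) \<in> poly_funs r"
| coord: "k \<in> index_set r \<Longrightarrow> (\<lambda>A. A k) \<in> poly_funs r"
| add: "f \<in> poly_funs r \<Longrightarrow> g \<in> poly_funs r \<Longrightarrow> (\<lambda>A. f A + g A) \<in> poly_funs r"
| mult: "f \<in> poly_funs r \<Longrightarrow> g \<in> poly_funs r \<Longrightarrow> (\<lambda>A. f A * g A) \<in> poly_funs r"

text \<open>Validity on a nonempty Zariski-open subset of the torus.\<close>

definition generically :: "nat \<Rightarrow> ((int \<Rightarrow> complex) \<Rightarrow> bool) \<Rightarrow> bool" where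
  "generically r Q \<longleftrightarrow> (\<exists>f \<in> poly_funs r. (\<exists>A \<in> cluster_torus r. f A \<noteq> 0)
                        \<and> (\<forall>A \<in> cluster_torus r. f A \<noteq> 0 \<longrightarrow> Q A))"

text \<open>Equality of two rational functions on the cluster torus: both are defined on a common dense
  open subset, and they agree at every point where both are defined.\<close>

definition rational_eq ::
    "nat \<Rightarrow> ((int \<Rightarrow> complex) \<rightharpoonup> complex) \<Rightarrow> ((int \<Rightarrow> complex) \<rightharpoonup> complex) \<Rightarrow> bool" where
  "rational_eq r F G \<longleftrightarrow>
     generically r (\<lambda>A. F A \<noteq> None \<and> G A \<noteq> None)
     \<and> (\<forall>A \<in> cluster_torus r. F A \<noteq> None \<longrightarrow> G A \<noteq> None \<longrightarrow> F A = G A)"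

end

theory Submission
  imports Defs
begin

text \<open>
  Let \<open>T = \<iota> \<circ> \<zeta>\<close>. The maps \<open>\<theta>\<close> and \<open>\<iota>\<close> are inverse transpose and inverse up to the same signs, so
  \<open>y = T(x)\<close> means that \<open>x \<in> N w\<^sub>0 y\<^sup>T\<close> with \<open>x, y\<close> both lower triangular. If
  \<open>y' = x\<^sub>j(a) y x\<^sub>j(b)\<close>, then \<open>x y\<^sub>j(a)\<close> lies in \<open>N w\<^sub>0 y'\<^sup>T\<close>, because \<open>w\<^sub>0 y\<^sub>j(b) w\<^sub>0\<^sup>-\<^sup>1 \<in> N\<close>. Hence the
  crystal operator becomes right multiplication of \<open>x\<close> by \<open>y\<^sub>j(a)\<close>, which changes only the minors with
  column set \<open>{1,\<dots>,j}\<close>, by \<open>a\<close> times the minor whose last column is moved to \<open>j + 1\<close>.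
  The quotient \<open>\<rho>\<^sub>m\<close> of these two minors satisfies, by the Desnanot--Jacobi identity,
  \<open>\<rho>\<^sub>s - \<rho>\<^sub>s\<^sub>-\<^sub>1 = A\<^bsub>s,j-1\<^esub> A\<^bsub>s-1,j+1\<^esub> / (A\<^bsub>s,j\<^esub> A\<^bsub>s-1,j\<^esub>)\<close>; successive differences have ratio \<open>P\<^bsub>s,j\<^esub>\<close>,
  and \<open>\<chi>\<^sub>j(y)\<close> is the last \<open>\<rho>\<close>.
\<close>

section \<open>Triangular matrices in the special linear group\<close>

text \<open>\<open>theta_aut\<close> and \<open>iota_anti\<close> are given by choice, so they are
  known only through their values on generators. The twist applies \<theta> to upper triangular
  matrices and \<iota> to lower triangular ones, so it suffices that the \<open>x_gen\<close>
  generate N. The inverse of the twist is never computed: it is injective on the double cell, and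
  one exhibited point x y_j(a) that it sends to the crystal image is enough. The shape of the answer
  comes from A_{m,j} becoming A_{m,j} (1 + (c - 1) \<rho>_m / \<chi>_j). Writing \<rho>_m and
  \<chi>_j as sums of differences splits \<chi>_j into the differences with s \<le> m, which receive
  the weight c, and the later ones. The products of the P are these differences divided by the last
  one, a divisor common to numerator and denominator. Equality of rational functions asks for a
  pointwise identity and for a nonzero polynomial off whose zeros both sides are defined. For the
  latter every new coordinate with letter j must be nonzero, not only the one at (m,d), since
  otherwise the image point leaves the cluster torus.\<close>

lemma SL_simps [simp]:
  "x \<otimes>\<^bsub>SL r\<^esub> y = x * y" "\<one>\<^bsub>SL r\<^esub> = 1\<^sub>m (Suc r)"
  by (simp_all add: SL_def)

lemma SL_carrier_iff: "x \<in> carrier (SL r) \<longleftrightarrow> x \<in> carrier_mat (Suc r) (Suc r) \<and> det x = 1"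
  by (simp add: SL_def)

lemma SL_carrierD [dest]: "x \<in> carrier (SL r) \<Longrightarrow> x \<in> carrier_mat (Suc r) (Suc r)"
  by (simp add: SL_carrier_iff)

lemma group_SL: "group (SL r)"
proof (rule groupI)
  fix x assume x: "x \<in> carrier (SL r)"
  hence c: "x \<in> carrier_mat (Suc r) (Suc r)" and d: "det x = 1" by (auto simp: SL_carrier_iff)
  have a: "adj_mat x * x = 1\<^sub>m (Suc r)" using adj_mat(3)[OF c] d by (auto intro: eq_matI)
  have "det (adj_mat x) = 1"
    using det_mult[OF adj_mat(1)[OF c] c] d a by simp
  hence "adj_mat x \<in> carrier (SL r)" using adj_mat(1)[OF c] by (simp add: SL_carrier_iff)
  thus "\<exists>y\<in>carrier (SL r). y \<otimes>\<^bsub>SL r\<^esub> x = \<one>\<^bsub>SL r\<^esub>" using a by auto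
next
  fix x y assume "x \<in> carrier (SL r)" "y \<in> carrier (SL r)"
  thus "x \<otimes>\<^bsub>SL r\<^esub> y \<in> carrier (SL r)"
    by (auto simp: SL_carrier_iff det_mult[of _ "Suc r"])
qed (auto simp: SL_carrier_iff)

lemma SL_mult [intro]: "x \<in> carrier (SL r) \<Longrightarrow> y \<in> carrier (SL r) \<Longrightarrow> x * y \<in> carrier (SL r)"
  using monoid.m_closed[OF group.is_monoid[OF group_SL]] by force

lemma SL_inv [intro]: "x \<in> carrier (SL r) \<Longrightarrow> inv\<^bsub>SL r\<^esub> x \<in> carrier (SL r)"
  using group.inv_closed[OF group_SL] by blast

lemma SL_inv_carrier [intro]: "x \<in> carrier (SL r) \<Longrightarrow> inv\<^bsub>SL r\<^esub> x \<in> carrier_mat (Suc r) (Suc r)"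
  using SL_inv by blast

lemma SL_inv_mult:
  assumes "x \<in> carrier (SL r)"
  shows "inv\<^bsub>SL r\<^esub> x * x = 1\<^sub>m (Suc r)" "x * inv\<^bsub>SL r\<^esub> x = 1\<^sub>m (Suc r)"
  using group.l_inv[OF group_SL assms] group.r_inv[OF group_SL assms] by simp_all

lemma SL_transpose [intro]: "x \<in> carrier (SL r) \<Longrightarrow> transpose_mat x \<in> carrier (SL r)"
  by (auto simp: SL_carrier_iff det_transpose)

lemma SL_assoc:
  assumes "x \<in> carrier (SL r)" "y \<in> carrier (SL r)" "z \<in> carrier (SL r)"
  shows "x * y * z = x * (y * z)"
  using assms by (auto intro: assoc_mult_mat)

lemma SL_cancel:
  assumes "x \<in> carrier (SL r)" "y \<in> carrier (SL r)"
  shows "inv\<^bsub>SL r\<^esub> x * (x * y) = y" "x * (inv\<^bsub>SL r\<^esub> x * y) = y"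
    "y * x * inv\<^bsub>SL r\<^esub> x = y" "y * inv\<^bsub>SL r\<^esub> x * x = y"
proof -
  have c: "inv\<^bsub>SL r\<^esub> x \<in> carrier (SL r)" using assms by auto
  have y: "y \<in> carrier_mat (Suc r) (Suc r)" using assms by auto
  note a = SL_inv_mult[OF assms(1)]
  show "inv\<^bsub>SL r\<^esub> x * (x * y) = y" using SL_assoc[OF c assms] a y by simp
  show "x * (inv\<^bsub>SL r\<^esub> x * y) = y" using SL_assoc[OF assms(1) c assms(2)] a y by simp
  show "y * x * inv\<^bsub>SL r\<^esub> x = y" using SL_assoc[OF assms(2) assms(1) c] a y by simp
  show "y * inv\<^bsub>SL r\<^esub> x * x = y" using SL_assoc[OF assms(2) c assms(1)] a y by simp
qed

lemma SL_mult_one [simp]: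
  "x \<in> carrier (SL r) \<Longrightarrow> x * 1\<^sub>m (Suc r) = x" "x \<in> carrier (SL r) \<Longrightarrow> 1\<^sub>m (Suc r) * x = x"
  by (auto dest: SL_carrierD)

lemma SL_one [simp]: "1\<^sub>m (Suc r) \<in> carrier (SL r)"
  by (simp add: SL_carrier_iff)

lemma SL_inv_eqI:
  assumes "x \<in> carrier (SL r)" "y \<in> carrier (SL r)" "y * x = 1\<^sub>m (Suc r)"
  shows "inv\<^bsub>SL r\<^esub> x = y"
  by (rule group.inv_equality[OF group_SL]) (use assms in simp_all)

lemma mult_index:
  assumes "x \<in> carrier_mat n k" "y \<in> carrier_mat k m" "i < n" "j < m"
  shows "(x * y) $$ (i, j) = (\<Sum>l<k. x $$ (i, l) * y $$ (l, j))"
  using assms by (simp add: scalar_prod_def atLeast0LessThan)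

section \<open>Upper triangular matrices: products and inverses\<close>

definition upper_SL :: "nat \<Rightarrow> complex mat set" where
  "upper_SL r = {x \<in> carrier (SL r). upper_triangular x}"

text \<open>A term of the product sum is nonzero only if i \<le> l \<le> j, and j \<le> i then
  leaves the single index l = i = j.\<close>

lemma upper_triangular_mult_index:
  assumes x: "x \<in> carrier_mat n n" "upper_triangular x"
    and y: "y \<in> carrier_mat n n" "upper_triangular y" and ij: "i < n" "j \<le> i"
  shows "(x * y) $$ (i, j) = (if i = j then x $$ (i, i) * y $$ (i, i) else 0)"
proof -
  have "x $$ (i, l) * y $$ (l, j) = (if l = i \<and> i = j then x $$ (i, i) * y $$ (i, i) else 0)"
    if l: "l < n" for l
  proof (cases "l < i")
    case True thus ?thesis using x ij by (auto dest: upper_triangularD)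
  next
    case False
    show ?thesis
    proof (cases "j < l")
      case True thus ?thesis using y l ij by (auto dest: upper_triangularD)
    next
      case 2: False
      hence "l = i" "i = j" using False ij by auto
      thus ?thesis by simp
    qed
  qed
  hence "(x * y) $$ (i, j) = (\<Sum>l<n. if l = i \<and> i = j then x $$ (i, i) * y $$ (i, i) else 0)"
    using x y ij by (subst mult_index[of _ n n _ n]) (auto intro!: sum.cong)
  also have "\<dots> = (if i = j then x $$ (i, i) * y $$ (i, i) else 0)"
    using ij by (auto simp: sum.delta)
  finally show ?thesis .
qed

lemma upper_SL_mult [intro]:
  assumes "x \<in> upper_SL r" "y \<in> upper_SL r" shows "x * y \<in> upper_SL r"
proof -
  have c: "x \<in> carrier_mat (Suc r) (Suc r)" "y \<in> carrier_mat (Suc r) (Suc r)"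
    using assms by (auto simp: upper_SL_def)
  have "upper_triangular (x * y)"
    using assms c upper_triangular_mult_index[of x "Suc r" y]
    by (intro upper_triangularI) (auto simp: upper_SL_def)
  thus ?thesis using assms by (auto simp: upper_SL_def)
qed

lemma upper_SL_diag_nonzero:
  assumes "x \<in> upper_SL r" "i < Suc r" shows "x $$ (i, i) \<noteq> 0"
proof
  assume 0: "x $$ (i, i) = 0"
  have c: "x \<in> carrier_mat (Suc r) (Suc r)" and ut: "upper_triangular x" and d: "det x = 1"
    using assms by (auto simp: upper_SL_def SL_carrier_iff)
  have "det x = 0"
    unfolding upper_triangular_imp_det_eq_0_iff[OF c ut] diag_mat_def set_map
    using 0 c assms(2) by (intro image_eqI[where x = i]) auto
  thus False using d by simp
qed

lemma upper_SL_inv [intro]: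
  assumes "x \<in> upper_SL r" shows "inv\<^bsub>SL r\<^esub> x \<in> upper_SL r"
proof -
  have xS: "x \<in> carrier (SL r)" using assms by (auto simp: upper_SL_def)
  define v where "v = inv\<^bsub>SL r\<^esub> x"
  have vS: "v \<in> carrier (SL r)" using xS by (auto simp: v_def)
  have c: "x \<in> carrier_mat (Suc r) (Suc r)" "v \<in> carrier_mat (Suc r) (Suc r)" using xS vS by auto
  have one: "v * x = 1\<^sub>m (Suc r)" using SL_inv_mult[OF xS] by (simp add: v_def)
  \<comment> \<open>Induction on the column: in the entry (i,j) of \<open>v * x\<close> the terms
    left of j vanish by induction and those right of j because x is upper triangular, so only the
    multiple of the nonzero diagonal entry of x remains.\<close>
  have "v $$ (i, j) = 0" if "j < i" "i < Suc r" for i j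
    using that
  proof (induction j arbitrary: i rule: less_induct)
    case (less j)
    have j: "j < Suc r" using less.prems by simp
    have "0 = (v * x) $$ (i, j)" using less.prems by (simp add: one)
    also have "\<dots> = (\<Sum>l<Suc r. v $$ (i, l) * x $$ (l, j))"
      by (rule mult_index[OF c(2,1) less.prems(2) j])
    also have "\<dots> = (\<Sum>l<Suc r. if l = j then v $$ (i, j) * x $$ (j, j) else 0)"
    proof (rule sum.cong[OF refl])
      fix l assume l: "l \<in> {..<Suc r}"
      consider "l < j" | "l = j" | "j < l" by linarith
      thus "v $$ (i, l) * x $$ (l, j) = (if l = j then v $$ (i, j) * x $$ (j, j) else 0)"
      proof cases
        case 1 thus ?thesis using less.IH[of l i] less.prems by simp
      next
        case 3
        have "x $$ (l, j) = 0"
          using assms c l 3 by (auto simp: upper_SL_def upper_triangular_def)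
        thus ?thesis using 3 by simp
      qed simp
    qed
    also have "\<dots> = v $$ (i, j) * x $$ (j, j)" using j by simp
    finally show ?case using upper_SL_diag_nonzero[OF assms j] by simp
  qed
  hence "upper_triangular v" using c by (intro upper_triangularI) auto
  thus ?thesis using vS by (simp add: upper_SL_def v_def)
qed

lemma N_plus_iff: "x \<in> N_plus r \<longleftrightarrow> x \<in> upper_SL r \<and> (\<forall>i<Suc r. x $$ (i, i) = 1)"
  by (auto simp: N_plus_def upper_SL_def)

lemma N_plus_mult [intro]:
  assumes "x \<in> N_plus r" "y \<in> N_plus r" shows "x * y \<in> N_plus r"
proof -
  have "x \<in> carrier_mat (Suc r) (Suc r)" "y \<in> carrier_mat (Suc r) (Suc r)"
    "upper_triangular x" "upper_triangular y"
    using assms by (auto simp: N_plus_def)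
  thus ?thesis using assms upper_triangular_mult_index[of x "Suc r" y]
    by (auto simp: N_plus_iff)
qed

lemma upper_SL_inv_diag:
  assumes "x \<in> upper_SL r" "i < Suc r"
  shows "(inv\<^bsub>SL r\<^esub> x) $$ (i, i) = inverse (x $$ (i, i))"
proof -
  have v: "inv\<^bsub>SL r\<^esub> x \<in> upper_SL r" using assms by auto
  have c: "x \<in> carrier_mat (Suc r) (Suc r)" "upper_triangular x"
    "inv\<^bsub>SL r\<^esub> x \<in> carrier_mat (Suc r) (Suc r)" "upper_triangular (inv\<^bsub>SL r\<^esub> x)"
    using assms v by (auto simp: upper_SL_def)
  have "(inv\<^bsub>SL r\<^esub> x * x) $$ (i, i) = (inv\<^bsub>SL r\<^esub> x) $$ (i, i) * x $$ (i, i)"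
    using upper_triangular_mult_index[OF c(3,4,1,2) assms(2)] by simp
  moreover have "inv\<^bsub>SL r\<^esub> x * x = 1\<^sub>m (Suc r)"
    using assms by (auto simp: upper_SL_def SL_inv_mult)
  ultimately show ?thesis using assms(2) upper_SL_diag_nonzero[OF assms]
    by (simp add: field_simps)
qed

lemma N_plus_inv [intro]: "x \<in> N_plus r \<Longrightarrow> inv\<^bsub>SL r\<^esub> x \<in> N_plus r"
  by (auto simp: N_plus_iff upper_SL_inv_diag)

lemma SL_inv_transpose:
  assumes "x \<in> carrier (SL r)"
  shows "inv\<^bsub>SL r\<^esub> (transpose_mat x) = transpose_mat (inv\<^bsub>SL r\<^esub> x)"
proof (rule SL_inv_eqI)
  have "transpose_mat (inv\<^bsub>SL r\<^esub> x) * transpose_mat x = transpose_mat (x * inv\<^bsub>SL r\<^esub> x)"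
    by (rule transpose_mult[symmetric, of _ "Suc r" "Suc r" _ "Suc r"]) (use assms in auto)
  thus "transpose_mat (inv\<^bsub>SL r\<^esub> x) * transpose_mat x = 1\<^sub>m (Suc r)"
    using assms by (simp add: SL_inv_mult)
qed (use assms in auto)

lemma SL_transpose_mult:
  assumes "x \<in> carrier (SL r)" "y \<in> carrier (SL r)"
  shows "transpose_mat (x * y) = transpose_mat y * transpose_mat x"
  by (rule transpose_mult[of _ "Suc r" "Suc r" _ "Suc r"]) (use assms in auto)

section \<open>Lower triangular matrices, inherited through transposition\<close>

definition lower_SL :: "nat \<Rightarrow> complex mat set" where
  "lower_SL r = {x \<in> carrier (SL r). transpose_mat x \<in> upper_SL r}"

lemma upper_SL_SL [dest]: "x \<in> upper_SL r \<Longrightarrow> x \<in> carrier (SL r)"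
  and lower_SL_SL [dest]: "x \<in> lower_SL r \<Longrightarrow> x \<in> carrier (SL r)"
  and N_plus_SL [dest]: "x \<in> N_plus r \<Longrightarrow> x \<in> carrier (SL r)"
  and N_minus_SL [dest]: "x \<in> N_minus r \<Longrightarrow> x \<in> carrier (SL r)"
  and torus_SL [dest]: "x \<in> torus_H r \<Longrightarrow> x \<in> carrier (SL r)"
  by (auto simp: upper_SL_def lower_SL_def N_plus_def N_minus_def torus_H_def)

lemma lower_SL_mult [intro]: "x \<in> lower_SL r \<Longrightarrow> y \<in> lower_SL r \<Longrightarrow> x * y \<in> lower_SL r"
  by (auto simp: lower_SL_def SL_transpose_mult)

lemma lower_SL_inv [intro]: "x \<in> lower_SL r \<Longrightarrow> inv\<^bsub>SL r\<^esub> x \<in> lower_SL r"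
  by (auto simp: lower_SL_def simp flip: SL_inv_transpose)

lemma N_minus_mult [intro]: "x \<in> N_minus r \<Longrightarrow> y \<in> N_minus r \<Longrightarrow> x * y \<in> N_minus r"
  by (auto simp: N_minus_def SL_transpose_mult)

lemma N_minus_inv [intro]: "x \<in> N_minus r \<Longrightarrow> inv\<^bsub>SL r\<^esub> x \<in> N_minus r"
  by (auto simp: N_minus_def simp flip: SL_inv_transpose)

lemma N_plus_subset_upper: "x \<in> N_plus r \<Longrightarrow> x \<in> upper_SL r"
  by (simp add: N_plus_iff)

lemma N_minus_subset_lower: "x \<in> N_minus r \<Longrightarrow> x \<in> lower_SL r"
  by (simp add: N_minus_def lower_SL_def N_plus_iff)

lemma torus_subset_upper: "x \<in> torus_H r \<Longrightarrow> x \<in> upper_SL r"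
  by (auto simp: torus_H_def upper_SL_def diagonal_mat_def SL_carrier_iff intro!: upper_triangularI)

lemma torus_transpose: "x \<in> torus_H r \<Longrightarrow> transpose_mat x = x"
  by (rule eq_matI) (auto simp: torus_H_def diagonal_mat_def SL_carrier_iff, metis)

lemma torus_subset_lower: "x \<in> torus_H r \<Longrightarrow> x \<in> lower_SL r"
  using torus_subset_upper torus_transpose by (auto simp: lower_SL_def)

lemma upper_SL_index: "x \<in> upper_SL r \<Longrightarrow> j < i \<Longrightarrow> i < Suc r \<Longrightarrow> x $$ (i, j) = 0"
  by (auto simp: upper_SL_def SL_carrier_iff dest!: upper_triangularD)

lemma upper_SLI:
  assumes "x \<in> carrier (SL r)" "\<And>i j. j < i \<Longrightarrow> i < Suc r \<Longrightarrow> x $$ (i, j) = 0"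
  shows "x \<in> upper_SL r"
  using assms by (auto simp: upper_SL_def SL_carrier_iff intro!: upper_triangularI)

lemma lower_SL_index: "x \<in> lower_SL r \<Longrightarrow> i < j \<Longrightarrow> j < Suc r \<Longrightarrow> x $$ (i, j) = 0"
  using upper_SL_index[of "transpose_mat x" r i j] by (auto simp: lower_SL_def SL_carrier_iff)

lemma lower_SLI:
  assumes "x \<in> carrier (SL r)" "\<And>i j. i < j \<Longrightarrow> j < Suc r \<Longrightarrow> x $$ (i, j) = 0"
  shows "x \<in> lower_SL r"
  using assms unfolding lower_SL_def by (auto simp: SL_carrier_iff intro!: upper_SLI det_transpose)

lemma N_minus_iff: "x \<in> N_minus r \<longleftrightarrow> x \<in> lower_SL r \<and> (\<forall>i<Suc r. x $$ (i, i) = 1)"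
  by (auto simp: N_minus_def lower_SL_def N_plus_iff SL_carrier_iff)

lemma transpose_triangular [intro]:
  "x \<in> N_plus r \<Longrightarrow> transpose_mat x \<in> N_minus r"
  "x \<in> N_minus r \<Longrightarrow> transpose_mat x \<in> N_plus r"
  "x \<in> upper_SL r \<Longrightarrow> transpose_mat x \<in> lower_SL r"
  "x \<in> lower_SL r \<Longrightarrow> transpose_mat x \<in> upper_SL r"
  by (auto simp: N_minus_def lower_SL_def)

lemma N_plus_Int_lower:
  assumes "x \<in> N_plus r" "x \<in> lower_SL r" shows "x = 1\<^sub>m (Suc r)"
proof (rule eq_matI)
  fix i j assume "i < dim_row (1\<^sub>m (Suc r))" "j < dim_col (1\<^sub>m (Suc r))"
  thus "x $$ (i, j) = 1\<^sub>m (Suc r) $$ (i, j)"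
    using assms upper_SL_index[of x r j i] lower_SL_index[of x r i j]
    by (cases i j rule: linorder_cases) (auto simp: N_plus_iff)
qed (use assms in \<open>auto simp: N_plus_def SL_carrier_iff\<close>)

lemma N_minus_Int_upper:
  assumes "x \<in> N_minus r" "x \<in> upper_SL r" shows "x = 1\<^sub>m (Suc r)"
proof -
  have "transpose_mat x = 1\<^sub>m (Suc r)"
    using assms by (intro N_plus_Int_lower) (auto simp: N_minus_def lower_SL_def)
  thus ?thesis by (metis transpose_transpose transpose_one)
qed

section \<open>Torus factors and the Borel subgroups\<close>

definition diag_part :: "nat \<Rightarrow> complex mat \<Rightarrow> complex mat" where
  "diag_part r x = mat (Suc r) (Suc r) (\<lambda>(i, j). if i = j then x $$ (i, i) else 0)"

lemma diag_part_upper_torus: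
  assumes "x \<in> upper_SL r" shows "diag_part r x \<in> torus_H r"
proof -
  have c: "x \<in> carrier_mat (Suc r) (Suc r)" "upper_triangular x" "det x = 1"
    using assms by (auto simp: upper_SL_def SL_carrier_iff)
  have "det (diag_part r x) = prod_list (diag_mat (diag_part r x))"
    by (rule det_upper_triangular[of _ "Suc r"])
       (auto simp: diag_part_def intro!: upper_triangularI)
  also have "diag_mat (diag_part r x) = diag_mat x"
    using c by (auto simp: diag_mat_def diag_part_def)
  also have "prod_list (diag_mat x) = 1" using det_upper_triangular[OF c(2,1)] c(3) by simp
  finally show ?thesis by (auto simp: torus_H_def SL_carrier_iff diag_part_def diagonal_mat_def)
qed

lemma diag_part_lower_torus:
  assumes "x \<in> lower_SL r" shows "diag_part r x \<in> torus_H r"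
proof -
  have "diag_part r x = diag_part r (transpose_mat x)"
    using SL_carrierD[OF lower_SL_SL[OF assms]] by (auto simp: diag_part_def intro!: eq_matI)
  thus ?thesis using diag_part_upper_torus[of "transpose_mat x" r] assms
    by (auto simp: lower_SL_def)
qed

lemma torus_inv:
  assumes "t \<in> torus_H r" shows "inv\<^bsub>SL r\<^esub> t \<in> torus_H r"
proof -
  have "inv\<^bsub>SL r\<^esub> t \<in> upper_SL r" "inv\<^bsub>SL r\<^esub> t \<in> lower_SL r"
    using assms torus_subset_upper torus_subset_lower by auto
  hence "(inv\<^bsub>SL r\<^esub> t) $$ (i, j) = 0" if "i < Suc r" "j < Suc r" "i \<noteq> j" for i j
    using that lower_SL_index upper_SL_index by (metis linorder_neqE_nat)
  thus ?thesis using assms SL_inv_carrier[of t r]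
    unfolding torus_H_def diagonal_mat_def by auto
qed

text \<open>Replaces the product HN by a condition on matrix entries, for which closure under
  products and inverses is already known.\<close>

lemma B_plus_eq: "B_plus r = upper_SL r"
proof (intro Set.set_eqI iffI)
  fix x assume "x \<in> B_plus r"
  thus "x \<in> upper_SL r"
    using torus_subset_upper N_plus_subset_upper by (auto simp: B_plus_def)
next
  fix x assume x: "x \<in> upper_SL r"
  let ?t = "diag_part r x"
  have t: "?t \<in> torus_H r" by (rule diag_part_upper_torus[OF x])
  have tu: "inv\<^bsub>SL r\<^esub> ?t \<in> upper_SL r" using t torus_subset_upper by auto
  have n: "inv\<^bsub>SL r\<^esub> ?t * x \<in> N_plus r"
  proof -
    have "(inv\<^bsub>SL r\<^esub> ?t * x) $$ (i, i) = 1" if i: "i < Suc r" for i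
      using upper_triangular_mult_index[of "inv\<^bsub>SL r\<^esub> ?t" "Suc r" x i i] i x tu
        upper_SL_inv_diag[OF torus_subset_upper[OF t] i] upper_SL_diag_nonzero[OF x i]
        SL_carrierD[OF upper_SL_SL[OF x]] SL_carrierD[OF upper_SL_SL[OF tu]]
      by (simp add: upper_SL_def) (simp add: diag_part_def)
    thus ?thesis using tu x by (auto simp: N_plus_iff)
  qed
  have "x = ?t * (inv\<^bsub>SL r\<^esub> ?t * x)" using SL_cancel(2)[OF torus_SL[OF t] upper_SL_SL[OF x]] by simp
  thus "x \<in> B_plus r" using t n unfolding B_plus_def by blast
qed

text \<open>Both orders of the factors occur: B^- is written as HN^-, whereas the crystal functions
  are read off x = nt.\<close>

lemma lower_SL_factor:
  assumes x: "x \<in> lower_SL r"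
  shows "x * inv\<^bsub>SL r\<^esub> (diag_part r x) \<in> N_minus r"
    "x = x * inv\<^bsub>SL r\<^esub> (diag_part r x) * diag_part r x"
    "inv\<^bsub>SL r\<^esub> (diag_part r x) * x \<in> N_minus r"
    "x = diag_part r x * (inv\<^bsub>SL r\<^esub> (diag_part r x) * x)"
proof -
  let ?t = "diag_part r x"
  have t: "?t \<in> torus_H r" by (rule diag_part_lower_torus[OF x])
  have tu: "inv\<^bsub>SL r\<^esub> ?t \<in> upper_SL r" using t torus_subset_upper by auto
  have tt: "transpose_mat (inv\<^bsub>SL r\<^esub> ?t) = inv\<^bsub>SL r\<^esub> ?t" using torus_inv[OF t] torus_transpose by blast
  have xt: "transpose_mat x \<in> upper_SL r" using x by (auto simp: lower_SL_def)
  have S: "x \<in> carrier (SL r)" "?t \<in> carrier (SL r)" "inv\<^bsub>SL r\<^esub> ?t \<in> carrier (SL r)"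
    using x t by auto
  hence c: "x \<in> carrier_mat (Suc r) (Suc r)" "inv\<^bsub>SL r\<^esub> ?t \<in> carrier_mat (Suc r) (Suc r)" by auto
  have d: "(inv\<^bsub>SL r\<^esub> ?t) $$ (i, i) * x $$ (i, i) = 1" if i: "i < Suc r" for i
    using i upper_SL_inv_diag[OF torus_subset_upper[OF t] i] upper_SL_diag_nonzero[OF xt i] c
    by (auto simp: diag_part_def)
  have "(inv\<^bsub>SL r\<^esub> ?t * transpose_mat x) $$ (i, i) = 1"
    "(transpose_mat x * inv\<^bsub>SL r\<^esub> ?t) $$ (i, i) = 1" if i: "i < Suc r" for i
    using upper_triangular_mult_index[of "inv\<^bsub>SL r\<^esub> ?t" "Suc r" "transpose_mat x" i i]
      upper_triangular_mult_index[of "transpose_mat x" "Suc r" "inv\<^bsub>SL r\<^esub> ?t" i i] i xt tu d[OF i] c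
    by (auto simp: upper_SL_def mult.commute)
  hence "inv\<^bsub>SL r\<^esub> ?t * transpose_mat x \<in> N_plus r" "transpose_mat x * inv\<^bsub>SL r\<^esub> ?t \<in> N_plus r"
    using tu xt by (auto simp: N_plus_iff)
  thus "x * inv\<^bsub>SL r\<^esub> ?t \<in> N_minus r" "inv\<^bsub>SL r\<^esub> ?t * x \<in> N_minus r"
    using S by (auto simp: N_minus_def SL_transpose_mult tt)
  show "x = x * inv\<^bsub>SL r\<^esub> (diag_part r x) * diag_part r x"
    "x = diag_part r x * (inv\<^bsub>SL r\<^esub> (diag_part r x) * x)"
    using SL_cancel[of ?t r x] S by auto
qed

lemma B_minus_eq: "B_minus r = lower_SL r"
proof (intro Set.set_eqI iffI)
  fix x assume "x \<in> B_minus r"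
  thus "x \<in> lower_SL r"
    using torus_subset_lower N_minus_subset_lower by (auto simp: B_minus_def)
next
  fix x assume "x \<in> lower_SL r"
  thus "x \<in> B_minus r"
    using lower_SL_factor(3,4)[of x r] diag_part_lower_torus[of x r] unfolding B_minus_def by blast
qed

section \<open>The twist on triangular matrices\<close>

lemmas SL_memb [simp] = SL_mult SL_inv SL_inv_carrier SL_transpose SL_carrierD torus_inv

section \<open>Elementary matrices and the generation of N\<close>

abbreviation elementary :: "nat \<Rightarrow> nat \<Rightarrow> nat \<Rightarrow> complex \<Rightarrow> complex mat" where
  "elementary r p q c \<equiv> addrow_mat (Suc r) c p q"

text \<open>Identifies the root subgroups with row operations I + c E_{p,q}; the indices p, q are
  0-based, whence the pairs (i-1,i) and (i,i-1).\<close>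

lemma x_gen_elementary: "1 \<le> i \<Longrightarrow> i \<le> r \<Longrightarrow> x_gen r i c = elementary r (i - 1) i c"
  and y_gen_elementary: "1 \<le> i \<Longrightarrow> i \<le> r \<Longrightarrow> y_gen r i c = elementary r i (i - 1) c"
  by (auto simp: x_gen_def y_gen_def unit_mat_def intro!: eq_matI)

lemma elementary_SL: "p \<noteq> q \<Longrightarrow> elementary r p q c \<in> carrier (SL r)"
  by (simp add: SL_carrier_iff det_addrow_mat)

lemma elementary_inv:
  assumes "p \<noteq> q" "q < Suc r"
  shows "inv\<^bsub>SL r\<^esub> (elementary r p q c) = elementary r p q (- c)"
proof (rule SL_inv_eqI)
  have "elementary r p q (- c) * elementary r p q c = addrow (- c) p q (elementary r p q c)"
    by (rule addrow_mat[symmetric, of _ _ "Suc r"]) (use assms in auto)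
  also have "\<dots> = 1\<^sub>m (Suc r)" by (rule eq_matI) (use assms in auto)
  finally show "elementary r p q (- c) * elementary r p q c = 1\<^sub>m (Suc r)" .
qed (use assms elementary_SL in auto)

lemma elementary_upper: "p < q \<Longrightarrow> elementary r p q c \<in> N_plus r"
  by (auto simp: N_plus_def elementary_SL intro!: upper_triangularI)

lemma elementary_transpose: "transpose_mat (elementary r p q c) = elementary r q p c"
  by (rule eq_matI) auto

lemma elementary_lower: "q < p \<Longrightarrow> elementary r p q c \<in> N_minus r"
  using elementary_upper[of q p r c] by (simp add: N_minus_def elementary_SL elementary_transpose)

lemma elementary_mult: "A \<in> carrier_mat (Suc r) (Suc r) \<Longrightarrow> q < Suc r \<Longrightarrow> elementary r p q c * A = addrow c p q A"
  by (rule addrow_mat[symmetric])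

text \<open>The commutator relation between root subgroups: a root that is a sum of two positive
  roots is reached from them by a group commutator.\<close>

lemma elementary_commutator:
  assumes "p < q" "q < s" "s < Suc r"
  shows "elementary r p s c
    = elementary r p q c * (elementary r q s 1 * (elementary r p q (- c) * elementary r q s (- 1)))"
proof -
  have "elementary r p s c = addrow c p q (addrow 1 q s (addrow (- c) p q (elementary r q s (- 1))))"
  proof (rule eq_matI)
    fix i j assume "i < dim_row (addrow c p q (addrow 1 q s (addrow (- c) p q (elementary r q s (- 1)))))"
      "j < dim_col (addrow c p q (addrow 1 q s (addrow (- c) p q (elementary r q s (- 1)))))"
    hence ij: "i < Suc r" "j < Suc r" by auto
    consider "i = p" | "i = q" | "i \<noteq> p" "i \<noteq> q" by blast
    thus "elementary r p s c $$ (i, j) = addrow c p q (addrow 1 q s (addrow (- c) p q (elementary r q s (- 1)))) $$ (i, j)"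
      using ij assms by cases simp_all
  qed (use assms in simp_all)
  thus ?thesis using assms by (simp add: elementary_mult)
qed

text \<open>Induction on the height q - p of the root: height one is a generator, and each further
  step is a commutator with the next simple root.\<close>

lemma elementary_gen_induct:
  assumes mult: "\<And>x y. x \<in> N_plus r \<Longrightarrow> y \<in> N_plus r \<Longrightarrow> P x \<Longrightarrow> P y \<Longrightarrow> P (x * y)"
    and gen: "\<And>i c. i \<in> {1..r} \<Longrightarrow> P (x_gen r i c)"
    and "p < q" "q < Suc r"
  shows "P (elementary r p q c)"
proof -
  define k where "k = q - p - 1"
  have q: "q = p + Suc k" using assms by (simp add: k_def)
  have "P (elementary r p (p + Suc k) c)" if "p + Suc k < Suc r" for c
    using that
  proof (induction k arbitrary: c)
    case 0
    thus ?case using gen[of "Suc p" c] x_gen_elementary[of "Suc p" r c] by simp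
  next
    case (Suc k)
    let ?q = "p + Suc k"
    have s: "P (elementary r ?q (Suc ?q) c)" for c
      using Suc.prems gen[of "Suc ?q" c] x_gen_elementary[of "Suc ?q" r c] by simp
    have "elementary r p (Suc ?q) c
      = elementary r p ?q c * (elementary r ?q (Suc ?q) 1 * (elementary r p ?q (- c) * elementary r ?q (Suc ?q) (- 1)))"
      using Suc.prems by (intro elementary_commutator) auto
    moreover have "P \<dots>"
      using Suc.prems s Suc.IH by (intro mult N_plus_mult elementary_upper) auto
    ultimately show ?case by simp
  qed
  thus ?thesis using assms q by simp
qed

text \<open>If \<open>p\<close> is the lowest nontrivial row, row \<open>q\<close> is a unit vector, so a row operation clears the entry
  \<open>(p, q)\<close> and changes no other one.\<close>

lemma N_plus_induct [consumes 1]: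
  assumes u: "u \<in> N_plus r"
    and one: "P (1\<^sub>m (Suc r))"
    and mult: "\<And>x y. x \<in> N_plus r \<Longrightarrow> y \<in> N_plus r \<Longrightarrow> P x \<Longrightarrow> P y \<Longrightarrow> P (x * y)"
    and gen: "\<And>i c. i \<in> {1..r} \<Longrightarrow> P (x_gen r i c)"
  shows "P u"
  using u
proof (induction "card {(p, q). p < q \<and> q < Suc r \<and> u $$ (p, q) \<noteq> 0}" arbitrary: u
    rule: less_induct)
  case less
  let ?Z = "\<lambda>u. {(p, q). p < q \<and> q < Suc r \<and> u $$ (p, q) \<noteq> (0::complex)}"
  have fin: "finite (?Z v)" for v
    by (rule finite_subset[of _ "{..<Suc r} \<times> {..<Suc r}"]) auto
  have c: "u \<in> carrier_mat (Suc r) (Suc r)" and up: "u \<in> upper_SL r"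
    using less.prems by (auto intro: N_plus_subset_upper)
  have d: "u $$ (i, i) = 1" if "i < Suc r" for i
    using less.prems that by (simp_all add: N_plus_iff)
  show ?case
  proof (cases "?Z u = {}")
    case True
    have z: "u $$ (i, j) = 0" if "i < j" "j < Suc r" for i j using True that by blast
    have "u = 1\<^sub>m (Suc r)"
    proof (rule eq_matI)
      fix i j assume "i < dim_row (1\<^sub>m (Suc r))" "j < dim_col (1\<^sub>m (Suc r))"
      thus "u $$ (i, j) = 1\<^sub>m (Suc r) $$ (i, j)"
        using z[of i j] d[of i] upper_SL_index[OF up, of j i]
        by (cases i j rule: linorder_cases) auto
    qed (use c in auto)
    thus ?thesis using one by simp
  next
    case False
    define p where "p = Max (fst ` ?Z u)"
    have "p \<in> fst ` ?Z u" unfolding p_def by (rule Max_in) (use False fin in auto)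
    then obtain q where pq: "p < q" "q < Suc r" "u $$ (p, q) \<noteq> 0" by auto
    have max: "u $$ (i, j) = 0" if "p < i" "i < j" "j < Suc r" for i j
    proof (rule ccontr)
      assume "u $$ (i, j) \<noteq> 0"
      hence "(i, j) \<in> ?Z u" using that by blast
      hence "i \<in> fst ` ?Z u" by (rule image_eqI[rotated]) simp
      hence "i \<le> p" unfolding p_def using fin by (intro Max_ge) auto
      thus False using that by simp
    qed
    have uq: "u $$ (q, j) = (if j = q then 1 else 0)" if "j < Suc r" for j
      using that d[of q] upper_SL_index[OF up, of j q] max[of q j] pq
      by (cases j q rule: linorder_cases) auto
    define v where "v = elementary r p q (- u $$ (p, q)) * u"
    have v: "v = addrow (- u $$ (p, q)) p q u"
      unfolding v_def using c pq by (intro elementary_mult) auto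
    have vN: "v \<in> N_plus r" unfolding v_def by (rule N_plus_mult[OF elementary_upper[OF pq(1)] less.prems])
    have vu: "v $$ (i, j) = (if (i, j) = (p, q) then 0 else u $$ (i, j))"
      if "i < Suc r" "j < Suc r" for i j
      using that c uq[of j] pq unfolding v by auto
    have "?Z v = ?Z u - {(p, q)}"
    proof (rule Set.set_eqI)
      fix z
      show "z \<in> ?Z v \<longleftrightarrow> z \<in> ?Z u - {(p, q)}"
        using vu[of "fst z" "snd z"] by (cases z) (auto split: if_splits)
    qed
    moreover have "(p, q) \<in> ?Z u" using pq by auto
    ultimately have "card (?Z v) < card (?Z u)" using fin[of u] by (simp only: card_Diff1_less)
    hence "P v" using less.hyps[of v] vN by blast
    moreover have "P (elementary r p q (u $$ (p, q)))"
      by (rule elementary_gen_induct[OF mult gen pq(1,2)])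
    ultimately have "P (elementary r p q (u $$ (p, q)) * v)"
      by (intro mult elementary_upper pq vN)
    also have "elementary r p q (u $$ (p, q)) = inv\<^bsub>SL r\<^esub> (elementary r p q (- u $$ (p, q)))"
      using pq by (simp add: elementary_inv)
    also have "\<dots> * v = u"
      unfolding v_def by (rule SL_cancel(1)) (use less.prems pq elementary_SL[of p q] in auto)
    finally show ?thesis .
  qed
qed

section \<open>Explicit models of \<theta> and \<iota>\<close>

definition sign_conj :: "nat \<Rightarrow> complex mat \<Rightarrow> complex mat" where
  "sign_conj r x = mat (Suc r) (Suc r) (\<lambda>(i, j). (- 1) ^ (i + j) * x $$ (i, j))"

lemma sign_conj_mult:
  assumes "x \<in> carrier_mat (Suc r) (Suc r)" "y \<in> carrier_mat (Suc r) (Suc r)"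
  shows "sign_conj r (x * y) = sign_conj r x * sign_conj r y"
proof (rule eq_matI)
  fix i j assume "i < dim_row (sign_conj r x * sign_conj r y)"
    "j < dim_col (sign_conj r x * sign_conj r y)"
  hence ij: "i < Suc r" "j < Suc r" by (auto simp: sign_conj_def)
  have "sign_conj r (x * y) $$ (i, j) = (\<Sum>l<Suc r. (- 1) ^ (i + j) * (x $$ (i, l) * y $$ (l, j)))"
    using ij assms by (simp add: sign_conj_def mult_index[OF assms] sum_distrib_left del: index_mult_mat(1) sum.lessThan_Suc)
  also have "\<dots> = (\<Sum>l<Suc r. sign_conj r x $$ (i, l) * sign_conj r y $$ (l, j))"
  proof (rule sum.cong[OF refl])
    fix l assume "l \<in> {..<Suc r}"
    moreover have "(- 1 :: complex) ^ (i + j) = (- 1) ^ (i + l) * (- 1) ^ (l + j)"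
    proof -
      have "(- 1 :: complex) ^ (i + l) * (- 1) ^ (l + j) = (- 1) ^ (i + j + 2 * l)"
        unfolding power_add[symmetric] by (rule arg_cong[of _ _ "(^) (- 1)"]) simp
      thus ?thesis by (simp only: power_add power_mult) simp
    qed
    ultimately show "(- 1) ^ (i + j) * (x $$ (i, l) * y $$ (l, j))
      = sign_conj r x $$ (i, l) * sign_conj r y $$ (l, j)"
      using ij by (simp add: sign_conj_def)
  qed
  also have "\<dots> = (sign_conj r x * sign_conj r y) $$ (i, j)"
    by (rule mult_index[symmetric]) (use ij in \<open>auto simp: sign_conj_def\<close>)
  finally show "sign_conj r (x * y) $$ (i, j) = (sign_conj r x * sign_conj r y) $$ (i, j)" .
qed (use assms in \<open>auto simp: sign_conj_def\<close>)

lemma sign_conj_involution: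
  assumes "x \<in> carrier_mat (Suc r) (Suc r)"
  shows "sign_conj r (sign_conj r x) = x"
  using assms by (auto simp: sign_conj_def mult.assoc[symmetric] power_mult_distrib[symmetric] intro!: eq_matI)

lemma sign_conj_SL [simp]:
  assumes "x \<in> carrier (SL r)" shows "sign_conj r x \<in> carrier (SL r)"
proof -
  \<comment> \<open>\<open>sign_conj\<close> is conjugation by the diagonal matrix D with entries 1,
    -1, 1, ...; since D D = 1, the determinant is unchanged.\<close>
  define D :: "complex mat" where "D = mat (Suc r) (Suc r) (\<lambda>(i, j). if i = j then (- 1) ^ i else 0)"
  have c: "x \<in> carrier_mat (Suc r) (Suc r)" "D \<in> carrier_mat (Suc r) (Suc r)"
    using assms by (auto simp: D_def)
  have l: "(D * y) $$ (i, j) = (- 1) ^ i * y $$ (i, j)"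
    if "y \<in> carrier_mat (Suc r) (Suc r)" "i < Suc r" "j < Suc r" for y i j
  proof -
    have "(D * y) $$ (i, j) = (\<Sum>l<Suc r. if l = i then (- 1) ^ i * y $$ (i, j) else 0)"
      unfolding mult_index[OF c(2) that] by (rule sum.cong) (use that in \<open>auto simp: D_def\<close>)
    thus ?thesis using that by (simp del: sum.lessThan_Suc)
  qed
  have rr: "(y * D) $$ (i, j) = y $$ (i, j) * (- 1) ^ j"
    if "y \<in> carrier_mat (Suc r) (Suc r)" "i < Suc r" "j < Suc r" for y i j
  proof -
    have "(y * D) $$ (i, j) = (\<Sum>l<Suc r. if l = j then y $$ (i, j) * (- 1) ^ j else 0)"
      unfolding mult_index[OF that(1) c(2) that(2,3)] by (rule sum.cong) (use that in \<open>auto simp: D_def\<close>)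
    thus ?thesis using that by (simp del: sum.lessThan_Suc)
  qed
  have "sign_conj r x = D * x * D"
    by (rule eq_matI) (use c in \<open>auto simp: sign_conj_def l rr power_add simp del: index_mult_mat(1)\<close>)
  hence "det (sign_conj r x) = det D * det x * det D"
    using c by (simp add: det_mult[of _ "Suc r"])
  moreover have "D * D = 1\<^sub>m (Suc r)"
    by (rule eq_matI)
      (use c in \<open>auto simp: l power_mult_distrib[symmetric] simp del: index_mult_mat(1), simp_all add: D_def power_mult_distrib[symmetric]\<close>)
  hence "det D * det D = 1" using det_mult[OF c(2) c(2)] by simp
  ultimately show ?thesis using assms by (auto simp: SL_carrier_iff sign_conj_def)
qed

lemma sign_conj_torus:
  assumes "t \<in> torus_H r" shows "sign_conj r t = t"
proof (rule eq_matI)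
  fix i j assume "i < dim_row t" "j < dim_col t"
  thus "sign_conj r t $$ (i, j) = t $$ (i, j)"
    using assms by (cases "i = j") (auto simp: torus_H_def diagonal_mat_def sign_conj_def SL_carrier_iff simp flip: mult_2)
qed (use assms in \<open>auto simp: torus_H_def sign_conj_def SL_carrier_iff\<close>)

lemma sign_conj_elementary: "p < Suc r \<Longrightarrow> q < Suc r \<Longrightarrow> q = Suc p \<or> p = Suc q \<Longrightarrow>
    sign_conj r (elementary r p q c) = elementary r p q (- c)"
  by (rule eq_matI) (auto simp: sign_conj_def simp flip: mult_2)

text \<open>The inverse transpose sends x_i(T) to y_i(-T), and the sign conjugation turns -T back
  into T. With \<open>iota0\<close> this gives concrete solutions of the conditions by which
  \<theta> and \<iota> are chosen, so the choice operator really returns maps with these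
  properties.\<close>

definition theta0 :: "nat \<Rightarrow> complex mat \<Rightarrow> complex mat" where
  "theta0 r x = sign_conj r (inv\<^bsub>SL r\<^esub> (transpose_mat x))"

definition iota0 :: "nat \<Rightarrow> complex mat \<Rightarrow> complex mat" where
  "iota0 r x = sign_conj r (inv\<^bsub>SL r\<^esub> x)"

lemma SL_inv_inv: "x \<in> carrier (SL r) \<Longrightarrow> inv\<^bsub>SL r\<^esub> (inv\<^bsub>SL r\<^esub> x) = x"
  by (rule group.inv_inv[OF group_SL])

lemma SL_inv_mult_group: "x \<in> carrier (SL r) \<Longrightarrow> y \<in> carrier (SL r) \<Longrightarrow>
    inv\<^bsub>SL r\<^esub> (x * y) = inv\<^bsub>SL r\<^esub> y * inv\<^bsub>SL r\<^esub> x"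
  using group.inv_mult_group[OF group_SL] by force

lemma sign_conj_inv:
  assumes "x \<in> carrier (SL r)"
  shows "inv\<^bsub>SL r\<^esub> (sign_conj r x) = sign_conj r (inv\<^bsub>SL r\<^esub> x)"
proof (rule SL_inv_eqI)
  have "sign_conj r (inv\<^bsub>SL r\<^esub> x) * sign_conj r x = sign_conj r (1\<^sub>m (Suc r))"
    using sign_conj_mult[of "inv\<^bsub>SL r\<^esub> x" r x] assms by (simp add: SL_inv_mult)
  also have "\<dots> = 1\<^sub>m (Suc r)" by (rule eq_matI) (auto simp: sign_conj_def simp flip: mult_2)
  finally show "sign_conj r (inv\<^bsub>SL r\<^esub> x) * sign_conj r x = 1\<^sub>m (Suc r)" .
qed (use assms in auto)

lemma iota0_bij: "bij_betw (iota0 r) (carrier (SL r)) (carrier (SL r))"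
proof (rule bij_betwI[where g = "iota0 r"])
  show "iota0 r (iota0 r x) = x" if "x \<in> carrier (SL r)" for x
    using that SL_inv_carrier[of x r] sign_conj_inv[of "inv\<^bsub>SL r\<^esub> x" r] sign_conj_involution[of x r]
    by (auto simp: iota0_def SL_inv_inv)
  thus "iota0 r (iota0 r x) = x" if "x \<in> carrier (SL r)" for x using that .
qed (auto simp: iota0_def)

lemma theta0_bij: "bij_betw (theta0 r) (carrier (SL r)) (carrier (SL r))"
proof -
  have "bij_betw transpose_mat (carrier (SL r)) (carrier (SL r))"
    by (rule bij_betwI[where g = transpose_mat]) auto
  moreover have "theta0 r = iota0 r \<circ> transpose_mat" by (auto simp: theta0_def iota0_def)
  ultimately show ?thesis using iota0_bij bij_betw_trans by metis
qed

lemma iota0_mult: "x \<in> carrier (SL r) \<Longrightarrow> y \<in> carrier (SL r) \<Longrightarrow> iota0 r (x * y) = iota0 r y * iota0 r x"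
  by (auto simp: iota0_def SL_inv_mult_group sign_conj_mult)

lemma theta0_mult: "x \<in> carrier (SL r) \<Longrightarrow> y \<in> carrier (SL r) \<Longrightarrow> theta0 r (x * y) = theta0 r x * theta0 r y"
  using iota0_mult[of "transpose_mat y" r "transpose_mat x"]
  by (auto simp: theta0_def SL_transpose_mult iota0_def)

lemma iota0_torus: "a \<in> torus_H r \<Longrightarrow> iota0 r a = inv\<^bsub>SL r\<^esub> a"
  and theta0_torus: "a \<in> torus_H r \<Longrightarrow> theta0 r a = inv\<^bsub>SL r\<^esub> a"
  using sign_conj_torus[OF torus_inv] by (auto simp: iota0_def theta0_def torus_transpose)

lemma iota0_gen: "i \<in> {1..r} \<Longrightarrow> iota0 r (x_gen r i T) = x_gen r i T \<and> iota0 r (y_gen r i T) = y_gen r i T"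
  and theta0_gen: "i \<in> {1..r} \<Longrightarrow> theta0 r (x_gen r i T) = y_gen r i T \<and> theta0 r (y_gen r i T) = x_gen r i T"
  by (auto simp: iota0_def theta0_def x_gen_elementary y_gen_elementary elementary_inv sign_conj_elementary elementary_transpose)

lemmas SL_subsets [simp] = upper_SL_SL lower_SL_SL N_plus_SL N_minus_SL torus_SL

lemma theta_aut_spec:
  "theta_aut r \<in> iso (SL r) (SL r)
     \<and> (\<forall>a \<in> torus_H r. theta_aut r a = inv\<^bsub>SL r\<^esub> a)
     \<and> (\<forall>i \<in> {1..r}. \<forall>T. theta_aut r (x_gen r i T) = y_gen r i T \<and> theta_aut r (y_gen r i T) = x_gen r i T)"
  (is "?P (theta_aut r)")
proof -
  have "theta0 r \<in> iso (SL r) (SL r)"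
    using theta0_bij[of r] by (auto simp: iso_def hom_def theta0_mult bij_betw_def)
  hence "?P (theta0 r)" using theta0_torus theta0_gen by blast
  thus ?thesis unfolding theta_aut_def by (rule someI[where P = ?P])
qed

lemma iota_anti_spec:
  "bij_betw (iota_anti r) (carrier (SL r)) (carrier (SL r))
     \<and> (\<forall>x \<in> carrier (SL r). \<forall>y \<in> carrier (SL r). iota_anti r (x * y) = iota_anti r y * iota_anti r x)
     \<and> (\<forall>a \<in> torus_H r. iota_anti r a = inv\<^bsub>SL r\<^esub> a)
     \<and> (\<forall>i \<in> {1..r}. \<forall>T. iota_anti r (x_gen r i T) = x_gen r i T \<and> iota_anti r (y_gen r i T) = y_gen r i T)"
  (is "?P (iota_anti r)")
proof -
  have "?P (iota0 r)" using iota0_bij iota0_mult iota0_torus iota0_gen by blast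
  thus ?thesis unfolding iota_anti_def by (rule someI[where P = ?P])
qed

lemma theta_aut_mult: "x \<in> carrier (SL r) \<Longrightarrow> y \<in> carrier (SL r) \<Longrightarrow>
    theta_aut r (x * y) = theta_aut r x * theta_aut r y"
  using theta_aut_spec[of r] by (auto simp: iso_def hom_def)

lemma iota_anti_mult: "x \<in> carrier (SL r) \<Longrightarrow> y \<in> carrier (SL r) \<Longrightarrow>
    iota_anti r (x * y) = iota_anti r y * iota_anti r x"
  using iota_anti_spec[of r] by blast

lemma theta_iota_one: "theta_aut r (1\<^sub>m (Suc r)) = 1\<^sub>m (Suc r)" "iota_anti r (1\<^sub>m (Suc r)) = 1\<^sub>m (Suc r)"
proof -
  have one: "1\<^sub>m (Suc r) \<in> torus_H r" by (auto simp: torus_H_def SL_carrier_iff diagonal_mat_def)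
  have inv: "inv\<^bsub>SL r\<^esub> (1\<^sub>m (Suc r)) = 1\<^sub>m (Suc r)" by (rule SL_inv_eqI) (auto simp: SL_carrier_iff)
  show "theta_aut r (1\<^sub>m (Suc r)) = 1\<^sub>m (Suc r)" "iota_anti r (1\<^sub>m (Suc r)) = 1\<^sub>m (Suc r)"
    using one theta_aut_spec[of r] iota_anti_spec[of r] inv by auto
qed

text \<open>Two multiplicative maps that agree on the generators x_i(c) agree on all of N.\<close>

lemma theta_aut_N_plus:
  assumes "u \<in> N_plus r" shows "theta_aut r u = theta0 r u"
  using assms
proof (induction u rule: N_plus_induct)
  case 1
  have "theta0 r (1\<^sub>m (Suc r)) = 1\<^sub>m (Suc r)"
    using theta0_torus[of "1\<^sub>m (Suc r)" r] theta_aut_spec[of r] theta_iota_one(1)[of r]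
    by (auto simp: torus_H_def SL_carrier_iff diagonal_mat_def)
  thus ?case by (simp add: theta_iota_one)
next
  case (2 x y)
  thus ?case by (auto simp: theta_aut_mult theta0_mult)
next
  case (3 i c)
  thus ?case using theta_aut_spec[of r] theta0_gen by auto
qed

lemma iota_anti_N_minus:
  assumes "u \<in> N_minus r" shows "iota_anti r u = iota0 r u"
proof -
  \<comment> \<open>Transposition makes the induction principle for N available on N^-.\<close>
  have "iota_anti r (transpose_mat v) = iota0 r (transpose_mat v)" if "v \<in> N_plus r" for v
    using that
  proof (induction v rule: N_plus_induct)
    case 1
    have "iota0 r (1\<^sub>m (Suc r)) = 1\<^sub>m (Suc r)"
      using iota0_torus[of "1\<^sub>m (Suc r)" r] iota_anti_spec[of r] theta_iota_one(2)[of r]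
      by (auto simp: torus_H_def SL_carrier_iff diagonal_mat_def)
    thus ?case by (simp add: theta_iota_one)
  next
    case (2 x y)
    thus ?case by (auto simp: SL_transpose_mult iota_anti_mult iota0_mult)
  next
    case (3 i c)
    have "transpose_mat (x_gen r i c) = y_gen r i c"
      using 3 by (simp add: x_gen_elementary y_gen_elementary elementary_transpose)
    thus ?case using 3 iota_anti_spec[of r] iota0_gen by auto
  qed
  from this[of "transpose_mat u"] show ?thesis using assms by auto
qed

text \<open>The two inverses and the two sign conjugations cancel, and of the inverse transpose and
  the inverse only the transpose is left.\<close>

lemma iota_theta_upper:
  assumes "z \<in> upper_SL r"
  shows "iota_anti r (theta_aut r z) = transpose_mat z"
proof -
  obtain t n where t: "t \<in> torus_H r" and n: "n \<in> N_plus r" and z: "z = t * n"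
    using assms by (auto simp flip: B_plus_eq simp: B_plus_def)
  have th: "theta_aut r z = inv\<^bsub>SL r\<^esub> t * theta0 r n"
    using t n theta_aut_spec[of r] by (auto simp: z theta_aut_mult theta_aut_N_plus)
  have it: "inv\<^bsub>SL r\<^esub> t \<in> torus_H r" by (rule torus_inv[OF t])
  have tn: "theta0 r n \<in> carrier (SL r)" using n by (auto simp: theta0_def)
  \<comment> \<open>\<iota> is known on N^- and on H, so the unipotent factor must first be seen to
    be lower triangular.\<close>
  have low: "theta0 r n \<in> N_minus r"
  proof -
    have m: "inv\<^bsub>SL r\<^esub> (transpose_mat n) \<in> N_minus r"
      using n by auto
    hence "theta0 r n \<in> lower_SL r"
      using tn lower_SL_index[OF N_minus_subset_lower[OF m]]
      by (intro lower_SLI) (auto simp: theta0_def sign_conj_def)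
    thus ?thesis using m by (auto simp: N_minus_iff theta0_def sign_conj_def simp flip: mult_2)
  qed
  have "iota_anti r (theta_aut r z) = iota0 r (theta0 r n) * inv\<^bsub>SL r\<^esub> (inv\<^bsub>SL r\<^esub> t)"
    using it tn low iota_anti_spec[of r] unfolding th
    by (auto simp: iota_anti_mult iota_anti_N_minus)
  also have "\<dots> = transpose_mat n * t"
    using n t sign_conj_inv[of "inv\<^bsub>SL r\<^esub> (transpose_mat n)" r]
    by (auto simp: iota0_def theta0_def SL_inv_inv sign_conj_involution)
  also have "\<dots> = transpose_mat z"
    using t n SL_transpose_mult[of t r n] by (simp add: z torus_transpose)
  finally show ?thesis .
qed

section \<open>Representatives of Weyl group elements\<close>

text \<open>The signs enter only through f b * f b = 1: in conjugates they occur in pairs or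
  multiply a zero, so the individual signs of the representative of w_0 are never computed. The
  lemmas below add that \<pi> is an involution, which holds for s_i and w_0 and makes \<pi> its own
  inverse.\<close>

definition signed_perm :: "nat \<Rightarrow> (nat \<Rightarrow> nat) \<Rightarrow> (nat \<Rightarrow> complex) \<Rightarrow> complex mat \<Rightarrow> bool" where
  "signed_perm r \<pi> f M \<longleftrightarrow> M \<in> carrier (SL r) \<and> (\<forall>b<Suc r. \<pi> b < Suc r \<and> f b * f b = 1)
     \<and> (\<forall>a<Suc r. \<forall>b<Suc r. M $$ (a, b) = (if a = \<pi> b then f b else 0))"

context
  fixes r \<pi> f M
  assumes M: "signed_perm r \<pi> f M" and inv\<pi>: "\<And>b. b < Suc r \<Longrightarrow> \<pi> (\<pi> b) = b"
begin

lemma signed_perm_carrier: "M \<in> carrier (SL r)" "M \<in> carrier_mat (Suc r) (Suc r)"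
  and signed_perm_less: "b < Suc r \<Longrightarrow> \<pi> b < Suc r"
  and signed_perm_index: "a < Suc r \<Longrightarrow> b < Suc r \<Longrightarrow> M $$ (a, b) = (if a = \<pi> b then f b else 0)"
  and signed_perm_sign: "b < Suc r \<Longrightarrow> f b * f b = 1"
  using M by (auto simp: signed_perm_def)

lemma signed_perm_mult_left:
  assumes "X \<in> carrier_mat (Suc r) (Suc r)" "a < Suc r" "b < Suc r"
  shows "(M * X) $$ (a, b) = f (\<pi> a) * X $$ (\<pi> a, b)"
proof -
  have "(M * X) $$ (a, b) = (\<Sum>l<Suc r. if l = \<pi> a then f (\<pi> a) * X $$ (\<pi> a, b) else 0)"
    unfolding mult_index[OF signed_perm_carrier(2) assms]
    by (rule sum.cong[OF refl]) (use assms inv\<pi> in \<open>auto simp: signed_perm_index\<close>)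
  thus ?thesis using assms signed_perm_less by (simp del: sum.lessThan_Suc)
qed

lemma signed_perm_transpose_mult_left:
  assumes "X \<in> carrier_mat (Suc r) (Suc r)" "a < Suc r" "b < Suc r"
  shows "(transpose_mat M * X) $$ (a, b) = f a * X $$ (\<pi> a, b)"
proof -
  have c: "transpose_mat M \<in> carrier_mat (Suc r) (Suc r)" using signed_perm_carrier by simp
  have "(transpose_mat M * X) $$ (a, b) = (\<Sum>l<Suc r. if l = \<pi> a then f a * X $$ (\<pi> a, b) else 0)"
    unfolding mult_index[OF c assms]
    by (rule sum.cong[OF refl]) (use assms signed_perm_carrier in \<open>auto simp: signed_perm_index\<close>)
  thus ?thesis using assms signed_perm_less by (simp del: sum.lessThan_Suc)
qed

lemma signed_perm_mult_right:
  assumes "X \<in> carrier_mat (Suc r) (Suc r)" "a < Suc r" "b < Suc r"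
  shows "(X * M) $$ (a, b) = f b * X $$ (a, \<pi> b)"
proof -
  have "(X * M) $$ (a, b) = (\<Sum>l<Suc r. if l = \<pi> b then f b * X $$ (a, \<pi> b) else 0)"
    unfolding mult_index[OF assms(1) signed_perm_carrier(2) assms(2,3)]
    by (rule sum.cong[OF refl]) (use assms in \<open>auto simp: signed_perm_index\<close>)
  thus ?thesis using assms signed_perm_less by (simp del: sum.lessThan_Suc)
qed

lemma signed_perm_mult_transpose_right:
  assumes "X \<in> carrier_mat (Suc r) (Suc r)" "a < Suc r" "b < Suc r"
  shows "(X * transpose_mat M) $$ (a, b) = f (\<pi> b) * X $$ (a, \<pi> b)"
proof -
  have c: "transpose_mat M \<in> carrier_mat (Suc r) (Suc r)" using signed_perm_carrier by simp
  have \<pi>: "b = \<pi> l \<longleftrightarrow> l = \<pi> b" if "l < Suc r" for l using inv\<pi> that assms(3) by metis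
  have "(X * transpose_mat M) $$ (a, b) = (\<Sum>l<Suc r. if l = \<pi> b then f (\<pi> b) * X $$ (a, \<pi> b) else 0)"
    unfolding mult_index[OF assms(1) c assms(2,3)]
    by (rule sum.cong[OF refl]) (use assms \<pi> signed_perm_carrier in \<open>auto simp: signed_perm_index inv\<pi>\<close>)
  thus ?thesis using assms signed_perm_less by (simp del: sum.lessThan_Suc)
qed

lemma signed_perm_inv: "inv\<^bsub>SL r\<^esub> M = transpose_mat M"
proof (rule SL_inv_eqI)
  show "transpose_mat M * M = 1\<^sub>m (Suc r)"
  proof (rule eq_matI)
    fix a b assume "a < dim_row (1\<^sub>m (Suc r))" "b < dim_col (1\<^sub>m (Suc r))"
    hence ab: "a < Suc r" "b < Suc r" by auto
    have "\<pi> a = \<pi> b \<longleftrightarrow> a = b" using inv\<pi> ab by metis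
    thus "(transpose_mat M * M) $$ (a, b) = 1\<^sub>m (Suc r) $$ (a, b)"
      using ab by (simp add: signed_perm_transpose_mult_left[OF signed_perm_carrier(2)]
        signed_perm_index signed_perm_less signed_perm_sign)
  qed (use signed_perm_carrier in auto)
qed (use signed_perm_carrier in auto)

lemma signed_perm_conj:
  assumes X: "X \<in> carrier_mat (Suc r) (Suc r)" and ab: "a < Suc r" "b < Suc r"
  shows "(inv\<^bsub>SL r\<^esub> M * X * M) $$ (a, b) = f a * f b * X $$ (\<pi> a, \<pi> b)"
    "(M * X * inv\<^bsub>SL r\<^esub> M) $$ (a, b) = f (\<pi> a) * f (\<pi> b) * X $$ (\<pi> a, \<pi> b)"
proof -
  have c: "transpose_mat M * X \<in> carrier_mat (Suc r) (Suc r)" "M * X \<in> carrier_mat (Suc r) (Suc r)"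
    using signed_perm_carrier X by (auto intro!: mult_carrier_mat)
  show "(inv\<^bsub>SL r\<^esub> M * X * M) $$ (a, b) = f a * f b * X $$ (\<pi> a, \<pi> b)"
    using signed_perm_mult_right[OF c(1) ab] signed_perm_transpose_mult_left[OF X ab(1), of "\<pi> b"]
      signed_perm_less[OF ab(2)] by (simp add: signed_perm_inv)
  show "(M * X * inv\<^bsub>SL r\<^esub> M) $$ (a, b) = f (\<pi> a) * f (\<pi> b) * X $$ (\<pi> a, \<pi> b)"
    using signed_perm_mult_transpose_right[OF c(2) ab] signed_perm_mult_left[OF X ab(1), of "\<pi> b"]
      signed_perm_less[OF ab(2)] by (simp add: signed_perm_inv)
qed

end

section \<open>The signed permutation matrices of s_i and w_0\<close>

definition adj_swap :: "nat \<Rightarrow> nat \<Rightarrow> nat" where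
  "adj_swap i b = (if b = i - 1 then i else if b = i then i - 1 else b)"

lemma s_bar_SL:
  assumes "i \<in> {1..r}" shows "s_bar r i \<in> carrier (SL r)"
  using assms by (auto simp: s_bar_def x_gen_elementary y_gen_elementary intro!: SL_mult elementary_SL)

lemma s_bar_mult_index:
  assumes i: "i \<in> {1..r}" and X: "X \<in> carrier_mat (Suc r) (Suc r)" and ab: "a < Suc r" "b < Suc r"
  shows "(s_bar r i * X) $$ (a, b) = (if a = i - 1 then - 1 else 1) * X $$ (adj_swap i a, b)"
proof -
  define E F where "E = elementary r (i - 1) i (- 1)" and "F = elementary r i (i - 1) 1"
  have c: "E \<in> carrier_mat (Suc r) (Suc r)" "F \<in> carrier_mat (Suc r) (Suc r)"
    by (simp_all add: E_def F_def)
  have "s_bar r i * X = E * F * E * X"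
    using i by (simp add: s_bar_def x_gen_elementary y_gen_elementary E_def F_def)
  also have "\<dots> = E * (F * (E * X))"
    using c X by (simp add: assoc_mult_mat[of _ "Suc r" "Suc r" _ "Suc r" _ "Suc r"] mult_carrier_mat[of _ _ "Suc r"])
  also have "E * X = addrow (- 1) (i - 1) i X"
    using i X by (simp add: E_def elementary_mult)
  also have "F * \<dots> = addrow 1 i (i - 1) (addrow (- 1) (i - 1) i X)"
    unfolding F_def using i X by (intro elementary_mult) auto
  also have "E * \<dots> = addrow (- 1) (i - 1) i (addrow 1 i (i - 1) (addrow (- 1) (i - 1) i X))"
    unfolding E_def using i X by (intro elementary_mult) auto
  finally have "s_bar r i * X = \<dots>" .
  thus ?thesis using i X ab by (auto simp: adj_swap_def)
qed

lemma s_bar_signed_perm: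
  assumes "i \<in> {1..r}"
  shows "signed_perm r (adj_swap i) (\<lambda>b. if b = i then - 1 else 1) (s_bar r i)"
proof -
  have c: "s_bar r i \<in> carrier_mat (Suc r) (Suc r)" using s_bar_SL[OF assms] by simp
  have "s_bar r i $$ (a, b) = (if a = adj_swap i b then if b = i then - 1 else 1 else 0)"
    if "a < Suc r" "b < Suc r" for a b
    using s_bar_mult_index[OF assms one_carrier_mat that] c that assms by (auto simp: adj_swap_def)
  thus ?thesis using s_bar_SL[OF assms] assms by (auto simp: signed_perm_def adj_swap_def)
qed

lemma signed_perm_s_bar_mult:
  assumes i: "i \<in> {1..r}" and M: "signed_perm r \<pi> f M"
  shows "\<exists>g. signed_perm r (\<lambda>b. adj_swap i (\<pi> b)) g (s_bar r i * M)"
proof -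
  have c: "M \<in> carrier (SL r)" using M by (simp add: signed_perm_def)
  have sw: "adj_swap i (adj_swap i b) = b" for b by (simp add: adj_swap_def)
  define g where "g b = (if adj_swap i (\<pi> b) = i - 1 then - f b else f b)" for b
  have "(s_bar r i * M) $$ (a, b) = (if a = adj_swap i (\<pi> b) then g b else 0)"
    if ab: "a < Suc r" "b < Suc r" for a b
  proof -
    have l: "adj_swap i a < Suc r" using i ab by (auto simp: adj_swap_def)
    have "adj_swap i a = \<pi> b \<longleftrightarrow> a = adj_swap i (\<pi> b)" using sw by metis
    thus ?thesis using s_bar_mult_index[OF i _ ab] c M l ab by (auto simp: signed_perm_def g_def)
  qed
  hence "signed_perm r (\<lambda>b. adj_swap i (\<pi> b)) g (s_bar r i * M)"
    using M i s_bar_SL[OF i] by (auto simp: signed_perm_def g_def adj_swap_def)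
  thus ?thesis by blast
qed

lemma word_signed_perm:
  assumes "set ws \<subseteq> {1..r}"
  shows "\<exists>g. signed_perm r (foldr adj_swap ws) g (foldr (\<lambda>i x. s_bar r i * x) ws (1\<^sub>m (r + 1)))"
  using assms
proof (induction ws)
  case Nil
  have "signed_perm r (\<lambda>b. b) (\<lambda>_. 1) (1\<^sub>m (r + 1))" by (auto simp: signed_perm_def SL_carrier_iff)
  thus ?case by (auto simp: id_def)
next
  case (Cons i ws)
  then obtain g where "signed_perm r (foldr adj_swap ws) g (foldr (\<lambda>i x. s_bar r i * x) ws (1\<^sub>m (r + 1)))"
    by auto
  from signed_perm_s_bar_mult[OF _ this, of i] show ?case using Cons.prems by (simp add: comp_def)
qed

lemma foldr_adj_swap_cycle:
  "foldr adj_swap [1..<Suc k] b = (if b < k then Suc b else if b = k then 0 else b)"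
  by (induction k arbitrary: b) (auto simp: adj_swap_def)

lemma w0_word_Suc: "w0_word (Suc k) = [1..<Suc (Suc k)] @ w0_word k"
proof -
  have "[1..<Suc k + 1] = 1 # map Suc [1..<k + 1]"
    by (subst upt_conv_Cons) (simp_all add: map_Suc_upt del: upt_Suc)
  thus ?thesis unfolding w0_word_def by (simp add: comp_def del: upt_Suc)
qed

text \<open>Removing the first cycle leaves the word of rank one less. That word reverses 0, ..., k
  and fixes k + 1; the cycle then raises each k - b to k + 1 - b and sends k + 1 to 0.\<close>

lemma foldr_adj_swap_w0: "foldr adj_swap (w0_word k) b = (if b \<le> k then k - b else b)"
proof (induction k arbitrary: b)
  case 0 show ?case by (simp add: w0_word_def)
next
  case (Suc k)
  have "foldr adj_swap (w0_word (Suc k)) b = foldr adj_swap [1..<Suc (Suc k)] (foldr adj_swap (w0_word k) b)"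
    by (simp add: w0_word_Suc del: upt_Suc)
  thus ?case unfolding Suc.IH foldr_adj_swap_cycle by auto
qed

lemma w0_word_set: "set (w0_word r) \<subseteq> {1..r}"
  by (induction r) (auto simp: w0_word_Suc, simp add: w0_word_def)

definition w0_sign :: "nat \<Rightarrow> nat \<Rightarrow> complex" where
  "w0_sign r b = w0_bar r $$ (r - b, b)"

lemma w0_bar_signed_perm: "signed_perm r (\<lambda>b. r - b) (w0_sign r) (w0_bar r)"
proof -
  obtain g where g: "signed_perm r (foldr adj_swap (w0_word r)) g (w0_bar r)"
    using word_signed_perm[OF w0_word_set[of r]] unfolding w0_bar_def by blast
  hence "w0_sign r b = g b" if "b < Suc r" for b
    using that by (auto simp: signed_perm_def w0_sign_def foldr_adj_swap_w0)
  thus ?thesis using g by (auto simp: signed_perm_def foldr_adj_swap_w0)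
qed

lemma w0_bar_SL [simp]: "w0_bar r \<in> carrier (SL r)"
  using w0_bar_signed_perm[of r] by (simp add: signed_perm_def)

lemma w0_sign_sq: "b < Suc r \<Longrightarrow> w0_sign r b * w0_sign r b = 1"
  using w0_bar_signed_perm[of r] by (simp add: signed_perm_def)

lemma w0_bar_inv: "inv\<^bsub>SL r\<^esub> (w0_bar r) = transpose_mat (w0_bar r)"
  by (rule signed_perm_inv[OF w0_bar_signed_perm]) simp

text \<open>Both indices are reversed, so conjugation by w_0 exchanges upper and lower triangular
  matrices; on the diagonal the two signs coincide and cancel.\<close>

lemma w0_bar_conj_index:
  assumes "X \<in> carrier_mat (Suc r) (Suc r)" "a < Suc r" "b < Suc r"
  shows "(inv\<^bsub>SL r\<^esub> (w0_bar r) * X * w0_bar r) $$ (a, b)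
      = w0_sign r a * w0_sign r b * X $$ (r - a, r - b)"
    "(w0_bar r * X * inv\<^bsub>SL r\<^esub> (w0_bar r)) $$ (a, b)
      = w0_sign r (r - a) * w0_sign r (r - b) * X $$ (r - a, r - b)"
  using signed_perm_conj[OF w0_bar_signed_perm _ assms] by simp_all

lemma w0_bar_conj_upper:
  assumes "u \<in> upper_SL r"
  shows "inv\<^bsub>SL r\<^esub> (w0_bar r) * u * w0_bar r \<in> lower_SL r"
    "w0_bar r * u * inv\<^bsub>SL r\<^esub> (w0_bar r) \<in> lower_SL r"
proof -
  have c: "u \<in> carrier_mat (Suc r) (Suc r)" using assms by simp
  have S: "u \<in> carrier (SL r)" using assms by simp
  show "inv\<^bsub>SL r\<^esub> (w0_bar r) * u * w0_bar r \<in> lower_SL r"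
    by (rule lower_SLI) (use S upper_SL_index[OF assms] in \<open>simp_all add: w0_bar_conj_index[OF c] less_Suc_eq_le\<close>)
  show "w0_bar r * u * inv\<^bsub>SL r\<^esub> (w0_bar r) \<in> lower_SL r"
    by (rule lower_SLI) (use S upper_SL_index[OF assms] in \<open>simp_all add: w0_bar_conj_index[OF c] less_Suc_eq_le\<close>)
qed

lemma w0_bar_conj_lower:
  assumes "u \<in> lower_SL r"
  shows "inv\<^bsub>SL r\<^esub> (w0_bar r) * u * w0_bar r \<in> upper_SL r"
    "w0_bar r * u * inv\<^bsub>SL r\<^esub> (w0_bar r) \<in> upper_SL r"
proof -
  have c: "u \<in> carrier_mat (Suc r) (Suc r)" using assms by simp
  have S: "u \<in> carrier (SL r)" using assms by simp
  show "inv\<^bsub>SL r\<^esub> (w0_bar r) * u * w0_bar r \<in> upper_SL r"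
    by (rule upper_SLI) (use S lower_SL_index[OF assms] in \<open>simp_all add: w0_bar_conj_index[OF c] less_Suc_eq_le\<close>)
  show "w0_bar r * u * inv\<^bsub>SL r\<^esub> (w0_bar r) \<in> upper_SL r"
    by (rule upper_SLI) (use S lower_SL_index[OF assms] in \<open>simp_all add: w0_bar_conj_index[OF c] less_Suc_eq_le\<close>)
qed

lemma w0_bar_conj_N:
  shows "u \<in> N_plus r \<Longrightarrow> inv\<^bsub>SL r\<^esub> (w0_bar r) * u * w0_bar r \<in> N_minus r"
    and "u \<in> N_minus r \<Longrightarrow> w0_bar r * u * inv\<^bsub>SL r\<^esub> (w0_bar r) \<in> N_plus r"
proof -
  show "inv\<^bsub>SL r\<^esub> (w0_bar r) * u * w0_bar r \<in> N_minus r" if u: "u \<in> N_plus r"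
    using u w0_bar_conj_upper(1)[OF N_plus_subset_upper[OF u]] w0_bar_conj_index(1)[of u]
      SL_carrierD[OF N_plus_SL[OF u]] w0_sign_sq
    by (simp add: N_minus_iff N_plus_iff)
  show "w0_bar r * u * inv\<^bsub>SL r\<^esub> (w0_bar r) \<in> N_plus r" if u: "u \<in> N_minus r"
    using u w0_bar_conj_lower(2)[OF N_minus_subset_lower[OF u]] w0_bar_conj_index(2)[of u]
      SL_carrierD[OF N_minus_SL[OF u]] w0_sign_sq
    by (simp add: N_minus_iff N_plus_iff)
qed

section \<open>The twist and the crystal on the double cell\<close>

text \<open>Moving N^- to one side and B to the other puts the quotient into their intersection,
  which is trivial.\<close>

lemma gauss_unique:
  assumes "n \<in> N_minus r" "n' \<in> N_minus r" "b \<in> upper_SL r" "b' \<in> upper_SL r" "n * b = n' * b'"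
  shows "n = n'"
proof -
  have S: "n \<in> carrier (SL r)" "n' \<in> carrier (SL r)" "b \<in> carrier (SL r)" "b' \<in> carrier (SL r)"
    using assms by auto
  have "inv\<^bsub>SL r\<^esub> n' * n = inv\<^bsub>SL r\<^esub> n' * (n * b) * inv\<^bsub>SL r\<^esub> b"
    using S by (simp add: SL_assoc[of _ r] SL_inv_mult)
  also have "\<dots> = b' * inv\<^bsub>SL r\<^esub> b"
    unfolding assms(5) using S by (simp add: SL_cancel)
  finally have "inv\<^bsub>SL r\<^esub> n' * n = b' * inv\<^bsub>SL r\<^esub> b" .
  moreover have "inv\<^bsub>SL r\<^esub> n' * n \<in> N_minus r" "b' * inv\<^bsub>SL r\<^esub> b \<in> upper_SL r" using assms by auto
  ultimately have "inv\<^bsub>SL r\<^esub> n' * n = 1\<^sub>m (Suc r)" by (metis N_minus_Int_upper)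
  thus ?thesis using SL_cancel(2)[OF S(2,1)] S by simp
qed

lemma gauss_minus_eq:
  assumes "n \<in> N_minus r" "b \<in> upper_SL r"
  shows "gauss_minus r (n * b) = n"
  unfolding gauss_minus_def
proof (rule the_equality)
  obtain t u where tu: "t \<in> torus_H r" "u \<in> N_plus r" "b = t * u"
    using assms by (auto simp flip: B_plus_eq simp: B_plus_def)
  hence "n * b = n * t * u" using assms by (simp add: SL_assoc[of _ r])
  thus "n \<in> N_minus r \<and> (\<exists>t\<in>torus_H r. \<exists>u\<in>N_plus r. n * b = n * t * u)" using assms tu by blast
next
  fix n' assume "n' \<in> N_minus r \<and> (\<exists>t\<in>torus_H r. \<exists>u\<in>N_plus r. n * b = n' * t * u)"
  then obtain t u where *: "n' \<in> N_minus r" "t \<in> torus_H r" "u \<in> N_plus r" "n * b = n' * t * u" by blast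
  have "n * b = n' * (t * u)" using * by (simp add: SL_assoc[of _ r])
  moreover have "t * u \<in> upper_SL r" using * torus_subset_upper N_plus_subset_upper by blast
  ultimately show "n' = n" using gauss_unique[OF assms(1) *(1) assms(2)] by simp
qed

text \<open>The graph of the twist on the double cell. In this form a preimage is found by
  exhibiting a pair, without solving for x.\<close>

definition twist_rel :: "nat \<Rightarrow> complex mat \<Rightarrow> complex mat \<Rightarrow> bool" where
  "twist_rel r x y \<longleftrightarrow> x \<in> lower_SL r \<and> y \<in> lower_SL r
     \<and> (\<exists>u\<in>N_plus r. x = u * w0_bar r * transpose_mat y)"

text \<open>Conjugating u by w_0 gives an element of N^-, which is therefore the Gauss factor that
  the twist strips off; the remaining transpose of y is transposed once more by \<iota>
  \<theta>.\<close>

lemma twist_eq: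
  assumes "twist_rel r x y"
  shows "(iota_anti r \<circ> zeta_twist r) x = y"
proof -
  obtain u where y: "y \<in> lower_SL r" and u: "u \<in> N_plus r" and x: "x = u * w0_bar r * transpose_mat y"
    using assms by (auto simp: twist_rel_def)
  let ?w = "w0_bar r" and ?b = "transpose_mat y"
  let ?n = "inv\<^bsub>SL r\<^esub> ?w * u * ?w"
  have b: "?b \<in> upper_SL r" and n: "?n \<in> N_minus r"
    using y w0_bar_conj_N(1)[OF u] by auto
  have z: "inv\<^bsub>SL r\<^esub> ?w * x = ?n * ?b"
    using y u by (simp add: x SL_assoc[of _ r])
  have "inv\<^bsub>SL r\<^esub> (gauss_minus r (?n * ?b)) * (?n * ?b) = ?b"
    unfolding gauss_minus_eq[OF n b] using n b by (simp add: SL_cancel)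
  thus ?thesis using iota_theta_upper[OF b] by (simp add: zeta_twist_def Let_def z)
qed

text \<open>The torus factor stands on the right, next to w_0, so that it can be moved across
  w_0.\<close>

lemma upper_SL_factor:
  assumes "b \<in> upper_SL r"
  obtains u t where "u \<in> N_plus r" "t \<in> torus_H r" "b = u * t"
proof -
  let ?c = "transpose_mat b"
  have c: "?c \<in> lower_SL r" using assms by auto
  define t where "t = diag_part r ?c"
  have t: "t \<in> torus_H r" unfolding t_def by (rule diag_part_lower_torus[OF c])
  note f = lower_SL_factor(3,4)[OF c, folded t_def]
  have "b = transpose_mat (t * (inv\<^bsub>SL r\<^esub> t * ?c))" using f(2) by simp
  also have "\<dots> = transpose_mat (inv\<^bsub>SL r\<^esub> t * ?c) * t"
    using SL_transpose_mult[of t r "inv\<^bsub>SL r\<^esub> t * ?c"] t f(1) by (simp add: torus_transpose)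
  finally show ?thesis using that f(1) t by blast
qed

lemma double_cell_lower: "x \<in> double_cell r \<Longrightarrow> x \<in> lower_SL r"
  by (simp add: double_cell_def B_minus_eq)

lemma double_cellI:
  "x \<in> lower_SL r \<Longrightarrow> b \<in> upper_SL r \<Longrightarrow> b' \<in> upper_SL r \<Longrightarrow> x = b * w0_bar r * b' \<Longrightarrow> x \<in> double_cell r"
  by (auto simp: double_cell_def B_minus_eq B_plus_eq)

lemma double_cellE:
  assumes "x \<in> double_cell r"
  obtains b b' where "b \<in> upper_SL r" "b' \<in> upper_SL r" "x = b * w0_bar r * b'"
  using assms by (auto simp: double_cell_def B_plus_eq)

lemma twist_rel_exists:
  assumes x: "x \<in> double_cell r" shows "\<exists>y. twist_rel r x y"
proof -
  obtain b b' where b: "b \<in> upper_SL r" "b' \<in> upper_SL r" "x = b * w0_bar r * b'"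
    using x by (rule double_cellE)
  obtain u t where ut: "u \<in> N_plus r" "t \<in> torus_H r" "b = u * t"
    using b(1) by (rule upper_SL_factor)
  let ?w = "w0_bar r"
  \<comment> \<open>The torus part of the left factor, carried across w_0, is merged with the right
    factor, so that only N is left in front of w_0.\<close>
  let ?c = "inv\<^bsub>SL r\<^esub> ?w * t * ?w * b'"
  have c: "?c \<in> upper_SL r"
    using b(2) w0_bar_conj_lower(1)[OF torus_subset_lower[OF ut(2)]] by auto
  have "x = u * ?w * ?c"
    using b(2) ut by (simp add: b(3) SL_assoc[of _ r] SL_cancel[of _ r])
  hence "twist_rel r x (transpose_mat ?c)"
    using c ut(1) double_cell_lower[OF x] by (auto simp: twist_rel_def)
  thus ?thesis ..
qed

lemma twist_rel_double_cell:
  assumes "twist_rel r x y"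
  shows "x \<in> double_cell r" "y \<in> double_cell r"
proof -
  obtain u where xl: "x \<in> lower_SL r" and y: "y \<in> lower_SL r" and u: "u \<in> N_plus r"
    and x: "x = u * w0_bar r * transpose_mat y"
    using assms by (auto simp: twist_rel_def)
  let ?w = "w0_bar r"
  show "x \<in> double_cell r"
    by (rule double_cellI[OF xl _ _ x]) (use u y N_plus_subset_upper in auto)
  \<comment> \<open>Solving the relation for y and transposing, with the inverse of w_0 equal to its
    transpose, puts the lower triangular ?m in front of w_0; conjugation by w_0 makes it the upper
    triangular factor behind w_0.\<close>
  let ?m = "transpose_mat (inv\<^bsub>SL r\<^esub> u)"
  have m: "?m \<in> N_minus r" using u by auto
  have "transpose_mat y = inv\<^bsub>SL r\<^esub> ?w * (inv\<^bsub>SL r\<^esub> u * x)"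
    using u y by (simp add: x SL_assoc[of _ r] SL_cancel[of _ r])
  hence "y = transpose_mat (inv\<^bsub>SL r\<^esub> ?w * (inv\<^bsub>SL r\<^esub> u * x))" by (metis transpose_transpose)
  also have "\<dots> = transpose_mat x * ?m * ?w"
    using u xl SL_transpose_mult[of "inv\<^bsub>SL r\<^esub> ?w" r "inv\<^bsub>SL r\<^esub> u * x"]
      SL_transpose_mult[of "inv\<^bsub>SL r\<^esub> u" r x] by (simp add: w0_bar_inv)
  also have "\<dots> = transpose_mat x * ?w * (inv\<^bsub>SL r\<^esub> ?w * ?m * ?w)"
    using u xl m by (simp add: SL_assoc[of _ r] SL_cancel[of _ r])
  finally have "y = \<dots>" .
  thus "y \<in> double_cell r"
    by (intro double_cellI[OF y _ w0_bar_conj_lower(1)[OF N_minus_subset_lower[OF m]]]) (use xl in auto)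
qed

text \<open>The quotient of x' and x equals that of u' and u, hence lies both in B^- and in N, whose
  intersection is trivial.\<close>

lemma twist_rel_inj:
  assumes "twist_rel r x y" "twist_rel r x' y" shows "x = x'"
proof -
  obtain u u' where x: "x \<in> lower_SL r" "x' \<in> lower_SL r" "y \<in> lower_SL r"
    and u: "u \<in> N_plus r" "u' \<in> N_plus r"
    and eq: "x = u * w0_bar r * transpose_mat y" "x' = u' * w0_bar r * transpose_mat y"
    using assms by (auto simp: twist_rel_def)
  have S: "transpose_mat y \<in> carrier (SL r)" using x by simp
  have "u' * inv\<^bsub>SL r\<^esub> u * x = x'"
    unfolding eq using u S by (simp add: SL_assoc[of _ r] SL_cancel[of _ r])
  hence "x' * inv\<^bsub>SL r\<^esub> x = u' * inv\<^bsub>SL r\<^esub> u * x * inv\<^bsub>SL r\<^esub> x" by simp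
  also have "\<dots> = u' * inv\<^bsub>SL r\<^esub> u" using u x by (simp add: SL_cancel(3)[of _ r])
  finally have "x' * inv\<^bsub>SL r\<^esub> x = u' * inv\<^bsub>SL r\<^esub> u" .
  moreover have "x' * inv\<^bsub>SL r\<^esub> x \<in> lower_SL r" "u' * inv\<^bsub>SL r\<^esub> u \<in> N_plus r" using x u by auto
  ultimately have "x' * inv\<^bsub>SL r\<^esub> x = 1\<^sub>m (Suc r)" by (metis N_plus_Int_lower)
  thus ?thesis using SL_cancel(4)[of x r x'] x by simp
qed

lemma twist_rel_twist:
  assumes "x \<in> double_cell r" shows "twist_rel r x ((iota_anti r \<circ> zeta_twist r) x)"
  using twist_rel_exists[OF assms] twist_eq by blast

lemma twist_inj_on: "inj_on (iota_anti r \<circ> zeta_twist r) (double_cell r)"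
  by (rule inj_onI) (metis twist_rel_twist twist_rel_inj)

lemma twist_partial_inv:
  assumes "twist_rel r x y"
  shows "partial_inv (double_cell r) (iota_anti r \<circ> zeta_twist r) y = Some x"
proof -
  have x: "x \<in> double_cell r" by (rule twist_rel_double_cell[OF assms])
  have "the_inv_into (double_cell r) (iota_anti r \<circ> zeta_twist r) y = x"
    by (rule the_inv_into_f_eq[OF twist_inj_on twist_eq[OF assms] x])
  moreover have "y \<in> (iota_anti r \<circ> zeta_twist r) ` double_cell r"
    using twist_eq[OF assms] x by (metis image_eqI)
  ultimately show ?thesis by (simp add: partial_inv_def del: comp_apply)
qed

section \<open>The crystal functions in terms of matrix entries\<close>

lemma elementary_mult_index:
  assumes "X \<in> carrier_mat (Suc r) (Suc r)" "q < Suc r" "a < Suc r" "b < Suc r"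
  shows "(elementary r p q c * X) $$ (a, b) = X $$ (a, b) + (if a = p then c * X $$ (q, b) else 0)"
  using assms by (simp add: elementary_mult)

lemma mult_elementary_index:
  assumes "X \<in> carrier_mat (Suc r) (Suc r)" "p < Suc r" "a < Suc r" "b < Suc r"
  shows "(X * elementary r p q c) $$ (a, b) = X $$ (a, b) + (if b = q then c * X $$ (a, p) else 0)"
  using addcol_mat[OF assms(1,2), of c q, symmetric] assms by simp

lemma lower_N_torus:
  assumes "y \<in> lower_SL r"
  obtains n t where "n \<in> N_minus r" "t \<in> torus_H r" "y = n * t"
    "\<And>a b. a < Suc r \<Longrightarrow> b < Suc r \<Longrightarrow> y $$ (a, b) = n $$ (a, b) * y $$ (b, b)"
    "\<And>b. b < Suc r \<Longrightarrow> t $$ (b, b) = y $$ (b, b)"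
proof -
  let ?t = "diag_part r y"
  define n where "n = y * inv\<^bsub>SL r\<^esub> ?t"
  have n: "n \<in> N_minus r" "y = n * ?t" unfolding n_def by (rule lower_SL_factor[OF assms])+
  have t: "?t \<in> torus_H r" by (rule diag_part_lower_torus[OF assms])
  have nc: "n \<in> carrier_mat (Suc r) (Suc r)" using n by simp
  have tc: "?t \<in> carrier_mat (Suc r) (Suc r)" using t by simp
  have "y $$ (a, b) = n $$ (a, b) * y $$ (b, b)" if "a < Suc r" "b < Suc r" for a b
  proof -
    have "y $$ (a, b) = (n * ?t) $$ (a, b)" by (rule arg_cong[OF n(2), of "\<lambda>m. m $$ (a, b)"])
    also have "\<dots> = (\<Sum>l<Suc r. n $$ (a, l) * ?t $$ (l, b))"
      by (rule mult_index[OF nc tc that])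
    also have "\<dots> = (\<Sum>l<Suc r. if l = b then n $$ (a, b) * y $$ (b, b) else 0)"
      by (rule sum.cong[OF refl]) (use that in \<open>auto simp: diag_part_def\<close>)
    finally show ?thesis using that by (simp del: sum.lessThan_Suc)
  qed
  moreover have "?t $$ (b, b) = y $$ (b, b)" if "b < Suc r" for b using that by (simp add: diag_part_def)
  ultimately show ?thesis by (rule that[OF n(1) t n(2)])
qed

lemma lower_SL_diag_nonzero:
  assumes "y \<in> lower_SL r" "b < Suc r" shows "y $$ (b, b) \<noteq> 0"
proof -
  have "dim_row y = Suc r" "dim_col y = Suc r" using SL_carrierD[OF lower_SL_SL[OF assms(1)]] by auto
  thus ?thesis using upper_SL_diag_nonzero[OF transpose_triangular(4)[OF assms(1)] assms(2)] assms(2) by simp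
qed

lemma less_rank:
  "i \<in> {1..r} \<Longrightarrow> i - Suc 0 < Suc r" "i \<in> {1..r} \<Longrightarrow> i < Suc r"
  "i \<in> {1..r} \<Longrightarrow> i - Suc 0 \<noteq> i" "i \<in> {1..r} \<Longrightarrow> i \<noteq> i - Suc 0"
  by auto

lemma gamma_cr_eq:
  assumes y: "y \<in> lower_SL r" and i: "i \<in> {1..r}"
  shows "gamma_cr r i y = y $$ (i - 1, i - 1) / y $$ (i, i)"
proof -
  obtain n t where nt: "n \<in> N_minus r" "t \<in> torus_H r" "y = n * t"
    and t: "\<And>b. b < Suc r \<Longrightarrow> t $$ (b, b) = y $$ (b, b)"
    using lower_N_torus[OF y] by metis
  have "(THE t. t \<in> torus_H r \<and> (\<exists>n\<in>N_minus r. y = n * t)) = t"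
  proof (rule the_equality)
    fix t' assume "t' \<in> torus_H r \<and> (\<exists>n\<in>N_minus r. y = n * t')"
    then obtain n' where n': "t' \<in> torus_H r" "n' \<in> N_minus r" "y = n' * t'" by blast
    have "n = n'" by (rule gauss_unique[of _ r _ t t']) (use nt n' torus_subset_upper in auto)
    hence "inv\<^bsub>SL r\<^esub> n * (n * t) = inv\<^bsub>SL r\<^esub> n * (n * t')" using nt(3) n'(3) by simp
    thus "t' = t" using SL_cancel(1)[of n r t] SL_cancel(1)[of n r t'] nt n' by simp
  qed (use nt in blast)
  thus ?thesis using t[of "i - 1"] t[of i] less_rank[OF i] by (simp add: gamma_cr_def simple_root_def)
qed

text \<open>The second factor ranges over the elements of N^- whose entry (i, i-1), counted from 0,
  vanishes: this is the one position below the diagonal that conjugation by s_i moves above it. Left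
  multiplication by y_i(a) then adds exactly a to that entry.\<close>

lemma chi_N_eq:
  assumes n: "n \<in> N_minus r" and i: "i \<in> {1..r}"
  shows "chi_N r i n = n $$ (i, i - 1)"
  unfolding chi_N_def
proof (rule the_equality)
  let ?s = "s_bar r i"
  have sw: "adj_swap i (adj_swap i b) = b" for b by (simp add: adj_swap_def)
  note s = s_bar_signed_perm[OF i] s_bar_SL[OF i]
  note conj = signed_perm_conj[OF s(1) sw]
  define n' where "n' = y_gen r i (- n $$ (i, i - 1)) * n"
  have y: "y_gen r i a = elementary r i (i - 1) a" for a using i by (simp add: y_gen_elementary)
  have yN: "y_gen r i a \<in> N_minus r" for a using i by (simp add: y elementary_lower)
  have nc: "n \<in> carrier_mat (Suc r) (Suc r)" using n by simp
  have n'N: "n' \<in> N_minus r" unfolding n'_def using yN n by blast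
  hence n'c: "n' \<in> carrier_mat (Suc r) (Suc r)" by simp
  have z: "n' $$ (i, i - 1) = 0"
    using less_rank[OF i] n elementary_mult_index[OF nc, of "i - 1" i "i - 1" "- n $$ (i, i - 1)" i]
    by (simp add: n'_def y N_minus_iff)
  define u where "u = inv\<^bsub>SL r\<^esub> ?s * n' * ?s"
  have u: "u \<in> N_minus r"
  proof -
    have "u \<in> lower_SL r"
    proof (rule lower_SLI)
      fix a b assume ab: "a < b" "b < Suc r"
      \<comment> \<open>s_i reverses the order of a single pair of indices, and the entry of n' at
        the reversed pair has been cleared.\<close>
      hence "adj_swap i a < adj_swap i b \<or> (adj_swap i a = i \<and> adj_swap i b = i - 1)"
        by (auto simp: adj_swap_def)
      moreover have "adj_swap i b < Suc r" using ab i by (auto simp: adj_swap_def)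
      ultimately have "n' $$ (adj_swap i a, adj_swap i b) = 0"
        using z lower_SL_index[OF N_minus_subset_lower[OF n'N]] by auto
      thus "u $$ (a, b) = 0" using conj(1)[OF n'c, of a b] ab by (simp add: u_def)
    qed (use s n'N in \<open>simp add: u_def\<close>)
    moreover have "u $$ (a, a) = 1" if a: "a < Suc r" for a
    proof -
      have "adj_swap i a < Suc r" using a i by (auto simp: adj_swap_def)
      thus ?thesis using conj(1)[OF n'c a a] n'N by (simp add: u_def N_minus_iff)
    qed
    ultimately show ?thesis by (simp add: N_minus_iff)
  qed
  have "n' = ?s * u * inv\<^bsub>SL r\<^esub> ?s"
    using s n'N by (simp add: u_def SL_assoc[of _ r] SL_cancel[of _ r] SL_inv_mult)
  moreover have "n = y_gen r i (n $$ (i, i - 1)) * n'"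
    using SL_cancel(2)[OF elementary_SL[of i "i - 1" r "n $$ (i, i - 1)"] N_minus_SL[OF n]] less_rank[OF i]
    by (simp add: n'_def y elementary_inv)
  ultimately show "\<exists>n'. n' \<in> N_minus r
      \<and> n' \<in> {?s * u * inv\<^bsub>SL r\<^esub> ?s | u. u \<in> N_minus r} \<and> n = y_gen r i (n $$ (i, i - 1)) * n'"
    using n'N u by blast
next
  let ?s = "s_bar r i"
  have sw: "adj_swap i (adj_swap i b) = b" for b by (simp add: adj_swap_def)
  note conj = signed_perm_conj[OF s_bar_signed_perm[OF i] sw]
  fix a assume "\<exists>n'. n' \<in> N_minus r
      \<and> n' \<in> {?s * u * inv\<^bsub>SL r\<^esub> ?s | u. u \<in> N_minus r} \<and> n = y_gen r i a * n'"
  then obtain n' u where *: "n' \<in> N_minus r" "u \<in> N_minus r" "n' = ?s * u * inv\<^bsub>SL r\<^esub> ?s"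
    "n = y_gen r i a * n'" by blast
  have uc: "u \<in> carrier_mat (Suc r) (Suc r)" and n'c: "n' \<in> carrier_mat (Suc r) (Suc r)" using * by auto
  have "u $$ (i - 1, i) = 0"
    using lower_SL_index[OF N_minus_subset_lower[OF *(2)], of "i - 1" i] i by auto
  hence "n' $$ (i, i - 1) = 0"
    using conj(2)[OF uc, of i "i - 1"] less_rank[OF i] *(3) by (simp add: adj_swap_def)
  moreover have "n' $$ (i - 1, i - 1) = 1" using *(1) less_rank[OF i] by (simp add: N_minus_iff)
  ultimately show "a = n $$ (i, i - 1)"
    using i less_rank[OF i] elementary_mult_index[OF n'c, of "i - 1" i "i - 1" a i]
    by (simp add: *(4) y_gen_elementary)
qed

lemma chi_cr_eq:
  assumes y: "y \<in> lower_SL r" and i: "i \<in> {1..r}"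
  shows "chi_cr r i y = y $$ (i, i - 1) / y $$ (i - 1, i - 1)"
proof -
  obtain n t where nt: "n \<in> N_minus r" "t \<in> torus_H r" "y = n * t"
    and yn: "\<And>a b. a < Suc r \<Longrightarrow> b < Suc r \<Longrightarrow> y $$ (a, b) = n $$ (a, b) * y $$ (b, b)"
    using lower_N_torus[OF y] by metis
  have "(THE n. n \<in> N_minus r \<and> (\<exists>t\<in>torus_H r. y = n * t)) = n"
  proof (rule the_equality)
    fix n' assume "n' \<in> N_minus r \<and> (\<exists>t\<in>torus_H r. y = n' * t)"
    then obtain t' where n': "t' \<in> torus_H r" "n' \<in> N_minus r" "y = n' * t'" by blast
    show "n' = n" by (rule gauss_unique[of _ r _ t' t]) (use nt n' torus_subset_upper in auto)
  qed (use nt in blast)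
  thus ?thesis
    using less_rank[OF i] yn[of i "i - 1"] lower_SL_diag_nonzero[OF y, of "i - 1"]
    by (simp add: chi_cr_def chi_N_eq[OF nt(1) i])
qed

text \<open>The left factor adds a multiple of row i to row p = i - 1, the right factor a multiple
  of column p to column i. The only entry above the diagonal that they can create is (p, i), and the
  parameters of the crystal are the ones for which its two contributions cancel.\<close>

lemma crystal_image_lower:
  assumes y: "y \<in> lower_SL r" and i: "i \<in> {1..r}" and c: "c \<noteq> 0" and \<chi>: "chi_cr r i y \<noteq> 0"
  shows "x_gen r i ((c - 1) * phi_cr r i y) * y * x_gen r i ((inverse c - 1) * epsilon_cr r i y)
    \<in> lower_SL r"
proof -
  define a b where "a = (c - 1) * phi_cr r i y" and "b = (inverse c - 1) * epsilon_cr r i y"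
  define p where "p = i - 1"
  have pi: "i = Suc p" "p < r" "Suc p < Suc r" using i by (auto simp: p_def)
  have x: "x_gen r i t = elementary r p i t" for t using i by (simp add: x_gen_elementary p_def)
  have yc: "y \<in> carrier_mat (Suc r) (Suc r)" using y by simp
  let ?z = "elementary r p i a * y"
  have zc: "?z \<in> carrier_mat (Suc r) (Suc r)" using yc by (auto intro: mult_carrier_mat)
  have e: "elementary r p i t \<in> carrier (SL r)" for t using pi by (simp add: elementary_SL)
  have nz: "y $$ (p, p) \<noteq> 0" "y $$ (i, i) \<noteq> 0" "y $$ (i, p) \<noteq> 0"
    using lower_SL_diag_nonzero[OF y] pi chi_cr_eq[OF y i] \<chi> by auto
  have ab: "a = (c - 1) * y $$ (p, p) / y $$ (i, p)" "b = (inverse c - 1) * y $$ (i, i) / y $$ (i, p)"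
    using nz by (simp_all add: a_def b_def phi_cr_def epsilon_cr_def chi_cr_eq[OF y i]
      gamma_cr_eq[OF y i] p_def)
  have "?z * elementary r p i b \<in> lower_SL r"
  proof (rule lower_SLI)
    fix k l assume kl: "k < l" "l < Suc r"
    have z: "?z $$ (k, m) = y $$ (k, m) + (if k = p then a * y $$ (i, m) else 0)" if "m < Suc r" for m
      using elementary_mult_index[OF yc, of i k m a p] kl that pi by simp
    have "(?z * elementary r p i b) $$ (k, l) = ?z $$ (k, l) + (if l = i then b * ?z $$ (k, p) else 0)"
      using mult_elementary_index[OF zc, of p k l b i] kl pi by simp
    also have "\<dots> = 0"
    proof -
      have y0: "y $$ (k, l) = 0" "l = i \<Longrightarrow> k \<noteq> p \<Longrightarrow> y $$ (k, p) = 0" "k = p \<Longrightarrow> l \<noteq> i \<Longrightarrow> y $$ (i, l) = 0"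
        using kl lower_SL_index[OF y] pi by auto
      \<comment> \<open>The left factor multiplies the diagonal entry (p,p) by c, which explains the
        inverse of c in the parameter on the right.\<close>
      have "y $$ (p, p) + a * y $$ (i, p) = c * y $$ (p, p)"
      proof -
        have "a * y $$ (i, p) = (c - 1) * y $$ (p, p)" using nz by (simp add: ab)
        thus ?thesis by (simp add: algebra_simps)
      qed
      moreover have "a * y $$ (i, i) + b * (c * y $$ (p, p)) = 0"
        using nz c by (simp add: ab divide_simps) (simp add: algebra_simps)
      ultimately have e: "a * y $$ (i, i) + b * (y $$ (p, p) + a * y $$ (i, p)) = 0" by simp
      consider "k = p" "l = i" | "k = p" "l \<noteq> i" | "k \<noteq> p" "l = i" | "k \<noteq> p" "l \<noteq> i" by blast
      thus ?thesis
        by cases (use y0 z[OF kl(2)] z[of p] pi e in simp_all)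
    qed
    finally show "(?z * elementary r p i b) $$ (k, l) = 0" .
  qed (use e y in simp)
  thus ?thesis by (simp add: x a_def b_def)
qed

lemma twist_rel_crystal:
  assumes xy: "twist_rel r x y" and i: "i \<in> {1..r}"
    and l: "x_gen r i a * y * x_gen r i b \<in> lower_SL r"
  shows "twist_rel r (x * y_gen r i a) (x_gen r i a * y * x_gen r i b)"
proof -
  obtain u where x: "x \<in> lower_SL r" and y: "y \<in> lower_SL r" and u: "u \<in> N_plus r"
    and eq: "x = u * w0_bar r * transpose_mat y"
    using xy by (auto simp: twist_rel_def)
  let ?w = "w0_bar r" and ?Y = "y_gen r i"
  have Y: "?Y t \<in> N_minus r" for t using i by (simp add: y_gen_elementary elementary_lower)
  have X: "x_gen r i t \<in> carrier (SL r)" "transpose_mat (x_gen r i t) = ?Y t" for t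
    using i less_rank[OF i] by (simp_all add: x_gen_elementary y_gen_elementary elementary_SL elementary_transpose)
  have inv: "inv\<^bsub>SL r\<^esub> (?Y b) \<in> N_minus r" using Y by auto
  \<comment> \<open>Transposing the crystal image puts y_i(b) directly after w_0; this factor, which
    lies in N, cancels it.\<close>
  let ?v = "?w * inv\<^bsub>SL r\<^esub> (?Y b) * inv\<^bsub>SL r\<^esub> ?w"
  have v: "u * ?v \<in> N_plus r" using w0_bar_conj_N(2)[OF inv] u by blast
  have t: "transpose_mat (x_gen r i a * y * x_gen r i b) = ?Y b * (transpose_mat y * ?Y a)"
    using X y SL_transpose_mult[of "x_gen r i a * y" r "x_gen r i b"]
      SL_transpose_mult[of "x_gen r i a" r y] by simp
  have "u * ?v * ?w * (?Y b * (transpose_mat y * ?Y a)) = x * ?Y a"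
    using Y[of a] Y[of b] u y by (simp add: eq SL_assoc[of _ r] SL_cancel[of _ r])
  hence "x * ?Y a = u * ?v * ?w * transpose_mat (x_gen r i a * y * x_gen r i b)" by (simp add: t)
  moreover have "x * ?Y a \<in> lower_SL r" using x Y N_minus_subset_lower by blast
  ultimately show ?thesis using l v unfolding twist_rel_def by blast
qed

section \<open>Determinant identities\<close>

text \<open>A determinant is affine in its corner entry: the cofactors along the last row do not
  contain that row, and the slope is the complementary minor.\<close>

lemma det_last_entry:
  fixes F G :: "nat \<times> nat \<Rightarrow> 'a :: comm_ring_1"
  assumes eq: "\<And>i j. i \<le> q \<Longrightarrow> j \<le> q \<Longrightarrow> (i, j) \<noteq> (q, q) \<Longrightarrow> F (i, j) = G (i, j)"
  shows "det (mat (Suc q) (Suc q) F) - det (mat (Suc q) (Suc q) G) = (F (q, q) - G (q, q)) * det (mat q q F)"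
proof -
  let ?A = "mat (Suc q) (Suc q) F" and ?B = "mat (Suc q) (Suc q) G"
  have cof: "cofactor ?A q j = cofactor ?B q j" if "j < Suc q" for j
  proof -
    have "mat_delete ?A q j = mat_delete ?B q j"
      by (rule eq_matI) (use that eq in \<open>auto simp: mat_delete_def\<close>)
    thus ?thesis by (simp add: cofactor_def)
  qed
  have "mat_delete ?A q q = mat q q F" by (rule eq_matI) (auto simp: mat_delete_def)
  hence cq: "cofactor ?A q q = det (mat q q F)" by (simp add: cofactor_def flip: mult_2)
  have "det ?A = (\<Sum>j<Suc q. ?A $$ (q, j) * cofactor ?A q j)"
    by (rule laplace_expansion_row) auto
  also have "\<dots> = (\<Sum>j<q. F (q, j) * cofactor ?A q j) + F (q, q) * det (mat q q F)"
    by (simp add: cq)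
  finally have A: "det ?A = \<dots>" .
  have "det ?B = (\<Sum>j<Suc q. ?B $$ (q, j) * cofactor ?B q j)"
    by (rule laplace_expansion_row) auto
  also have "\<dots> = (\<Sum>j<Suc q. ?B $$ (q, j) * cofactor ?A q j)"
    by (rule sum.cong) (simp_all add: cof)
  also have "\<dots> = (\<Sum>j<q. F (q, j) * cofactor ?A q j) + G (q, q) * det (mat q q F)"
    by (simp add: cq eq)
  finally show ?thesis unfolding A by (simp add: algebra_simps)
qed

lemma det_last_row_zero:
  fixes F :: "nat \<times> nat \<Rightarrow> 'a :: comm_ring_1"
  assumes "\<And>j. j < e \<Longrightarrow> F (e, j) = 0"
  shows "det (mat (Suc e) (Suc e) F) = F (e, e) * det (mat e e F)"
proof -
  let ?A = "mat (Suc e) (Suc e) F"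
  have "mat_delete ?A e e = mat e e F" by (rule eq_matI) (auto simp: mat_delete_def)
  hence "cofactor ?A e e = det (mat e e F)" by (simp add: cofactor_def flip: mult_2)
  moreover have "det ?A = (\<Sum>j<Suc e. ?A $$ (e, j) * cofactor ?A e j)"
    by (rule laplace_expansion_row) auto
  ultimately show ?thesis using assms by simp
qed

lemma det_last_column:
  fixes F G H :: "nat \<times> nat \<Rightarrow> 'a :: comm_ring_1"
  assumes eq: "\<And>i j. i \<le> q \<Longrightarrow> j < q \<Longrightarrow> F (i, j) = H (i, j) \<and> G (i, j) = H (i, j)"
    and col: "\<And>i. i \<le> q \<Longrightarrow> H (i, q) = F (i, q) + a * G (i, q)"
  shows "det (mat (Suc q) (Suc q) H) = det (mat (Suc q) (Suc q) F) + a * det (mat (Suc q) (Suc q) G)"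
proof -
  have cof: "cofactor (mat (Suc q) (Suc q) F) i q = cofactor (mat (Suc q) (Suc q) H) i q
      \<and> cofactor (mat (Suc q) (Suc q) G) i q = cofactor (mat (Suc q) (Suc q) H) i q"
    if "i < Suc q" for i
  proof -
    have "mat_delete (mat (Suc q) (Suc q) F) i q = mat_delete (mat (Suc q) (Suc q) H) i q"
      "mat_delete (mat (Suc q) (Suc q) G) i q = mat_delete (mat (Suc q) (Suc q) H) i q"
      by (rule eq_matI; use that eq in \<open>auto simp: mat_delete_def\<close>)+
    thus ?thesis by (simp add: cofactor_def)
  qed
  have exp: "det (mat (Suc q) (Suc q) K) = (\<Sum>i<Suc q. K (i, q) * cofactor (mat (Suc q) (Suc q) K) i q)"
    for K :: "nat \<times> nat \<Rightarrow> 'a"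
    by (subst laplace_expansion_column[of _ "Suc q" q]) (auto intro!: sum.cong)
  have "det (mat (Suc q) (Suc q) H)
    = (\<Sum>i<Suc q. F (i, q) * cofactor (mat (Suc q) (Suc q) F) i q
        + a * (G (i, q) * cofactor (mat (Suc q) (Suc q) G) i q))"
    unfolding exp[of H] by (rule sum.cong[OF refl]) (use col cof in \<open>simp add: algebra_simps\<close>)
  thus ?thesis unfolding exp[of F] exp[of G] by (simp only: sum.distrib sum_distrib_left)
qed

lemma det_mat_2:
  fixes F :: "nat \<times> nat \<Rightarrow> 'a :: comm_ring_1"
  shows "det (mat 2 2 F) = F (0, 0) * F (1, 1) - F (0, 1) * F (1, 0)"
proof -
  let ?A = "mat 2 2 F"
  have "det ?A = (\<Sum>i<2. ?A $$ (i, 0) * cofactor ?A i 0)"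
    by (rule laplace_expansion_column) auto
  moreover have "mat_delete ?A 0 0 = mat 1 1 (\<lambda>_. F (1, 1))" "mat_delete ?A 1 0 = mat 1 1 (\<lambda>_. F (0, 1))"
    by (rule eq_matI; auto simp: mat_delete_def)+
  ultimately show ?thesis
    by (simp add: numeral_2_eq_2 cofactor_def det_single)
qed

text \<open>Multiplying by the identity with its last two columns replaced by the first and last columns
  of the adjugate gives this Desnanot--Jacobi identity up to a factor \<open>det M\<close>.\<close>

lemma desnanot_jacobi:
  fixes F :: "nat \<Rightarrow> nat \<Rightarrow> 'a :: field"
  assumes nz: "det (mat (Suc (Suc e)) (Suc (Suc e)) (\<lambda>(i, j). F i j)) \<noteq> 0"
  shows "det (mat (Suc e) (Suc e) (\<lambda>(i, j). F (Suc i) (if j = e then Suc e else j)))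
        * det (mat (Suc e) (Suc e) (\<lambda>(i, j). F i j))
      - det (mat (Suc e) (Suc e) (\<lambda>(i, j). F i (if j = e then Suc e else j)))
        * det (mat (Suc e) (Suc e) (\<lambda>(i, j). F (Suc i) j))
      = det (mat (Suc (Suc e)) (Suc (Suc e)) (\<lambda>(i, j). F i j)) * det (mat e e (\<lambda>(i, j). F (Suc i) j))"
proof -
  define n where "n = Suc (Suc e)"
  define M where "M = mat n n (\<lambda>(i, j). F i j)"
  define D where "D = det M"
  define R where "R = adj_mat M"
  define I where "I = det (mat e e (\<lambda>(i, j). F (Suc i) j))"
  have Mc: "M \<in> carrier_mat n n" by (simp add: M_def)
  have Rc: "R \<in> carrier_mat n n" unfolding R_def by (rule adj_mat(1)[OF Mc])
  define Q where "Q = mat n n (\<lambda>(i, j). if j < e then if i = j then 1 else 0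
    else if j = e then R $$ (i, 0) else R $$ (i, Suc e))"
  define K where "K = mat n n (\<lambda>(i, j). if j < e then F i j
    else if j = e then if i = 0 then D else 0 else if i = Suc e then D else 0)"
  have Qc: "Q \<in> carrier_mat n n" by (simp add: Q_def)
  have MR: "(\<Sum>l<n. M $$ (i, l) * R $$ (l, j)) = (if i = j then D else 0)" if "i < n" "j < n" for i j
  proof -
    have "(M * R) $$ (i, j) = (if i = j then D else 0)"
      unfolding R_def adj_mat(2)[OF Mc] using that by (simp add: D_def)
    thus ?thesis using mult_index[OF Mc Rc that] by simp
  qed
  have "M * Q = K"
  proof (rule eq_matI)
    fix i j assume "i < dim_row K" "j < dim_col K"
    hence ij: "i < n" "j < n" by (auto simp: K_def)
    have MQ: "(M * Q) $$ (i, j) = (\<Sum>l<n. M $$ (i, l) * Q $$ (l, j))" by (rule mult_index[OF Mc Qc ij])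
    consider "j < e" | "j = e" | "j = Suc e" using ij(2) unfolding n_def by linarith
    thus "(M * Q) $$ (i, j) = K $$ (i, j)"
    proof cases
      case 1
      have "(\<Sum>l<n. M $$ (i, l) * Q $$ (l, j)) = (\<Sum>l<n. if l = j then M $$ (i, j) else 0)"
        by (rule sum.cong) (use 1 ij in \<open>auto simp: Q_def\<close>)
      also have "\<dots> = M $$ (i, j)" using ij by simp
      finally show ?thesis unfolding MQ using 1 ij by (simp add: M_def K_def)
    next
      case 2
      have "(\<Sum>l<n. M $$ (i, l) * Q $$ (l, j)) = (\<Sum>l<n. M $$ (i, l) * R $$ (l, 0))"
        by (rule sum.cong) (use 2 ij in \<open>auto simp: Q_def\<close>)
      thus ?thesis unfolding MQ using MR[of i 0] 2 ij by (simp add: K_def)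
    next
      case 3
      have "(\<Sum>l<n. M $$ (i, l) * Q $$ (l, j)) = (\<Sum>l<n. M $$ (i, l) * R $$ (l, Suc e))"
        by (rule sum.cong) (use 3 ij in \<open>auto simp: Q_def\<close>)
      thus ?thesis unfolding MQ using MR[of i "Suc e"] 3 ij by (simp add: K_def)
    qed
  qed (simp_all add: K_def Q_def M_def)
  hence KQ: "det K = D * det Q" using det_mult[OF Mc Qc] by (simp add: D_def)
  have K: "det K = D * (D * ((- 1) ^ e * I))"
  proof -
    have Kc: "K \<in> carrier_mat n n" by (simp add: K_def)
    let ?L = "mat (Suc e) (Suc e) (\<lambda>(i, j). if j < e then F i j else if i = 0 then D else 0)"
    have "mat_delete K (Suc e) (Suc e) = ?L"
      by (rule eq_matI) (auto simp: mat_delete_def K_def n_def)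
    hence c: "cofactor K (Suc e) (Suc e) = det ?L" by (simp add: cofactor_def flip: mult_2)
    have "det K = (\<Sum>i<n. K $$ (i, Suc e) * cofactor K i (Suc e))"
      by (rule laplace_expansion_column[OF Kc]) (simp add: n_def)
    also have "\<dots> = (\<Sum>i<n. if i = Suc e then D * det ?L else 0)"
    proof (rule sum.cong[OF refl])
      fix i assume "i \<in> {..<n}"
      hence "K $$ (i, Suc e) = (if i = Suc e then D else 0)" by (simp add: K_def n_def)
      thus "K $$ (i, Suc e) * cofactor K i (Suc e) = (if i = Suc e then D * det ?L else 0)"
        using c by simp
    qed
    finally have 1: "det K = D * det ?L" by (simp add: n_def)
    have "mat_delete ?L 0 e = mat e e (\<lambda>(i, j). F (Suc i) j)"
      by (rule eq_matI) (auto simp: mat_delete_def)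
    hence c': "cofactor ?L 0 e = (- 1) ^ e * I" by (simp add: cofactor_def I_def)
    have "det ?L = (\<Sum>i<Suc e. ?L $$ (i, e) * cofactor ?L i e)"
      by (rule laplace_expansion_column) auto
    also have "\<dots> = (\<Sum>i<Suc e. if i = 0 then D * ((- 1) ^ e * I) else 0)"
      by (rule sum.cong) (auto simp: c')
    finally have "det ?L = D * ((- 1) ^ e * I)" by simp
    thus ?thesis using 1 by simp
  qed
  have Q: "det Q = R $$ (e, 0) * R $$ (Suc e, Suc e) - R $$ (e, Suc e) * R $$ (Suc e, 0)"
  proof -
    let ?B = "mat e 2 (\<lambda>(i, j). Q $$ (i, e + j))" and ?C = "mat 2 2 (\<lambda>(i, j). Q $$ (e + i, e + j))"
    have "Q = four_block_mat (1\<^sub>m e) ?B (0\<^sub>m 2 e) ?C"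
      by (rule eq_matI) (auto simp: Q_def n_def)
    hence "det Q = det (four_block_mat (1\<^sub>m e) ?B (0\<^sub>m 2 e) ?C)" by (rule arg_cong)
    also have "\<dots> = det (1\<^sub>m e) * det ?C"
      by (rule det_four_block_mat_lower_left_zero) auto
    finally have "det Q = det (1\<^sub>m e) * det ?C" .
    thus ?thesis unfolding det_mat_2 by (simp add: Q_def n_def)
  qed
  have cof: "R $$ (i, j) = (- 1) ^ (i + j) * det (mat_delete M j i)" if "i < n" "j < n" for i j
    using that Mc by (auto simp: R_def adj_mat_def cofactor_def add.commute)
  let ?a = "det (mat (Suc e) (Suc e) (\<lambda>(i, j). F (Suc i) (if j = e then Suc e else j)))"
  let ?b = "det (mat (Suc e) (Suc e) (\<lambda>(i, j). F i j))"
  let ?c = "det (mat (Suc e) (Suc e) (\<lambda>(i, j). F i (if j = e then Suc e else j)))"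
  let ?d = "det (mat (Suc e) (Suc e) (\<lambda>(i, j). F (Suc i) j))"
  have del: "mat_delete M 0 e = mat (Suc e) (Suc e) (\<lambda>(i, j). F (Suc i) (if j = e then Suc e else j))"
    "mat_delete M (Suc e) (Suc e) = mat (Suc e) (Suc e) (\<lambda>(i, j). F i j)"
    "mat_delete M (Suc e) e = mat (Suc e) (Suc e) (\<lambda>(i, j). F i (if j = e then Suc e else j))"
    "mat_delete M 0 (Suc e) = mat (Suc e) (Suc e) (\<lambda>(i, j). F (Suc i) j)"
    by (rule eq_matI; force simp: mat_delete_def M_def n_def)+
  have sq: "(- 1 :: 'a) ^ (k + k) = 1" for k by (simp flip: mult_2)
  have R: "R $$ (e, 0) = (- 1) ^ e * ?a" "R $$ (Suc e, Suc e) = ?b" "R $$ (e, Suc e) = - ?c"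
    "R $$ (Suc e, 0) = - ((- 1) ^ e * ?d)"
    by (subst cof; simp add: n_def del sq)+
  have "D * (D * ((- 1) ^ e * I)) = D * ((- 1) ^ e * (?a * ?b - ?c * ?d))"
    using K KQ by (simp add: Q R algebra_simps)
  moreover have "D \<noteq> 0" using nz by (simp add: D_def M_def n_def)
  ultimately have "D * ((- 1) ^ e * I) = (- 1) ^ e * (?a * ?b - ?c * ?d)"
    by (rule mult_left_cancel[THEN iffD1, rotated])
  hence "(- 1) ^ e * (D * I) = (- 1) ^ e * (?a * ?b - ?c * ?d)" by (simp only: mult.left_commute)
  hence "D * I = ?a * ?b - ?c * ?d" by (rule mult_left_cancel[THEN iffD1, rotated]) simp
  thus ?thesis by (simp add: D_def M_def n_def I_def)
qed

text \<open>Cramer's rule for a row vector times a matrix: c is v times the adjugate, divided by the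
  determinant.\<close>

lemma det_solve_row:
  fixes F :: "nat \<Rightarrow> nat \<Rightarrow> 'a :: field"
  assumes "det (mat n n (\<lambda>(i, j). F i j)) \<noteq> 0"
  shows "\<exists>c. \<forall>j<n. (\<Sum>l<n. c l * F l j) = v j"
proof -
  define G where "G = mat n n (\<lambda>(i, j). F i j)"
  define D where "D = det G"
  have Gc: "G \<in> carrier_mat n n" by (simp add: G_def)
  note A = adj_mat[OF Gc]
  define c where "c l = (\<Sum>k<n. v k * adj_mat G $$ (k, l)) / D" for l
  have "(\<Sum>l<n. c l * F l j) = v j" if j: "j < n" for j
  proof -
    have e: "(\<Sum>l<n. adj_mat G $$ (k, l) * F l j) = (if k = j then D else 0)" if "k < n" for k
    proof -
      have "(adj_mat G * G) $$ (k, j) = (if k = j then D else 0)" unfolding A(3) using that j by (simp add: D_def)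
      thus ?thesis unfolding mult_index[OF A(1) Gc that j] using j by (simp add: G_def)
    qed
    have "(\<Sum>l<n. c l * F l j) = (\<Sum>l<n. \<Sum>k<n. v k * (adj_mat G $$ (k, l) * F l j)) / D"
      by (simp add: c_def sum_divide_distrib sum_distrib_right mult.assoc)
    also have "(\<Sum>l<n. \<Sum>k<n. v k * (adj_mat G $$ (k, l) * F l j)) = (\<Sum>k<n. v k * (\<Sum>l<n. adj_mat G $$ (k, l) * F l j))"
      by (subst sum.swap) (simp add: sum_distrib_left)
    also have "\<dots> = (\<Sum>k<n. if k = j then v j * D else 0)" by (rule sum.cong) (auto simp: e)
    finally show ?thesis using j assms by (simp add: D_def G_def)
  qed
  thus ?thesis by blast
qed

text \<open>A degenerate case of Cauchy-Binet: the chosen rows of A are supported on the first d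
  columns, so only one intermediate index set contributes.\<close>

lemma mat_mult_block:
  fixes A B :: "'a :: comm_ring_1 mat"
  assumes A: "A \<in> carrier_mat n n" and B: "B \<in> carrier_mat n n" and d: "d \<le> n"
    and \<rho>: "\<And>i. i < d \<Longrightarrow> \<rho> i < n" and \<sigma>: "\<And>j. j < d \<Longrightarrow> \<sigma> j < n"
    and z: "\<And>i l. i < d \<Longrightarrow> d \<le> l \<Longrightarrow> l < n \<Longrightarrow> A $$ (\<rho> i, l) = 0"
  shows "mat d d (\<lambda>(i, j). (A * B) $$ (\<rho> i, \<sigma> j))
    = mat d d (\<lambda>(i, l). A $$ (\<rho> i, l)) * mat d d (\<lambda>(l, j). B $$ (l, \<sigma> j))"
proof (rule eq_matI)
  fix i j assume "i < dim_row (mat d d (\<lambda>(i, l). A $$ (\<rho> i, l)) * mat d d (\<lambda>(l, j). B $$ (l, \<sigma> j)))"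
    "j < dim_col (mat d d (\<lambda>(i, l). A $$ (\<rho> i, l)) * mat d d (\<lambda>(l, j). B $$ (l, \<sigma> j)))"
  hence ij: "i < d" "j < d" by auto
  have "(A * B) $$ (\<rho> i, \<sigma> j) = (\<Sum>l<n. A $$ (\<rho> i, l) * B $$ (l, \<sigma> j))"
    by (rule mult_index[OF A B \<rho>[OF ij(1)] \<sigma>[OF ij(2)]])
  also have "\<dots> = (\<Sum>l<d. A $$ (\<rho> i, l) * B $$ (l, \<sigma> j))"
    by (rule sum.mono_neutral_right) (use d z ij in auto)
  also have "\<dots> = (mat d d (\<lambda>(i, l). A $$ (\<rho> i, l)) * mat d d (\<lambda>(l, j). B $$ (l, \<sigma> j))) $$ (i, j)"
    by (subst mult_index[of _ d d _ d]) (use ij in auto)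
  finally show "mat d d (\<lambda>(i, j). (A * B) $$ (\<rho> i, \<sigma> j)) $$ (i, j)
      = (mat d d (\<lambda>(i, l). A $$ (\<rho> i, l)) * mat d d (\<lambda>(l, j). B $$ (l, \<sigma> j))) $$ (i, j)"
    using ij by simp
qed auto

section \<open>Initial minors\<close>

text \<open>\<open>imin x m d\<close> is the minor with rows \<open>m + 1, \<dots>, m + d\<close> and columns \<open>1, \<dots>, d\<close>; in \<open>imin'\<close>
  the last column is \<open>d + 1\<close>.\<close>

definition imin :: "complex mat \<Rightarrow> nat \<Rightarrow> nat \<Rightarrow> complex" where
  "imin x m d = det (mat d d (\<lambda>(i, j). x $$ (m + i, j)))"

definition imin' :: "complex mat \<Rightarrow> nat \<Rightarrow> nat \<Rightarrow> complex" where
  "imin' x m d = det (mat d d (\<lambda>(i, j). x $$ (m + i, if j = d - 1 then d else j)))"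

lemma imin_0 [simp]: "imin x m 0 = 1"
  by (simp add: imin_def)

lemma pick_atLeastLessThan:
  assumes "i < n" shows "pick {m..<m + n} i = m + i"
proof -
  have "{a \<in> {m..<m + n}. a < m + i} = {m..<m + i}" using assms by auto
  thus ?thesis using pick_card_in_set[of "m + i" "{m..<m + n}"] assms by simp
qed

lemma minor_eq_imin:
  assumes x: "x \<in> carrier_mat (Suc r) (Suc r)" and md: "m + d \<le> Suc r"
  shows "minor {m + 1..m + d} {1..d} x = imin x m d"
proof -
  have im: "(\<lambda>j. j - 1) ` {k + 1..k + d} = {k..<k + d}" for k
  proof -
    have "{k + 1..k + d} = Suc ` {k..<k + d}" by (simp add: image_Suc_atLeastLessThan atLeastLessThanSuc_atLeastAtMost)
    hence "(\<lambda>j. j - 1) ` {k + 1..k + d} = (\<lambda>j. j - 1) ` Suc ` {k..<k + d}" by (simp only:)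
    also have "\<dots> = {k..<k + d}" by (simp only: image_image) simp
    finally show ?thesis .
  qed
  have "{i. i < Suc r \<and> i \<in> {k..<k + d}} = {k..<k + d}" if "k + d \<le> Suc r" for k using that by auto
  hence "card {i. i < Suc r \<and> i \<in> {k..<k + d}} = d" if "k + d \<le> Suc r" for k using that by simp
  note c = this[OF md] this[of 0]
  have "submatrix x {m..<m + d} {0..<0 + d} = mat d d (\<lambda>(i, j). x $$ (m + i, j))"
    unfolding submatrix_def using x md c
    by (intro eq_matI) (simp_all add: pick_atLeastLessThan pick_atLeastLessThan[of _ _ 0, simplified])
  thus ?thesis using im[of m] im[of 0] by (simp add: minor_def imin_def)
qed

text \<open>Right multiplication by y_j(a) adds a times column j + 1 to column j, counted from 1.
  For d < j the changed column is absent, for d > j both columns are present and the determinant is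
  invariant, and for d = j the minor is linear in its last column.\<close>

lemma imin_mult_y_gen:
  assumes x: "x \<in> carrier_mat (Suc r) (Suc r)" and j: "j \<in> {1..r}" and md: "m + d \<le> Suc r" and d: "d \<le> r"
  shows "imin (x * y_gen r j a) m d = imin x m d + (if j = d then a * imin' x m d else 0)"
proof -
  let ?z = "x * y_gen r j a"
  have z: "?z $$ (m + i, k) = x $$ (m + i, k) + (if k = j - 1 then a * x $$ (m + i, j) else 0)"
    if "i < d" "k < d" for i k
    using mult_elementary_index[OF x, of j "m + i" k a "j - 1"] that md j d by (simp add: y_gen_elementary)
  consider "d < j" | "j = d" | "j < d" by linarith
  thus ?thesis
  proof cases
    case 1
    have "mat d d (\<lambda>(i, k). ?z $$ (m + i, k)) = mat d d (\<lambda>(i, k). x $$ (m + i, k))"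
      by (rule eq_matI) (use 1 z in auto)
    thus ?thesis using 1 by (simp add: imin_def)
  next
    case 2
    then obtain e where e: "d = Suc e" using j by (cases d) auto
    show ?thesis
      using det_last_column[of e "\<lambda>(i, k). x $$ (m + i, k)" "\<lambda>(i, k). ?z $$ (m + i, k)"
          "\<lambda>(i, k). x $$ (m + i, if k = e then Suc e else k)" a] z 2 e
      by (simp add: imin_def imin'_def less_Suc_eq_le)
  next
    case 3
    have "mat d d (\<lambda>(i, k). ?z $$ (m + i, k)) = addcol a (j - 1) j (mat d d (\<lambda>(i, k). x $$ (m + i, k)))"
      by (rule eq_matI) (use 3 z in auto)
    thus ?thesis using 3 less_rank[OF j] by (simp add: imin_def det_addcol[of j d])
  qed
qed

text \<open>The lowest \<open>d\<close> rows of \<open>x = u \<cdot> w\<^sub>0 \<cdot> y\<^sup>T\<close> are a \<open>d \<times> d\<close> matrix times the first \<open>d\<close> rows of \<open>y\<^sup>T\<close>.\<close>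

lemma chi_imin:
  assumes xy: "twist_rel r x y" and d: "d \<in> {1..r}" and nz: "imin x (Suc r - d) d \<noteq> 0"
  shows "chi_cr r d y = imin' x (Suc r - d) d / imin x (Suc r - d) d"
proof -
  obtain u where y: "y \<in> lower_SL r" and u: "u \<in> N_plus r" and x: "x = u * w0_bar r * transpose_mat y"
    using xy by (auto simp: twist_rel_def)
  obtain e where e: "d = Suc e" using d by (cases d) auto
  define m where "m = Suc r - d"
  have me: "m + d = Suc r" "Suc e < Suc r" using d e by (auto simp: m_def)
  let ?v = "u * w0_bar r" and ?b = "transpose_mat y"
  have uc: "u \<in> carrier_mat (Suc r) (Suc r)" using u by simp
  have vS: "?v \<in> carrier (SL r)" using u by simp
  have vc: "?v \<in> carrier_mat (Suc r) (Suc r)" using vS by (rule SL_carrierD)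
  have yc: "y \<in> carrier_mat (Suc r) (Suc r)" using y by simp
  have bc: "?b \<in> carrier_mat (Suc r) (Suc r)" using y by simp
  have b: "?b $$ (i, j) = y $$ (j, i)" if "i < Suc r" "j < Suc r" for i j
    using that carrier_matD[OF yc] by simp
  have v0: "?v $$ (m + i, l) = 0" if "i < d" "d \<le> l" "l < Suc r" for i l
  proof -
    have "?v $$ (m + i, l) = w0_sign r l * u $$ (m + i, r - l)"
      using signed_perm_mult_right[OF w0_bar_signed_perm _ uc, of "m + i" l] that me by simp
    also have "u $$ (m + i, r - l) = 0"
      by (rule upper_SL_index[OF N_plus_subset_upper[OF u]]) (use that me in auto)
    finally show ?thesis by simp
  qed
  define W where "W = det (mat d d (\<lambda>(i, l). ?v $$ (m + i, l)))"
  define P where "P = det (mat e e (\<lambda>(i, l). ?b $$ (i, l)))"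
  \<comment> \<open>\<sigma> covers both column sets, the first d columns and those with the last
    one shifted by one. The two minors share the factors W and P, so their quotient is a quotient of
    two entries of y, namely \<chi>_d.\<close>
  have col: "det (mat d d (\<lambda>(i, j). x $$ (m + i, \<sigma> j))) = W * (?b $$ (e, \<sigma> e) * P)"
    if \<sigma>: "\<And>j. j < e \<Longrightarrow> \<sigma> j = j" "\<sigma> e < Suc r" for \<sigma>
  proof -
    have s: "\<sigma> j < Suc r" if "j < d" for j using that \<sigma> e me by (cases "j = e") auto
    have "mat d d (\<lambda>(i, j). x $$ (m + i, \<sigma> j))
        = mat d d (\<lambda>(i, l). ?v $$ (m + i, l)) * mat d d (\<lambda>(l, j). ?b $$ (l, \<sigma> j))"
      unfolding x by (rule mat_mult_block[OF vc bc]) (use me s v0 in auto)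
    hence "det (mat d d (\<lambda>(i, j). x $$ (m + i, \<sigma> j))) = W * det (mat d d (\<lambda>(l, j). ?b $$ (l, \<sigma> j)))"
      by (simp only: W_def) (rule det_mult, auto)
    also have "det (mat d d (\<lambda>(l, j). ?b $$ (l, \<sigma> j))) = ?b $$ (e, \<sigma> e) * det (mat e e (\<lambda>(l, j). ?b $$ (l, \<sigma> j)))"
      unfolding e using det_last_row_zero[of e "\<lambda>(l, j). ?b $$ (l, \<sigma> j)"] \<sigma> b lower_SL_index[OF y] me
      by simp
    also have "mat e e (\<lambda>(l, j). ?b $$ (l, \<sigma> j)) = mat e e (\<lambda>(i, l). ?b $$ (i, l))"
      by (rule eq_matI) (use \<sigma> in auto)
    finally show ?thesis by (simp add: P_def)
  qed
  have "imin x m d = W * (y $$ (e, e) * P)"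
    unfolding imin_def using col[of "\<lambda>j. j"] me b by simp
  moreover have "imin' x m d = W * (y $$ (Suc e, e) * P)"
    unfolding imin'_def e using col[of "\<lambda>j. if j = e then Suc e else j", unfolded e] me b by simp
  ultimately have "imin' x m d * y $$ (e, e) = imin x m d * y $$ (Suc e, e)" by simp
  thus ?thesis
    unfolding chi_cr_eq[OF y d] using nz lower_SL_diag_nonzero[OF y, of e] me
    by (simp add: m_def e divide_simps mult.commute)
qed

text \<open>Desnanot-Jacobi for the rows t + 1, ..., t + d + 1 and the columns 1, ..., d + 1, where
  the rows removed are the first and the last and the columns removed are the last two.\<close>

lemma imin_jacobi:
  assumes "imin x t (Suc d) \<noteq> 0" "d \<ge> 1"
  shows "imin' x (Suc t) d * imin x t d - imin' x t d * imin x (Suc t) d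
    = imin x t (Suc d) * imin x (Suc t) (d - 1)"
proof -
  obtain e where e: "d = Suc e" using assms by (cases d) auto
  show ?thesis
    using desnanot_jacobi[of e "\<lambda>i j. x $$ (t + i, j)"] assms by (simp add: e imin_def imin'_def)
qed

section \<open>Reconstruction of a matrix from its initial minors\<close>

lemma imin_recursion:
  assumes "\<And>i j. i \<le> q \<Longrightarrow> j \<le> q \<Longrightarrow> (i, j) \<noteq> (q, q) \<Longrightarrow> x $$ (m + i, j) = x' $$ (m + i, j)"
  shows "imin x m (Suc q) - imin x' m (Suc q) = (x $$ (m + q, q) - x' $$ (m + q, q)) * imin x m q"
  using det_last_entry[of q "\<lambda>(i, j). x $$ (m + i, j)" "\<lambda>(i, j). x' $$ (m + i, j)"] assms
  by (simp add: imin_def)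

text \<open>An entry (p,q) with q \<le> p, counted from 0, is the bottom right corner of the initial
  minor of size q + 1 starting in row p - q. All other entries of that minor come earlier when the
  matrix is read column by column, and the slope in the corner is a nonzero minor.\<close>

lemma lower_SL_imin_unique:
  assumes x: "x \<in> lower_SL r" "x' \<in> lower_SL r"
    and eq: "\<And>m d. m + d \<le> Suc r \<Longrightarrow> imin x m d = imin x' m d"
    and nz: "\<And>m d. m + d \<le> Suc r \<Longrightarrow> imin x m d \<noteq> 0"
  shows "x = x'"
proof -
  have "x $$ (p, q) = x' $$ (p, q)" if "p < Suc r" "q < Suc r" for p q
    using that
  proof (induction q arbitrary: p rule: less_induct)
    case (less q)
    note col = less.IH
    show ?case using less.prems
    proof (induction p rule: less_induct)
      case (less p)
      show ?case
      proof (cases "p < q")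
        case True
        thus ?thesis using lower_SL_index[OF x(1)] lower_SL_index[OF x(2)] less.prems by simp
      next
        case False
        define m where "m = p - q"
        have p: "p = m + q" using False by (simp add: m_def)
        have "imin x m (Suc q) - imin x' m (Suc q) = (x $$ (m + q, q) - x' $$ (m + q, q)) * imin x m q"
        proof (rule imin_recursion)
          fix i j assume ij: "i \<le> q" "j \<le> q" "(i, j) \<noteq> (q, q)"
          show "x $$ (m + i, j) = x' $$ (m + i, j)"
            using col[of j "m + i"] less.IH[of "m + i"] ij less.prems p by (cases "j < q") auto
        qed
        moreover have "imin x m (Suc q) = imin x' m (Suc q)" "imin x m q \<noteq> 0"
          using eq nz p less.prems by auto
        ultimately show ?thesis by (simp add: p)
      qed
    qed
  qed
  moreover have "dim_row x = Suc r" "dim_col x = Suc r" "dim_row x' = Suc r" "dim_col x' = Suc r"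
    using SL_carrierD[OF lower_SL_SL[OF x(1)]] SL_carrierD[OF lower_SL_SL[OF x(2)]] by auto
  ultimately show ?thesis by (intro eq_matI) auto
qed

text \<open>Supplies the bounds on i and j inside the determinant in \<open>fill\<close>, so that
  each recursive call is seen to go to an earlier column or to a higher row of the same
  column.\<close>

lemma mat_fundef_cong [fundef_cong]:
  assumes "nr = nr'" "nc = nc'" "\<And>i j. i < nr' \<Longrightarrow> j < nc' \<Longrightarrow> f (i, j) = f' (i, j)"
  shows "mat nr nc f = mat nr' nc' f'"
  using assms by (intro eq_matI) auto

text \<open>Column \<open>q\<close> and row \<open>p\<close> of the matrix whose initial minors are prescribed by \<open>a\<close>: the minor ending
  at this entry is affine in it, with slope the previous minor.\<close>

function fill :: "(nat \<Rightarrow> nat \<Rightarrow> complex) \<Rightarrow> nat \<Rightarrow> nat \<Rightarrow> complex" where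
  "fill a q p = (if p < q then 0
     else (a (p - q) (Suc q)
         - det (mat (Suc q) (Suc q) (\<lambda>(i, j). if i = q \<and> j = q then 0 else fill a j (p - q + i))))
       / a (p - q) q)"
  by pat_completeness auto
termination
  by (relation "inv_image (less_than <*lex*> less_than) (\<lambda>(a, q, p). (q, p))") auto

declare fill.simps [simp del]

lemma fill_imin:
  assumes nz: "\<And>m d. m + d \<le> Suc r \<Longrightarrow> a m d \<noteq> 0" and a0: "\<And>m. a m 0 = 1"
    and md: "m + d \<le> Suc r"
  shows "imin (mat (Suc r) (Suc r) (\<lambda>(p, q). fill a q p)) m d = a m d"
  using md
proof (induction d)
  case 0 show ?case by (simp add: a0)
next
  case (Suc q)
  let ?x = "mat (Suc r) (Suc r) (\<lambda>(p, q). fill a q p)"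
  \<comment> \<open>The same matrix with the corner of the minor set to 0: the affine dependence on
    the corner then becomes the defining equation of \<open>fill\<close>.\<close>
  let ?x' = "mat (Suc r) (Suc r) (\<lambda>(p, j). if p = m + q \<and> j = q then 0 else fill a j p)"
  have "imin ?x m (Suc q) - imin ?x' m (Suc q) = (?x $$ (m + q, q) - ?x' $$ (m + q, q)) * imin ?x m q"
    by (rule imin_recursion) (use Suc.prems in auto)
  also have "?x $$ (m + q, q) - ?x' $$ (m + q, q) = fill a q (m + q)" using Suc.prems by simp
  also have "imin ?x m q = a m q" using Suc by simp
  also have "fill a q (m + q) = (a m (Suc q) - imin ?x' m (Suc q)) / a m q"
  proof -
    have "mat (Suc q) (Suc q) (\<lambda>(i, j). if i = q \<and> j = q then 0 else fill a j (m + i))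
        = mat (Suc q) (Suc q) (\<lambda>(i, j). ?x' $$ (m + i, j))"
      by (rule eq_matI) (use Suc.prems in auto)
    thus ?thesis by (subst fill.simps) (simp only: add_diff_cancel_right' imin_def, simp)
  qed
  finally show ?case using nz[of m q] Suc.prems by simp
qed

lemma imin_full_det: "x \<in> carrier_mat (Suc r) (Suc r) \<Longrightarrow> imin x 0 (Suc r) = det x"
  unfolding imin_def by (rule arg_cong[of _ _ det]) auto

lemma lower_SL_imin_exists:
  assumes nz: "\<And>m d. m + d \<le> Suc r \<Longrightarrow> a m d \<noteq> 0" and a0: "\<And>m. a m 0 = 1"
    and a1: "a 0 (Suc r) = 1"
  shows "\<exists>x\<in>lower_SL r. \<forall>m d. m + d \<le> Suc r \<longrightarrow> imin x m d = a m d"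
proof -
  let ?x = "mat (Suc r) (Suc r) (\<lambda>(p, q). fill a q p)"
  have im: "imin ?x m d = a m d" if "m + d \<le> Suc r" for m d
    using fill_imin[of r a m d] nz a0 that by blast
  have "det ?x = 1" using im[of 0 "Suc r"] a1 imin_full_det[of ?x r] by simp
  hence "?x \<in> lower_SL r" by (intro lower_SLI) (auto simp: SL_carrier_iff fill.simps)
  thus ?thesis using im by blast
qed

text \<open>Row \<open>r + 1 - i\<close> of \<open>u\<close> is chosen so that the first \<open>i\<close> entries of this row of \<open>u x\<close> vanish; this is a
  linear system whose determinant is a corner minor of \<open>x\<close>.\<close>

lemma lower_SL_double_cell:
  assumes x: "x \<in> lower_SL r" and nz: "\<And>d. d \<in> {1..r} \<Longrightarrow> imin x (Suc r - d) d \<noteq> 0"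
  shows "x \<in> double_cell r"
proof -
  have xc: "x \<in> carrier_mat (Suc r) (Suc r)" using x by simp
  have "\<exists>c. \<forall>j<i. (\<Sum>l<i. c l * x $$ (Suc r - i + l, j)) = - x $$ (r - i, j)" if "i \<le> r" for i
  proof -
    have "imin x (Suc r - i) i \<noteq> 0" using nz[of i] that by (cases "i = 0") auto
    thus ?thesis using det_solve_row[of i "\<lambda>l j. x $$ (Suc r - i + l, j)"] by (simp add: imin_def)
  qed
  then obtain c where c: "\<And>i j. i \<le> r \<Longrightarrow> j < i \<Longrightarrow>
      (\<Sum>l<i. c i l * x $$ (Suc r - i + l, j)) = - x $$ (r - i, j)" by metis
  define u where "u = mat (Suc r) (Suc r) (\<lambda>(k, p). if p < k then 0 else if p = k then 1
    else c (r - k) (p - Suc k))"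
  have uc: "u \<in> carrier_mat (Suc r) (Suc r)" and ut: "upper_triangular u" and ud: "\<And>i. i < Suc r \<Longrightarrow> u $$ (i, i) = 1"
    by (auto simp: u_def intro!: upper_triangularI)
  have "diag_mat u = replicate (Suc r) 1" by (rule nth_equalityI) (auto simp: diag_mat_def u_def simp del: upt_Suc replicate_Suc)
  hence "det u = 1" using det_upper_triangular[OF ut uc] by simp
  hence u: "u \<in> N_plus r" using uc ut ud by (simp add: N_plus_def SL_carrier_iff)
  have ux: "(u * x) $$ (k, j) = 0" if kj: "k < Suc r" "j < r - k" for k j
  proof -
    have j: "j < Suc r" using kj by simp
    have "(u * x) $$ (k, j) = (\<Sum>p<Suc r. u $$ (k, p) * x $$ (p, j))" by (rule mult_index[OF uc xc kj(1) j])
    also have "\<dots> = (\<Sum>p\<in>{k..<Suc r}. u $$ (k, p) * x $$ (p, j))"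
      by (rule sum.mono_neutral_right) (use kj in \<open>auto simp: u_def\<close>)
    also have "\<dots> = x $$ (k, j) + (\<Sum>p\<in>{Suc k..<Suc r}. u $$ (k, p) * x $$ (p, j))"
      using kj by (subst sum.atLeast_Suc_lessThan) (auto simp: u_def)
    also have "(\<Sum>p\<in>{Suc k..<Suc r}. u $$ (k, p) * x $$ (p, j))
        = (\<Sum>l<r - k. c (r - k) l * x $$ (Suc r - (r - k) + l, j))"
      by (rule sum.reindex_bij_witness[of _ "\<lambda>l. Suc k + l" "\<lambda>p. p - Suc k"]) (use kj in \<open>auto simp: u_def\<close>)
    also have "\<dots> = - x $$ (k, j)" using c[of "r - k" j] kj by simp
    finally show ?thesis by simp
  qed
  let ?w = "w0_bar r"
  let ?b = "inv\<^bsub>SL r\<^esub> ?w * (u * x)"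
  have S: "u \<in> carrier (SL r)" "x \<in> carrier (SL r)" using u x by simp_all
  have uxc: "u * x \<in> carrier_mat (Suc r) (Suc r)" using S by (intro SL_carrierD SL_mult)
  \<comment> \<open>\<open>u * x\<close> vanishes strictly above the antidiagonal, and the inverse
    of w_0 reverses the rows up to sign.\<close>
  have b: "?b \<in> upper_SL r"
  proof (rule upper_SLI)
    fix i j assume ij: "j < i" "i < Suc r"
    have "?b $$ (i, j) = w0_sign r i * (u * x) $$ (r - i, j)"
      unfolding w0_bar_inv using signed_perm_transpose_mult_left[OF w0_bar_signed_perm _ uxc, of i j] ij by simp
    thus "?b $$ (i, j) = 0" using ux[of "r - i" j] ij by simp
  qed (use S in simp)
  have "x = inv\<^bsub>SL r\<^esub> u * ?w * ?b" using S by (simp add: SL_assoc[of _ r] SL_cancel[of _ r])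
  thus ?thesis by (rule double_cellI[OF x _ b, rotated]) (use u N_plus_subset_upper in auto)
qed

section \<open>Indices of the cluster torus\<close>

text \<open>The number of letters before the m-th cycle, so that the pair (m,d) sits at position
  \<open>cycle_offset r m + d\<close>.\<close>

definition cycle_offset :: "nat \<Rightarrow> nat \<Rightarrow> nat" where
  "cycle_offset r m = (\<Sum>p = 1..<m. Suc r - p)"

lemma cycle_offset_Suc: "1 \<le> m \<Longrightarrow> cycle_offset r (Suc m) = cycle_offset r m + (Suc r - m)"
  by (simp add: cycle_offset_def)

lemma cycle_offset_mono: "m \<le> m' \<Longrightarrow> cycle_offset r m \<le> cycle_offset r m'"
  unfolding cycle_offset_def by (rule sum_mono2) auto

lemma length_cycles:
  "length (concat (map (\<lambda>p. [1..<r + 2 - p]) [1..<m])) = cycle_offset r m"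
proof (cases "m = 0")
  case False
  have "length (concat (map (\<lambda>p. [1..<r + 2 - p]) [1..<m])) = (\<Sum>p\<leftarrow>[1..<m]. Suc r - p)"
    by (simp add: length_concat comp_def del: upt_Suc)
  also have "\<dots> = cycle_offset r m"
    by (simp add: cycle_offset_def interv_sum_list_conv_sum_set_nat)
  finally show ?thesis .
qed (simp add: cycle_offset_def)

lemma n_len_Suc: "n_len (Suc k) = Suc k + n_len k"
proof -
  have "Suc k * (Suc k + 1) = 2 * Suc k + k * (k + 1)" by simp
  thus ?thesis unfolding n_len_def by simp
qed

lemma n_len_eq: "n_len r = cycle_offset r (Suc r)"
proof -
  have "length (w0_word k) = n_len k" for k
    by (induction k) (simp add: w0_word_def n_len_def, simp add: w0_word_Suc n_len_Suc del: upt_Suc)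
  thus ?thesis using length_cycles[of r "Suc r"] by (simp add: w0_word_def del: upt_Suc)
qed

definition valid_pair :: "nat \<Rightarrow> nat \<Rightarrow> nat \<Rightarrow> bool" where
  "valid_pair r m d \<longleftrightarrow> 1 \<le> m \<and> 1 \<le> d \<and> m + d \<le> Suc r"

lemma letter_cycle_offset:
  assumes "valid_pair r m d"
  shows "letter r (int (cycle_offset r m + d)) = int d"
proof -
  have md: "1 \<le> m" "1 \<le> d" "m + d \<le> Suc r" using assms by (auto simp: valid_pair_def)
  have "[1..<m + (Suc r - m)] = [1..<m] @ [m..<m + (Suc r - m)]"
    by (rule upt_add_eq_append) (use md in simp)
  also have "[m..<m + (Suc r - m)] = m # [Suc m..<m + (Suc r - m)]"
    by (rule upt_conv_Cons) (use md in simp)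
  also have "m + (Suc r - m) = r + 1" using md by simp
  finally have "[1..<r + 1] = [1..<m] @ m # [Suc m..<r + 1]" .
  hence w: "w0_word r = concat (map (\<lambda>p. [1..<r + 2 - p]) [1..<m]) @ [1..<r + 2 - m]
      @ concat (map (\<lambda>p. [1..<r + 2 - p]) [Suc m..<r + 1])"
    unfolding w0_word_def by (simp del: upt_Suc)
  have l: "d - 1 < length [1..<r + 2 - m]" using md by simp
  have "w0_word r ! (cycle_offset r m + (d - 1)) = ([1..<r + 2 - m]
      @ concat (map (\<lambda>p. [1..<r + 2 - p]) [Suc m..<r + 1])) ! (d - 1)"
    unfolding w length_cycles[symmetric] nth_append_length_plus ..
  also have "\<dots> = [1..<r + 2 - m] ! (d - 1)" using l by (simp only: nth_append if_True)
  also have "\<dots> = d" using md by (subst nth_upt) auto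
  finally have "w0_word r ! (cycle_offset r m + (d - 1)) = d" .
  moreover have "nat (int (cycle_offset r m + d) - 1) = cycle_offset r m + (d - 1)" using md by simp
  ultimately show ?thesis by (simp add: letter_def)
qed

lemma cycle_offset_less:
  assumes "valid_pair r m d" "valid_pair r m' d'"
  shows "cycle_offset r m + d < cycle_offset r m' + d' \<longleftrightarrow> m < m' \<or> (m = m' \<and> d < d')"
proof -
  have lt: "cycle_offset r m + d < cycle_offset r m' + d'"
    if "valid_pair r m d" "valid_pair r m' d'" "m < m'" for m d m' d'
    using cycle_offset_Suc[of m r] cycle_offset_mono[of "Suc m" m' r] that by (auto simp: valid_pair_def)
  show ?thesis
    using lt[OF assms] lt[OF assms(2,1)] by (cases m m' rule: linorder_cases) auto
qed

lemma cycle_offset_bounds: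
  assumes "valid_pair r m d"
  shows "1 \<le> cycle_offset r m + d" "cycle_offset r m + d \<le> n_len r"
  using assms cycle_offset_Suc[of m r] cycle_offset_mono[of "Suc m" "Suc r" r]
  by (auto simp: valid_pair_def n_len_eq)

lemma cycle_offset_surj:
  assumes "1 \<le> k" "k \<le> n_len r"
  shows "\<exists>m d. valid_pair r m d \<and> k = cycle_offset r m + d"
proof -
  have "\<exists>m d. valid_pair r m d \<and> k = cycle_offset r m + d" if "M \<le> r" "k \<le> cycle_offset r (Suc M)" for M
    using that
  proof (induction M)
    case 0
    thus ?case using assms by (simp add: cycle_offset_def)
  next
    case (Suc M)
    show ?case
    proof (cases "k \<le> cycle_offset r (Suc M)")
      case True thus ?thesis using Suc by simp
    next
      case False
      thus ?thesis using Suc.prems cycle_offset_Suc[of "Suc M" r]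
        by (intro exI[of _ "Suc M"] exI[of _ "k - cycle_offset r (Suc M)"]) (auto simp: valid_pair_def)
    qed
  qed
  thus ?thesis using assms(2) n_len_eq by auto
qed

lemma pos_eq:
  assumes v: "valid_pair r m d"
  shows "pos r m d = int (cycle_offset r m + d)"
proof -
  have card: "card {l \<in> {1..int (cycle_offset r p + d)}. letter r l = int d} = p" if p: "valid_pair r p d" for p
  proof -
    \<comment> \<open>Each of the cycles 1, ..., p contains the letter d exactly once, at its d-th
      place; counting occurrences therefore counts cycles.\<close>
    have "{l \<in> {1..int (cycle_offset r p + d)}. letter r l = int d}
        = (\<lambda>q. int (cycle_offset r q + d)) ` {1..p}" (is "?L = ?R")
    proof (intro Set.equalityI subsetI)
      fix l assume l: "l \<in> ?L"
      hence "1 \<le> nat l" "nat l \<le> n_len r" using cycle_offset_bounds[OF p] by auto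
      then obtain q e where q: "valid_pair r q e" "nat l = cycle_offset r q + e"
        using cycle_offset_surj by blast
      hence lq: "l = int (cycle_offset r q + e)" using l by auto
      hence e: "e = d" using letter_cycle_offset[OF q(1)] l by simp
      have "q \<le> p" using cycle_offset_less[OF p, of q d] q(1) lq l e by force
      thus "l \<in> ?R" using q(1) lq e by (auto simp: valid_pair_def)
    next
      fix l assume "l \<in> ?R"
      then obtain q where q: "q \<in> {1..p}" "l = int (cycle_offset r q + d)" by blast
      have vq: "valid_pair r q d" using q p by (auto simp: valid_pair_def)
      have "cycle_offset r q \<le> cycle_offset r p" using q by (intro cycle_offset_mono) auto
      thus "l \<in> ?L" using letter_cycle_offset[OF vq] cycle_offset_bounds[OF vq] q by auto
    qed
    moreover have "inj_on (\<lambda>q. int (cycle_offset r q + d)) {1..p}"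
    proof (rule inj_onI)
      fix q q' assume q: "q \<in> {1..p}" "q' \<in> {1..p}" "int (cycle_offset r q + d) = int (cycle_offset r q' + d)"
      have "valid_pair r q d" "valid_pair r q' d" using q p by (auto simp: valid_pair_def)
      thus "q = q'" using cycle_offset_less[of r q d q' d] cycle_offset_less[of r q' d q d] q(3) by auto
    qed
    ultimately show ?thesis by (simp add: card_image)
  qed
  show ?thesis
    unfolding pos_def
  proof (rule the_equality)
    show "int (cycle_offset r m + d) \<in> {1..int (n_len r)} \<and> letter r (int (cycle_offset r m + d)) = int d
        \<and> card {l \<in> {1..int (cycle_offset r m + d)}. letter r l = int d} = m"
      using cycle_offset_bounds[OF v] letter_cycle_offset[OF v] card[OF v] by auto
  next
    fix k assume k: "k \<in> {1..int (n_len r)} \<and> letter r k = int d \<and> card {l \<in> {1..k}. letter r l = int d} = m"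
    then obtain q e where q: "valid_pair r q e" "nat k = cycle_offset r q + e"
      using cycle_offset_surj[of "nat k" r] by (auto simp: nat_le_iff le_nat_iff)
    hence kq: "k = int (cycle_offset r q + e)" using k by auto
    hence "e = d" using letter_cycle_offset[OF q(1)] k by simp
    moreover from this have "q = m" using card[of q] q(1) k kq by simp
    ultimately show "k = int (cycle_offset r m + d)" using kq by simp
  qed
qed

text \<open>The frozen indices \<open>-d\<close> become the pairs \<open>(0,d)\<close>.\<close>

definition cpos :: "nat \<Rightarrow> nat \<Rightarrow> nat \<Rightarrow> int" where
  "cpos r m d = (if m = 0 then - int d else pos r m d)"

text \<open>The bound d \<le> r excludes the pair (0, r+1), which would stand for the full
  determinant.\<close>

definition index_pairs :: "nat \<Rightarrow> (nat \<times> nat) set" where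
  "index_pairs r = {(m, d). 1 \<le> d \<and> m + d \<le> Suc r \<and> d \<le> r}"

lemma index_pairs_cases:
  "(m, d) \<in> index_pairs r \<longleftrightarrow> (m = 0 \<and> 1 \<le> d \<and> d \<le> r) \<or> valid_pair r m d"
  by (auto simp: index_pairs_def valid_pair_def)

lemma finite_index_pairs: "finite (index_pairs r)"
  by (rule finite_subset[of _ "{..Suc r} \<times> {..r}"]) (auto simp: index_pairs_def)

text \<open>Indices are ordered lexicographically as soon as one of the pairs is positive. Between
  two pairs with m = 0 the order is reversed, because they stand for -d and -e; hence the asymmetric
  hypotheses.\<close>

lemma cpos_less:
  assumes "(m, e) \<in> index_pairs r" "valid_pair r t d"
  shows "cpos r m e < cpos r t d \<longleftrightarrow> m < t \<or> (m = t \<and> e < d)"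
    "cpos r t d < cpos r m e \<longleftrightarrow> t < m \<or> (t = m \<and> d < e)"
proof -
  have t: "t \<noteq> 0" using assms(2) by (auto simp: valid_pair_def)
  have p: "cpos r t d = int (cycle_offset r t + d)" using t by (simp add: cpos_def pos_eq[OF assms(2)])
  consider "m = 0" | "valid_pair r m e" using assms(1) unfolding index_pairs_cases by blast
  hence "(cpos r m e < cpos r t d \<longleftrightarrow> m < t \<or> (m = t \<and> e < d))
      \<and> (cpos r t d < cpos r m e \<longleftrightarrow> t < m \<or> (t = m \<and> d < e))"
  proof cases
    case 1
    thus ?thesis using t assms cycle_offset_bounds[OF assms(2)] unfolding p
      by (auto simp: cpos_def valid_pair_def)
  next
    case 2
    hence "cpos r m e = int (cycle_offset r m + e)"
      using pos_eq[OF 2] by (auto simp: cpos_def valid_pair_def)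
    thus ?thesis unfolding p using cycle_offset_less[OF 2 assms(2)] cycle_offset_less[OF assms(2) 2] by auto
  qed
  thus "cpos r m e < cpos r t d \<longleftrightarrow> m < t \<or> (m = t \<and> e < d)"
    "cpos r t d < cpos r m e \<longleftrightarrow> t < m \<or> (t = m \<and> d < e)" by auto
qed

lemma cpos_valid:
  assumes "valid_pair r m d"
  shows "1 \<le> cpos r m d" "cpos r m d \<le> int (n_len r)" "letter r (cpos r m d) = int d"
  using assms cycle_offset_bounds[OF assms] letter_cycle_offset[OF assms]
  by (auto simp: cpos_def pos_eq[OF assms] valid_pair_def)

lemma abs_letter_cpos: "(m, d) \<in> index_pairs r \<Longrightarrow> \<bar>letter r (cpos r m d)\<bar> = int d"
  using cpos_valid(3)[of r m d] unfolding index_pairs_cases by (auto simp: cpos_def letter_def)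

text \<open>The letter recovers d, and the order of the occurrences recovers m. This lets products
  and functions on the index set be written in terms of pairs.\<close>

lemma cpos_bij: "bij_betw (\<lambda>(m, d). cpos r m d) (index_pairs r) (index_set r)"
proof (rule bij_betw_imageI)
  show "inj_on (\<lambda>(m, d). cpos r m d) (index_pairs r)"
  proof (rule inj_onI, clarify)
    fix m d m' d' assume *: "(m, d) \<in> index_pairs r" "(m', d') \<in> index_pairs r" "cpos r m d = cpos r m' d'"
    hence d: "d = d'" using abs_letter_cpos[of m d r] abs_letter_cpos[of m' d' r] by simp
    show "m = m' \<and> d = d'"
    proof (cases "m = 0 \<and> m' = 0")
      case False
      hence "valid_pair r m d \<or> valid_pair r m' d'" using *(1,2) unfolding index_pairs_cases by blast
      thus ?thesis using cpos_less[OF *(1), of m' d'] cpos_less[OF *(2), of m d] *(3) d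
        by (cases m m' rule: linorder_cases) auto
    qed (use d in auto)
  qed
  show "(\<lambda>(m, d). cpos r m d) ` index_pairs r = index_set r"
  proof (intro Set.equalityI subsetI)
    fix k assume "k \<in> (\<lambda>(m, d). cpos r m d) ` index_pairs r"
    then obtain m d where md: "(m, d) \<in> index_pairs r" and k: "k = cpos r m d" by auto
    from md consider "m = 0" "1 \<le> d" "d \<le> r" | "valid_pair r m d" unfolding index_pairs_cases by blast
    thus "k \<in> index_set r"
    proof cases
      case 1 thus ?thesis by (simp add: k cpos_def index_set_def)
    next
      case 2 thus ?thesis using cpos_valid(1,2)[OF 2] by (simp add: k index_set_def)
    qed
  next
    fix k assume k: "k \<in> index_set r"
    show "k \<in> (\<lambda>(m, d). cpos r m d) ` index_pairs r"
    proof (cases "k < 0")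
      case True
      thus ?thesis using k by (intro image_eqI[of _ _ "(0, nat (- k))"]) (auto simp: index_set_def index_pairs_def cpos_def)
    next
      case False
      then obtain m d where md: "valid_pair r m d" "nat k = cycle_offset r m + d"
        using cycle_offset_surj[of "nat k" r] k by (auto simp: index_set_def nat_le_iff le_nat_iff)
      have "k = cpos r m d"
        using False k md pos_eq[OF md(1)] by (auto simp: cpos_def valid_pair_def index_set_def)
      moreover have "(m, d) \<in> index_pairs r" using md(1) by (simp add: index_pairs_cases)
      ultimately show ?thesis by (intro image_eqI[of _ _ "(m, d)"]) auto
    qed
  qed
qed

lemma cpos_index_set: "(m, d) \<in> index_pairs r \<Longrightarrow> cpos r m d \<in> index_set r"
  using bij_betwE[OF cpos_bij] by fast

lemma index_set_cposE:
  assumes "l \<in> index_set r"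
  obtains p e where "(p, e) \<in> index_pairs r" "l = cpos r p e"
proof -
  have "l \<in> (\<lambda>(m, d). cpos r m d) ` index_pairs r" using assms cpos_bij[of r] by (simp add: bij_betw_def)
  thus ?thesis using that by auto
qed

text \<open>The letter d occurs once in each cycle up to cycle r + 1 - d, so the successor of (m,d)
  is (m+1,d) while that cycle still contains d; the index -d behaves like an occurrence in a cycle
  0.\<close>

lemma next_index_cpos:
  assumes md: "(m, d) \<in> index_pairs r"
  shows "next_index r (cpos r m d) = (if m + d \<le> r then cpos r (Suc m) d else int (n_len r) + 1)"
proof -
  let ?k = "cpos r m d"
  let ?S = "{l \<in> index_set r. l > ?k \<and> \<bar>letter r l\<bar> = \<bar>letter r ?k\<bar>} \<union> {int (n_len r) + 1}"
  have later: "Suc m \<le> p \<and> valid_pair r p d \<and> l = cpos r p d"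
    if "l \<in> index_set r" "l > ?k" "\<bar>letter r l\<bar> = \<bar>letter r ?k\<bar>" "(p, e) \<in> index_pairs r" "l = cpos r p e" for l p e
  proof -
    have e: "e = d" using that abs_letter_cpos[OF md] abs_letter_cpos[OF that(4)] by simp
    have "valid_pair r p d"
    proof (rule ccontr)
      assume "\<not> valid_pair r p d"
      hence p: "p = 0" using that(4) e unfolding index_pairs_cases by blast
      show False
      proof (cases "m = 0")
        case True thus False using p e that by simp
      next
        case False
        hence "valid_pair r m d" using md unfolding index_pairs_cases by blast
        thus False using cpos_less(2)[OF that(4), of m d] that p e by simp
      qed
    qed
    thus ?thesis using cpos_less(2)[OF md, of p d] cpos_less(1)[OF md, of p d] that e by auto
  qed
  have fin: "finite ?S" using finite_index_set by simp
  show ?thesis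
  proof (cases "m + d \<le> r")
    case True
    have v: "valid_pair r (Suc m) d" using True md by (auto simp: valid_pair_def index_pairs_def)
    have "Min ?S = cpos r (Suc m) d"
    proof (rule Min_eqI[OF fin])
      show "cpos r (Suc m) d \<in> ?S"
        using cpos_valid[OF v] abs_letter_cpos[OF md] cpos_less(1)[OF md v] by (auto simp: index_set_def)
    next
      fix l assume "l \<in> ?S"
      moreover have "cpos r (Suc m) d \<le> l" if l: "l \<in> index_set r" "l > ?k" "\<bar>letter r l\<bar> = \<bar>letter r ?k\<bar>"
      proof -
        obtain p e where pe: "(p, e) \<in> index_pairs r" "l = cpos r p e"
          using l(1) by (rule index_set_cposE)
        note L = later[OF l pe]
        hence "(p, d) \<in> index_pairs r" by (simp add: index_pairs_cases)
        thus ?thesis using cpos_less(1)[of p d r "Suc m" d] v L by auto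
      qed
      ultimately show "cpos r (Suc m) d \<le> l" using cpos_valid(2)[OF v] by auto
    qed
    thus ?thesis using True by (simp add: next_index_def)
  next
    case False
    have "?S = {int (n_len r) + 1}"
    proof -
      have "False" if l: "l \<in> index_set r" "l > ?k" "\<bar>letter r l\<bar> = \<bar>letter r ?k\<bar>" for l
      proof -
        obtain p e where pe: "(p, e) \<in> index_pairs r" "l = cpos r p e"
          using l(1) by (rule index_set_cposE)
        show False using later[OF l pe] False by (auto simp: valid_pair_def)
      qed
      thus ?thesis by blast
    qed
    hence "Min ?S = int (n_len r) + 1" by (simp only: Min_singleton)
    thus ?thesis using False by (simp add: next_index_def)
  qed
qed

text \<open>The brackets in the row j = (t+1,d) and the column k = (m,e), with every comparison of
  indices replaced by the lexicographic one. Equality of indices is written as the failure of both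
  strict comparisons, and m + e > r expresses that the successor of k lies beyond all positions.
  Comparing m with t and e with d then decides everything.\<close>

lemma bracket_value:
  assumes "Suc t + d \<le> r" "1 \<le> d" "1 \<le> e" "m + e \<le> Suc r" "e \<le> r"
  shows "(if e = d then 2 else if Suc e = d \<or> e = Suc d then - 1 else 0) / 2 *
      (- of_bool (\<not> (m + e > r \<or> t < m \<or> (m = t \<and> d < e)) \<and> \<not> (m + e \<le> r \<and> (m < t \<or> (m = t \<and> e < d))))
       + of_bool (\<not> (Suc (Suc t) < m \<or> (m = Suc (Suc t) \<and> d < e)) \<and> \<not> (m < Suc (Suc t) \<or> (m = Suc (Suc t) \<and> e < d)))
       - of_bool ((m < Suc t \<or> (m = Suc t \<and> e < d)) \<and> (m + e > r \<or> t < m \<or> (m = t \<and> d < e)))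
       + of_bool ((m < Suc (Suc t) \<or> (m = Suc (Suc t) \<and> e < d)) \<and> (m + e > r \<or> Suc t < m \<or> (m = Suc t \<and> d < e)))
       + of_bool ((Suc t < m \<or> (m = Suc t \<and> d < e)) \<and> (m < Suc (Suc t) \<or> (m = Suc (Suc t) \<and> e < d)))
         * of_bool (m \<noteq> 0)
       - of_bool ((m + e > r \<or> t < m \<or> (m = t \<and> d < e)) \<and> (m + e \<le> r \<and> (m < Suc t \<or> (m = Suc t \<and> e < d))))
         * of_bool (m + e \<le> r))
    = (of_bool (e = d \<and> m = Suc (Suc t)) - of_bool (e = d \<and> m = t)
      + of_bool (Suc e = d \<and> m = Suc t) - of_bool (Suc e = d \<and> m = Suc (Suc t))
      + of_bool (e = Suc d \<and> m = t) - of_bool (e = Suc d \<and> m = Suc t) :: rat)"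
proof -
  consider "m < t" | "m = t" | "m = Suc t" | "m = Suc (Suc t)" | "m > Suc (Suc t)" by linarith
  thus ?thesis
  proof cases
    case 1
    consider "e = d" | "Suc e = d" | "e = Suc d" | "e \<noteq> d" "Suc e \<noteq> d" "e \<noteq> Suc d" by blast
    thus ?thesis by cases (insert 1 assms, auto)
  next
    case 2
    consider "e = d" | "Suc e = d" | "e = Suc d" | "e \<noteq> d" "Suc e \<noteq> d" "e \<noteq> Suc d" by blast
    thus ?thesis by cases (insert 2 assms, auto)
  next
    case 3
    consider "e = d" | "Suc e = d" | "e = Suc d" | "e \<noteq> d" "Suc e \<noteq> d" "e \<noteq> Suc d" by blast
    thus ?thesis by cases (insert 3 assms, auto)
  next
    case 4
    consider "e = d" | "Suc e = d" | "e = Suc d" | "e \<noteq> d" "Suc e \<noteq> d" "e \<noteq> Suc d" by blast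
    thus ?thesis by cases (insert 4 assms, auto)
  next
    case 5
    consider "e = d" | "Suc e = d" | "e = Suc d" | "e \<noteq> d" "Suc e \<noteq> d" "e \<noteq> Suc d" by blast
    thus ?thesis by cases (insert 5 assms, auto)
  qed
qed

text \<open>The row belongs to an index j > 0 whose successor is at most n, so M contributes nothing
  to it. The remaining entries of B are the six neighbours of j, and these are the rows that occur
  in the products over t \<le> r - d.\<close>

lemma Btilde_pair:
  assumes td: "valid_pair r (Suc t) d" "Suc t + d \<le> r" and me: "(m, e) \<in> index_pairs r"
  shows "Btilde r (cpos r (Suc t) d) (cpos r m e)
    = of_bool (e = d \<and> m = Suc (Suc t)) - of_bool (e = d \<and> m = t)
      + of_bool (Suc e = d \<and> m = Suc t) - of_bool (Suc e = d \<and> m = Suc (Suc t))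
      + of_bool (e = Suc d \<and> m = t) - of_bool (e = Suc d \<and> m = Suc t)" (is "_ = ?b")
proof -
  let ?n = "int (n_len r)"
  define j where "j = cpos r (Suc t) d"
  define k where "k = cpos r m e"
  define j' where "j' = cpos r (Suc (Suc t)) d"
  define k' where "k' = next_index r k"
  have d1: "d \<ge> 1" using td by (auto simp: valid_pair_def)
  have td': "(Suc t, d) \<in> index_pairs r" using td by (simp add: index_pairs_cases)
  have v2: "valid_pair r (Suc (Suc t)) d" using td d1 by (auto simp: valid_pair_def)
  have nj: "next_index r j = j'" using next_index_cpos[OF td'] td by (simp add: j_def j'_def)
  have j0: "0 < j" "0 < j'" "j' \<le> ?n" using cpos_valid[OF td(1)] cpos_valid[OF v2] by (auto simp: j_def j'_def)
  have kin: "k \<in> index_set r" "j \<in> index_set r"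
    using cpos_index_set me td' by (auto simp: k_def j_def)
  have k0: "0 < k \<longleftrightarrow> m \<noteq> 0"
    using me cpos_valid(1)[of r m e] unfolding k_def index_pairs_cases by (auto simp: cpos_def valid_pair_def)
  have cmp: "k < j \<longleftrightarrow> m < Suc t \<or> (m = Suc t \<and> e < d)" "j < k \<longleftrightarrow> Suc t < m \<or> (m = Suc t \<and> d < e)"
    "k < j' \<longleftrightarrow> m < Suc (Suc t) \<or> (m = Suc (Suc t) \<and> e < d)"
    "j' < k \<longleftrightarrow> Suc (Suc t) < m \<or> (m = Suc (Suc t) \<and> d < e)"
    using cpos_less[OF me td(1)] cpos_less[OF me v2] by (auto simp: j_def k_def j'_def)
  have k': "k' = (if m + e \<le> r then cpos r (Suc m) e else ?n + 1)"
    using next_index_cpos[OF me] by (simp add: k'_def k_def)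
  have k'n: "k' \<le> ?n \<longleftrightarrow> m + e \<le> r"
  proof (cases "m + e \<le> r")
    case True
    hence "valid_pair r (Suc m) e" using me by (auto simp: valid_pair_def index_pairs_def)
    thus ?thesis using k' True cpos_valid(2) by simp
  qed (use k' in simp)
  have cmp': "k' < j \<longleftrightarrow> m + e \<le> r \<and> (m < t \<or> (m = t \<and> e < d))"
    "k' < j' \<longleftrightarrow> m + e \<le> r \<and> (m < Suc t \<or> (m = Suc t \<and> e < d))"
    "j < k' \<longleftrightarrow> m + e > r \<or> t < m \<or> (m = t \<and> d < e)"
    "j' < k' \<longleftrightarrow> m + e > r \<or> Suc t < m \<or> (m = Suc t \<and> d < e)"
  proof -
    have "(k' < j \<longleftrightarrow> m + e \<le> r \<and> (m < t \<or> (m = t \<and> e < d)))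
      \<and> (k' < j' \<longleftrightarrow> m + e \<le> r \<and> (m < Suc t \<or> (m = Suc t \<and> e < d)))
      \<and> (j < k' \<longleftrightarrow> m + e > r \<or> t < m \<or> (m = t \<and> d < e))
      \<and> (j' < k' \<longleftrightarrow> m + e > r \<or> Suc t < m \<or> (m = Suc t \<and> d < e))"
    proof (cases "m + e \<le> r")
      case True
      hence "(Suc m, e) \<in> index_pairs r" using me by (auto simp: index_pairs_def)
      thus ?thesis using cpos_less[of "Suc m" e r "Suc t" d] cpos_less[of "Suc m" e r "Suc (Suc t)" d]
          td(1) v2 True k' by (auto simp: j_def j'_def)
    next
      case False
      thus ?thesis using k' cpos_valid(2)[OF td(1)] cpos_valid(2)[OF v2] by (auto simp: j_def j'_def)
    qed
    thus "k' < j \<longleftrightarrow> m + e \<le> r \<and> (m < t \<or> (m = t \<and> e < d))"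
      "k' < j' \<longleftrightarrow> m + e \<le> r \<and> (m < Suc t \<or> (m = Suc t \<and> e < d))"
      "j < k' \<longleftrightarrow> m + e > r \<or> t < m \<or> (m = t \<and> d < e)"
      "j' < k' \<longleftrightarrow> m + e > r \<or> Suc t < m \<or> (m = Suc t \<and> d < e)" by blast+
  qed
  have eq: "j = k' \<longleftrightarrow> \<not> j < k' \<and> \<not> k' < j" "j' = k \<longleftrightarrow> \<not> j' < k \<and> \<not> k < j'" by auto
  have M0: "M_entry r j k = 0" using nj j0 by (simp add: M_entry_def)
  have "b_entry r j k = of_int ?b"
  proof -
    have c: "cartan \<bar>letter r k\<bar> \<bar>letter r j\<bar> = (if e = d then 2 else if Suc e = d \<or> e = Suc d then - 1 else 0)"
      using abs_letter_cpos[OF me] abs_letter_cpos[OF td'] by (auto simp: cartan_def j_def k_def)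
    have b: "b_entry r j k = cartan \<bar>letter r k\<bar> \<bar>letter r j\<bar> / 2 *
      (- of_bool (j = k') + of_bool (j' = k)
       - of_bool (k < j \<and> j < k')
       + of_bool (k < j' \<and> j' < k')
       + of_bool (j < k \<and> k < j') * of_bool (k > 0)
       - of_bool (j < k' \<and> k' < j') * of_bool (k' \<le> ?n))"
      using nj j0 by (simp add: b_entry_def k'_def)
    have "1 \<le> e" "m + e \<le> Suc r" "e \<le> r" using me by (auto simp: index_pairs_def)
    thus ?thesis
      unfolding b c eq cmp cmp' k0 k'n using bracket_value[OF td(2) d1] by simp
  qed
  hence "rat_of_int (Btilde r j k) = rat_of_int ?b" unfolding of_int_Btilde[OF kin(2,1)] M0 by (simp only: add_0_right)
  thus ?thesis unfolding j_def k_def by (simp only: of_int_eq_iff)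
qed

text \<open>The default 1 is the value of the initial minors that are not coordinates, the empty
  ones (d = 0) and the full determinant (0, r+1), so that formulas about neighbouring minors need no
  boundary cases.\<close>

definition coord :: "nat \<Rightarrow> (int \<Rightarrow> complex) \<Rightarrow> nat \<Rightarrow> nat \<Rightarrow> complex" where
  "coord r A m d = (if (m, d) \<in> index_pairs r then A (cpos r m d) else 1)"

lemma cluster_torus_nonzero: "A \<in> cluster_torus r \<Longrightarrow> k \<in> index_set r \<Longrightarrow> A k \<noteq> 0"
  unfolding cluster_torus_def by (drule (1) PiE_mem) simp

lemma coord_nonzero: "A \<in> cluster_torus r \<Longrightarrow> coord r A m d \<noteq> 0"
  by (simp add: coord_def cluster_torus_nonzero cpos_index_set)

lemma p_M_coord:
  assumes A: "A \<in> cluster_torus r" and d: "1 \<le> d" and t: "Suc t + d \<le> r"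
  shows "p_M r A (pos r (Suc t) d)
    = coord r A (Suc t) (d - 1) * coord r A t (Suc d) * coord r A (Suc (Suc t)) d
      / (coord r A t d * coord r A (Suc (Suc t)) (d - 1) * coord r A (Suc t) (Suc d))"
proof -
  let ?Z = "index_pairs r" and ?A = "\<lambda>z. A (case z of (m, e) \<Rightarrow> cpos r m e)"
  have td: "valid_pair r (Suc t) d" using d t by (auto simp: valid_pair_def)
  have nz: "?A z \<noteq> 0" if "z \<in> ?Z" for z
    using cluster_torus_nonzero[OF A] cpos_index_set that by (cases z) simp
  \<comment> \<open>A factor concentrated at one index z0. Its product over all pairs is trivial
    when z0 is not a pair, which treats neighbours outside the index set uniformly.\<close>
  define g where "g z0 f z = (if z = z0 then f (?A z) else (1::complex))" for z0 :: "nat \<times> nat" and f z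
  have g: "(\<Prod>z\<in>?Z. g (m, e) f z) = (if (m, e) \<in> ?Z then f (coord r A m e) else 1)" for m e f
    unfolding g_def using finite_index_pairs[of r] by (simp add: prod.delta coord_def)
  have "p_M r A (pos r (Suc t) d) = (\<Prod>k\<in>index_set r. A k powi Btilde r (cpos r (Suc t) d) k)"
    by (simp add: p_M_def cpos_def)
  also have "\<dots> = (\<Prod>z\<in>?Z. ?A z powi Btilde r (cpos r (Suc t) d) (case z of (m, e) \<Rightarrow> cpos r m e))"
    by (rule prod.reindex_bij_betw[OF cpos_bij, symmetric])
  also have "\<dots> = (\<Prod>z\<in>?Z. g (Suc t, d - 1) id z * g (t, Suc d) id z * g (Suc (Suc t), d) id z
      * (g (t, d) inverse z * g (Suc (Suc t), d - 1) inverse z * g (Suc t, Suc d) inverse z))"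
  proof (rule prod.cong[OF refl])
    fix z assume z: "z \<in> ?Z"
    obtain m e where [simp]: "z = (m, e)" by (cases z)
    have e1: "1 \<le> e" using z by (auto simp: index_pairs_def)
    have B: "Btilde r (cpos r (Suc t) d) (cpos r m e)
      = of_bool (e = d \<and> m = Suc (Suc t)) - of_bool (e = d \<and> m = t)
      + of_bool (Suc e = d \<and> m = Suc t) - of_bool (Suc e = d \<and> m = Suc (Suc t))
      + of_bool (e = Suc d \<and> m = t) - of_bool (e = Suc d \<and> m = Suc t)"
      using Btilde_pair[OF td t] z by simp
    have n1: "m = k \<Longrightarrow> m \<noteq> Suc k" for k by simp
    consider "e = d" | "Suc e = d" | "e = Suc d" | "e \<noteq> d" "Suc e \<noteq> d" "e \<noteq> Suc d" by blast
    hence "A (cpos r m e) powi Btilde r (cpos r (Suc t) d) (cpos r m e)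
      = g (Suc t, d - 1) id z * g (t, Suc d) id z * g (Suc (Suc t), d) id z
      * (g (t, d) inverse z * g (Suc (Suc t), d - 1) inverse z * g (Suc t, Suc d) inverse z)"
      unfolding B g_def using e1 d by cases (auto simp: power_int_minus)
    thus "?A z powi Btilde r (cpos r (Suc t) d) (case z of (m, e) \<Rightarrow> cpos r m e)
      = g (Suc t, d - 1) id z * g (t, Suc d) id z * g (Suc (Suc t), d) id z
      * (g (t, d) inverse z * g (Suc (Suc t), d - 1) inverse z * g (Suc t, Suc d) inverse z)"
      by simp
  qed
  also have "\<dots> = coord r A (Suc t) (d - 1) * coord r A t (Suc d) * coord r A (Suc (Suc t)) d
      * (inverse (coord r A t d) * inverse (coord r A (Suc (Suc t)) (d - 1)) * inverse (coord r A (Suc t) (Suc d)))"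
    unfolding prod.distrib g by (auto simp: coord_def)
  finally show ?thesis by (simp add: divide_inverse)
qed

section \<open>The crystal in cluster coordinates\<close>

text \<open>Beyond the prescribed minors, the right-hand side mentions only the empty minors and the
  determinant, which are 1 for every matrix in \<open>lower_SL r\<close>.\<close>

lemma minor_conditions:
  assumes x: "x \<in> lower_SL r"
  shows "(\<forall>d \<in> {1..r}. minor {1..d} {1..d} x = A (- int d))
      \<and> (\<forall>d \<in> {1..r}. \<forall>m \<in> {1..r - d + 1}. minor {m + 1..m + d} {1..d} x = A (pos r m d))
    \<longleftrightarrow> (\<forall>m d. m + d \<le> Suc r \<longrightarrow> imin x m d = coord r A m d)" (is "?L \<longleftrightarrow> ?R")
proof
  have xc: "x \<in> carrier_mat (Suc r) (Suc r)" and dx: "det x = 1"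
    using SL_carrier_iff lower_SL_SL[OF x] by auto
  have minor0: "minor {1..d} {1..d} x = imin x 0 d" if "d \<le> Suc r" for d
    using minor_eq_imin[OF xc, of 0 d] that by simp
  {
    assume L: ?L
    show ?R
    proof (intro allI impI)
      fix m d assume md: "m + d \<le> Suc r"
      consider "d = 0" | "m = 0" "d = Suc r" | "m = 0" "d \<in> {1..r}" | "m \<ge> 1" "d \<in> {1..r}" "m \<in> {1..r - d + 1}"
        using md by force
      thus "imin x m d = coord r A m d"
      proof cases
        case 1 thus ?thesis by (simp add: coord_def index_pairs_def)
      next
        case 2 thus ?thesis using imin_full_det[OF xc] dx by (simp add: coord_def index_pairs_def)
      next
        case 3
        hence "minor {1..d} {1..d} x = A (- int d)" using L by blast
        thus ?thesis using 3 minor0[of d] by (simp add: coord_def index_pairs_def cpos_def)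
      next
        case 4
        hence "minor {m + 1..m + d} {1..d} x = A (pos r m d)" using L by blast
        thus ?thesis using 4 md minor_eq_imin[OF xc md] by (simp add: coord_def index_pairs_def cpos_def)
      qed
    qed
  next
    assume R: ?R
    show ?L
    proof (intro conjI ballI)
      fix d assume d: "d \<in> {1..r}"
      thus "minor {1..d} {1..d} x = A (- int d)"
        using R[rule_format, of 0 d] minor0[of d] by (simp add: coord_def index_pairs_def cpos_def)
    next
      fix d m assume d: "d \<in> {1..r}" "m \<in> {1..r - d + 1}"
      hence md: "m + d \<le> Suc r" by auto
      show "minor {m + 1..m + d} {1..d} x = A (pos r m d)"
        using R[rule_format, OF md] minor_eq_imin[OF xc md] d md by (simp add: coord_def index_pairs_def cpos_def)
    qed
  }
qed

lemma a_cluster_eqI: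
  assumes A: "A \<in> cluster_torus r" and x: "x \<in> double_cell r"
    and eq: "\<And>m d. m + d \<le> Suc r \<Longrightarrow> imin x m d = coord r A m d"
  shows "a_cluster r A = x"
  unfolding a_cluster_def
proof (rule the_equality)
  show "x \<in> double_cell r \<and> (\<forall>d \<in> {1..r}. minor {1..d} {1..d} x = A (- int d))
     \<and> (\<forall>d \<in> {1..r}. \<forall>m \<in> {1..r - d + 1}. minor {m + 1..m + d} {1..d} x = A (pos r m d))"
    using minor_conditions[OF double_cell_lower[OF x], of A] x eq by blast
next
  fix x' assume x': "x' \<in> double_cell r \<and> (\<forall>d \<in> {1..r}. minor {1..d} {1..d} x' = A (- int d))
     \<and> (\<forall>d \<in> {1..r}. \<forall>m \<in> {1..r - d + 1}. minor {m + 1..m + d} {1..d} x' = A (pos r m d))"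
  hence "\<forall>m d. m + d \<le> Suc r \<longrightarrow> imin x' m d = coord r A m d"
    using minor_conditions[of x' r A] double_cell_lower by blast
  thus "x' = x"
    by (intro lower_SL_imin_unique[of x' r x]) (use x x' eq double_cell_lower coord_nonzero[OF A] in auto)
qed

text \<open>The prescribed initial minors are nonzero, so a lower triangular matrix with these
  minors exists. The corner minors, those with m + d = r + 1, are among them, and their nonvanishing
  places it in the double cell.\<close>

lemma a_cluster_spec:
  assumes A: "A \<in> cluster_torus r"
  shows "a_cluster r A \<in> double_cell r"
    "m + d \<le> Suc r \<Longrightarrow> imin (a_cluster r A) m d = coord r A m d"
proof -
  obtain x where x: "x \<in> lower_SL r" "\<And>m d. m + d \<le> Suc r \<Longrightarrow> imin x m d = coord r A m d"
  proof -
    have "\<exists>x\<in>lower_SL r. \<forall>m d. m + d \<le> Suc r \<longrightarrow> imin x m d = coord r A m d"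
      by (rule lower_SL_imin_exists) (use coord_nonzero[OF A] in simp, simp_all add: coord_def index_pairs_def)
    thus ?thesis using that by blast
  qed
  have "x \<in> double_cell r"
    by (rule lower_SL_double_cell[OF x(1)]) (use x(2) coord_nonzero[OF A] in auto)
  hence "a_cluster r A = x" by (intro a_cluster_eqI[OF A] x(2))
  thus "a_cluster r A \<in> double_cell r" "m + d \<le> Suc r \<Longrightarrow> imin (a_cluster r A) m d = coord r A m d"
    using \<open>x \<in> double_cell r\<close> x(2) by auto
qed

lemma a_cluster_coordinate:
  assumes "A \<in> cluster_torus r" "(m, d) \<in> index_pairs r"
  shows "A (cpos r m d) = imin (a_cluster r A) m d"
  using a_cluster_spec(2)[OF assms(1), of m d] assms(2) by (simp add: coord_def index_pairs_def)

lemma a_cluster_inj: "inj_on (a_cluster r) (cluster_torus r)"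
proof (rule inj_onI)
  fix A B assume AB: "A \<in> cluster_torus r" "B \<in> cluster_torus r" "a_cluster r A = a_cluster r B"
  show "A = B"
  proof (rule PiE_ext[OF AB(1,2)[unfolded cluster_torus_def]])
    fix k assume "k \<in> index_set r"
    then obtain m d where "(m, d) \<in> index_pairs r" "k = cpos r m d" by (rule index_set_cposE)
    thus "A k = B k" using a_cluster_coordinate AB by metis
  qed
qed

lemma a_cluster_partial_inv_Some:
  assumes "partial_inv (cluster_torus r) (a_cluster r) x = Some A"
  shows "A \<in> cluster_torus r" "a_cluster r A = x"
proof -
  have x: "x \<in> a_cluster r ` cluster_torus r" and A: "A = the_inv_into (cluster_torus r) (a_cluster r) x"
    using assms by (auto simp: partial_inv_def split: if_splits)
  show "A \<in> cluster_torus r" unfolding A by (rule the_inv_into_into[OF a_cluster_inj x order_refl])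
  show "a_cluster r A = x" unfolding A by (rule f_the_inv_into_f[OF a_cluster_inj x])
qed

text \<open>The image of the chart contains every point of the double cell with nonvanishing initial
  minors: its coordinates are simply these minors.\<close>

lemma a_cluster_partial_inv_defined:
  assumes x: "x \<in> double_cell r" and nz: "\<And>m d. (m, d) \<in> index_pairs r \<Longrightarrow> imin x m d \<noteq> 0"
  shows "partial_inv (cluster_torus r) (a_cluster r) x \<noteq> None"
proof -
  let ?c = "\<lambda>(m, d). cpos r m d"
  define A where "A = restrict (\<lambda>k. case the_inv_into (index_pairs r) ?c k of (m, d) \<Rightarrow> imin x m d) (index_set r)"
  have A: "A (cpos r m d) = imin x m d" if "(m, d) \<in> index_pairs r" for m d
  proof -
    have "the_inv_into (index_pairs r) ?c (?c (m, d)) = (m, d)"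
      by (rule the_inv_into_f_f[OF bij_betw_imp_inj_on[OF cpos_bij] that])
    thus ?thesis using cpos_index_set[OF that] by (simp add: A_def)
  qed
  have "A k \<noteq> 0" if k: "k \<in> index_set r" for k
  proof -
    obtain m d where "(m, d) \<in> index_pairs r" "k = cpos r m d" using k by (rule index_set_cposE)
    thus ?thesis using A nz by simp
  qed
  hence T: "A \<in> cluster_torus r" by (auto simp: cluster_torus_def A_def)
  have l: "x \<in> lower_SL r" by (rule double_cell_lower[OF x])
  have xc: "x \<in> carrier_mat (Suc r) (Suc r)" and dx: "det x = 1"
    using SL_carrier_iff lower_SL_SL[OF l] by auto
  have "imin x m d = coord r A m d" if md: "m + d \<le> Suc r" for m d
  proof (cases "(m, d) \<in> index_pairs r")
    case True thus ?thesis by (simp add: coord_def A)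
  next
    case False
    hence "d = 0 \<or> (m = 0 \<and> d = Suc r)" using md by (auto simp: index_pairs_def)
    thus ?thesis using False imin_full_det[OF xc] dx by (auto simp: coord_def)
  qed
  hence "a_cluster r A = x" by (rule a_cluster_eqI[OF T x])
  thus ?thesis using T by (auto simp: partial_inv_def)
qed

definition twist_of :: "nat \<Rightarrow> (int \<Rightarrow> complex) \<Rightarrow> complex mat" where
  "twist_of r A = (iota_anti r \<circ> zeta_twist r) (a_cluster r A)"

text \<open>The right factor of the crystal operator has been absorbed into N, so only the parameter
  (c - 1) / \<chi>_j of the left factor remains. Membership in the double cell is recorded in order
  to decide whether the product lies in the image of the chart.\<close>

lemma cluster_crystal_eq:
  assumes A: "A \<in> cluster_torus r" and j: "j \<in> {1..r}" and c: "c \<noteq> 0"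
  shows "cluster_crystal r j c A = (if chi_cr r j (twist_of r A) \<noteq> 0
    then partial_inv (cluster_torus r) (a_cluster r)
      (a_cluster r A * y_gen r j ((c - 1) / chi_cr r j (twist_of r A))) else None)"
    "chi_cr r j (twist_of r A) \<noteq> 0 \<Longrightarrow>
      a_cluster r A * y_gen r j ((c - 1) / chi_cr r j (twist_of r A)) \<in> double_cell r"
proof -
  define x where "x = a_cluster r A"
  define y where "y = twist_of r A"
  have xd: "x \<in> double_cell r" unfolding x_def by (rule a_cluster_spec(1)[OF A])
  have xy: "twist_rel r x y" using twist_rel_twist[OF xd] by (simp add: y_def twist_of_def x_def)
  have yd: "y \<in> double_cell r" by (rule twist_rel_double_cell(2)[OF xy])
  let ?a = "(c - 1) / chi_cr r j y"
  define y' where "y' = x_gen r j ((c - 1) * phi_cr r j y) * y * x_gen r j ((inverse c - 1) * epsilon_cr r j y)"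
  have rel: "twist_rel r (x * y_gen r j ?a) y'" if "chi_cr r j y \<noteq> 0"
  proof -
    have "y' \<in> lower_SL r"
      unfolding y'_def by (rule crystal_image_lower[OF double_cell_lower[OF yd] j c that])
    from twist_rel_crystal[OF xy j this[unfolded y'_def]] show ?thesis by (simp add: y'_def phi_cr_def)
  qed
  have "cluster_crystal r j c A = (if chi_cr r j y \<noteq> 0
    then partial_inv (cluster_torus r) (a_cluster r) (x * y_gen r j ?a) else None)"
  proof -
    have 0: "(Some \<circ> (iota_anti r \<circ> zeta_twist r) \<circ> a_cluster r) A = Some y"
      by (simp add: y_def twist_of_def)
    have 1: "crystal_e r j c y = (if chi_cr r j y \<noteq> 0 then Some y' else None)"
      using yd by (simp add: crystal_e_def y'_def)
    show ?thesis unfolding cluster_crystal_def map_comp_def 0 using twist_partial_inv[OF rel] by (simp add: 1)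
  qed
  thus "cluster_crystal r j c A = (if chi_cr r j (twist_of r A) \<noteq> 0
    then partial_inv (cluster_torus r) (a_cluster r)
      (a_cluster r A * y_gen r j ((c - 1) / chi_cr r j (twist_of r A))) else None)"
    by (simp add: x_def y_def)
  show "a_cluster r A * y_gen r j ((c - 1) / chi_cr r j (twist_of r A)) \<in> double_cell r"
    if "chi_cr r j (twist_of r A) \<noteq> 0"
    using twist_rel_double_cell(1)[OF rel] that by (simp add: x_def y_def)
qed

text \<open>\<open>jump r A d s\<close> is the difference \<rho>_s - \<rho>_{s-1} for column d.
  Numerator and denominator are kept apart because the denominators are cleared later to obtain
  polynomials.\<close>

definition jump_num :: "nat \<Rightarrow> (int \<Rightarrow> complex) \<Rightarrow> nat \<Rightarrow> nat \<Rightarrow> complex" where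
  "jump_num r A d s = coord r A s (d - 1) * coord r A (s - 1) (Suc d)"

definition jump_den :: "nat \<Rightarrow> (int \<Rightarrow> complex) \<Rightarrow> nat \<Rightarrow> nat \<Rightarrow> complex" where
  "jump_den r A d s = coord r A s d * coord r A (s - 1) d"

definition jump :: "nat \<Rightarrow> (int \<Rightarrow> complex) \<Rightarrow> nat \<Rightarrow> nat \<Rightarrow> complex" where
  "jump r A d s = jump_num r A d s / jump_den r A d s"

lemma jump_nonzero:
  "A \<in> cluster_torus r \<Longrightarrow> jump r A d s \<noteq> 0" "A \<in> cluster_torus r \<Longrightarrow> jump_den r A d s \<noteq> 0"
  by (simp_all add: jump_def jump_num_def jump_den_def coord_nonzero)

lemma imin'_0:
  assumes "x \<in> lower_SL r" "d \<in> {1..r}"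
  shows "imin' x 0 d = 0"
proof -
  obtain e where e: "d = Suc e" using assms by (cases d) auto
  let ?F = "\<lambda>(i, j). x $$ (i, if j = e then Suc e else j)"
  have "x $$ (i, Suc e) = 0" if "i \<le> e" for i using lower_SL_index[OF assms(1), of i "Suc e"] that assms(2) e by simp
  \<comment> \<open>The last column is zero, so linearity in it shows that the determinant equals
    twice itself.\<close>
  hence "det (mat (Suc e) (Suc e) ?F) = det (mat (Suc e) (Suc e) ?F) + 1 * det (mat (Suc e) (Suc e) ?F)"
    by (intro det_last_column) auto
  thus ?thesis by (simp add: imin'_def e)
qed

text \<open>Dividing the Desnanot-Jacobi identity by the two minors of size d in rows starting at t
  + 1 and t + 2 gives one difference of \<rho>; the sum starts from \<rho>_0 = 0.\<close>

lemma imin'_sum_jump: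
  assumes A: "A \<in> cluster_torus r" and d: "d \<in> {1..r}" and m: "m + d \<le> Suc r"
  shows "imin' (a_cluster r A) m d = coord r A m d * (\<Sum>s = 1..m. jump r A d s)"
  using m
proof (induction m)
  case 0
  show ?case using imin'_0[OF double_cell_lower[OF a_cluster_spec(1)[OF A]] d] by simp
next
  case (Suc t)
  let ?x = "a_cluster r A"
  note im = a_cluster_spec(2)[OF A]
  note nz = coord_nonzero[OF A]
  have "imin' ?x (Suc t) d * imin ?x t d - imin' ?x t d * imin ?x (Suc t) d
    = imin ?x t (Suc d) * imin ?x (Suc t) (d - 1)"
    by (rule imin_jacobi) (use Suc.prems d im nz in auto)
  hence "imin' ?x (Suc t) d * coord r A t d - coord r A t d * (\<Sum>s = 1..t. jump r A d s) * coord r A (Suc t) d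
    = coord r A t (Suc d) * coord r A (Suc t) (d - 1)"
    using Suc d by (simp add: im)
  moreover have "coord r A t (Suc d) * coord r A (Suc t) (d - 1)
      = coord r A t d * (coord r A (Suc t) d * jump r A d (Suc t))"
    using nz by (simp add: jump_def jump_num_def jump_den_def)
  ultimately have "coord r A t d * imin' ?x (Suc t) d
      = coord r A t d * (coord r A (Suc t) d * ((\<Sum>s = 1..t. jump r A d s) + jump r A d (Suc t)))"
    by (simp add: algebra_simps)
  thus ?case using nz by simp
qed

lemma chi_sum_jump:
  assumes A: "A \<in> cluster_torus r" and d: "d \<in> {1..r}"
  shows "chi_cr r d (twist_of r A) = (\<Sum>s = 1..Suc r - d. jump r A d s)"
proof -
  have xy: "twist_rel r (a_cluster r A) (twist_of r A)"
    using twist_rel_twist[OF a_cluster_spec(1)[OF A]] by (simp add: twist_of_def)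
  have im: "imin (a_cluster r A) (Suc r - d) d = coord r A (Suc r - d) d"
    using a_cluster_spec(2)[OF A] d by simp
  have "imin' (a_cluster r A) (Suc r - d) d = coord r A (Suc r - d) d * (\<Sum>s = 1..Suc r - d. jump r A d s)"
    by (rule imin'_sum_jump[OF A d]) (use d in simp)
  thus ?thesis using chi_imin[OF xy d] im coord_nonzero[OF A] by simp
qed

text \<open>The numerator of the answer up to the common divisor, with jumps in place of products of
  the P; m = 0 gives the denominator whatever c is.\<close>

definition weighted_sum :: "nat \<Rightarrow> complex \<Rightarrow> (int \<Rightarrow> complex) \<Rightarrow> nat \<Rightarrow> nat \<Rightarrow> complex" where
  "weighted_sum r c A d m = (\<Sum>s = 1..Suc r - d. (if s \<le> m then c else 1) * jump r A d s)"

lemma weighted_sum_split: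
  assumes "m \<le> Suc r - d"
  shows "weighted_sum r c A d m = c * (\<Sum>s = 1..m. jump r A d s) + (\<Sum>s = m + 1..Suc r - d. jump r A d s)"
proof -
  have "{1..Suc r - d} = {1..m} \<union> {m + 1..Suc r - d}" using assms by auto
  hence "weighted_sum r c A d m = (\<Sum>s = 1..m. (if s \<le> m then c else 1) * jump r A d s)
      + (\<Sum>s = m + 1..Suc r - d. (if s \<le> m then c else 1) * jump r A d s)"
    unfolding weighted_sum_def by (simp only:) (rule sum.union_disjoint; auto)
  thus ?thesis by (simp add: sum_distrib_left)
qed

lemma weighted_sum_0: "weighted_sum r c A d 0 = (\<Sum>s = 1..Suc r - d. jump r A d s)"
  by (simp add: weighted_sum_def)

lemma imin_crystal:
  assumes A: "A \<in> cluster_torus r" and j: "j \<in> {1..r}" and md: "(m, d) \<in> index_pairs r"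
    and \<chi>: "chi_cr r j (twist_of r A) \<noteq> 0"
  shows "imin (a_cluster r A * y_gen r j ((c - 1) / chi_cr r j (twist_of r A))) m d
    = coord r A m d * (if j = d then weighted_sum r c A d m / weighted_sum r c A d 0 else 1)"
proof -
  let ?x = "a_cluster r A" and ?\<chi> = "chi_cr r j (twist_of r A)"
  have md': "m + d \<le> Suc r" "d \<in> {1..r}" using md by (auto simp: index_pairs_def)
  have xc: "?x \<in> carrier_mat (Suc r) (Suc r)"
    using double_cell_lower[OF a_cluster_spec(1)[OF A]] by simp
  have im: "imin (?x * y_gen r j ((c - 1) / ?\<chi>)) m d
      = coord r A m d + (if j = d then (c - 1) / ?\<chi> * imin' ?x m d else 0)"
    using imin_mult_y_gen[OF xc j md'(1)] md' a_cluster_spec(2)[OF A md'(1)] by simp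
  show ?thesis
  proof (cases "j = d")
    case False
    thus ?thesis using im by simp
  next
    case True
    let ?S = "\<Sum>s = 1..m. jump r A d s" and ?T = "\<Sum>s = m + 1..Suc r - d. jump r A d s"
    have \<chi>0: "?\<chi> = weighted_sum r c A d 0"
      using chi_sum_jump[OF A md'(2)] True by (simp add: weighted_sum_0)
    have sp: "weighted_sum r c A d 0 = ?S + ?T"
    proof -
      have "{1..Suc r - d} = {1..m} \<union> {m + 1..Suc r - d}" using md' by auto
      thus ?thesis unfolding weighted_sum_0 by (simp only:) (rule sum.union_disjoint; auto)
    qed
    \<comment> \<open>c S + T = (S + T) + (c - 1) S, where S + T is \<chi>_d and S is \<rho>_m;
      after division by \<chi>_d this is the factor 1 + (c - 1) \<rho>_m / \<chi>_d.\<close>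
    have "weighted_sum r c A d m = weighted_sum r c A d 0 + (c - 1) * ?S"
      using weighted_sum_split[of m r d c A] md' unfolding sp by (simp add: algebra_simps)
    hence "weighted_sum r c A d m / ?\<chi> = 1 + (c - 1) / ?\<chi> * ?S"
      using \<chi> unfolding \<chi>0 by (simp add: divide_simps)
    thus ?thesis using im True imin'_sum_jump[OF A md'(2,1)] unfolding \<chi>0[symmetric]
      by (simp add: algebra_simps)
  qed
qed

text \<open>Each P_{t,d} is the quotient of the jumps at t and t + 1, so the product
  telescopes.\<close>

lemma prod_p_M:
  assumes A: "A \<in> cluster_torus r" and d: "d \<in> {1..r}" and s: "s \<in> {1..Suc r - d}"
  shows "(\<Prod>t = s..r - d. p_M r A (pos r t d)) = jump r A d s / jump r A d (Suc r - d)"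
proof -
  have P: "p_M r A (pos r t d) = jump r A d t / jump r A d (Suc t)" if t: "1 \<le> t" "t \<le> r - d" for t
  proof -
    obtain t' where t': "t = Suc t'" using t by (cases t) auto
    show ?thesis
      using p_M_coord[OF A, of d t'] t d coord_nonzero[OF A]
      by (simp add: t' jump_def jump_num_def jump_den_def mult.assoc)
  qed
  \<comment> \<open>Induction downwards from the upper end: k is the number of factors, and k = 0 is
    the empty product, where s = r - d + 1 and the quotient of jumps is 1.\<close>
  obtain k where k: "s = Suc r - d - k" "k \<le> r - d" using s d by (intro that[of "Suc r - d - s"]) auto
  have "(\<Prod>t = Suc r - d - k..r - d. p_M r A (pos r t d))
      = jump r A d (Suc r - d - k) / jump r A d (Suc r - d)" if "k \<le> r - d"
    using that
  proof (induction k)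
    case 0
    thus ?case using d jump_nonzero[OF A] by (simp add: Suc_diff_le)
  next
    case (Suc k)
    let ?t = "Suc r - d - Suc k"
    have t: "1 \<le> ?t" "?t \<le> r - d" "Suc ?t = Suc r - d - k" using Suc.prems d by auto
    have "(\<Prod>t = ?t..r - d. p_M r A (pos r t d))
        = p_M r A (pos r ?t d) * (\<Prod>t = Suc ?t..r - d. p_M r A (pos r t d))"
      by (rule prod.atLeast_Suc_atMost[OF t(2)])
    also have "\<dots> = jump r A d ?t / jump r A d (Suc ?t) * (jump r A d (Suc ?t) / jump r A d (Suc r - d))"
      using P[OF t(1,2)] Suc t(3) by simp
    also have "\<dots> = jump r A d ?t / jump r A d (Suc r - d)" using jump_nonzero[OF A] by simp
    finally show ?case .
  qed
  thus ?thesis using k by simp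
qed

lemma sum_prod_p_M:
  assumes A: "A \<in> cluster_torus r" and d: "d \<in> {1..r}" and S: "S \<subseteq> {1..Suc r - d}"
  shows "(\<Sum>s\<in>S. \<Prod>t = s..r - d. p_M r A (pos r t d)) = (\<Sum>s\<in>S. jump r A d s) / jump r A d (Suc r - d)"
proof -
  have "(\<Sum>s\<in>S. \<Prod>t = s..r - d. p_M r A (pos r t d)) = (\<Sum>s\<in>S. jump r A d s / jump r A d (Suc r - d))"
    by (rule sum.cong[OF refl], rule prod_p_M[OF A d]) (use S in blast)
  thus ?thesis by (simp add: sum_divide_distrib)
qed

section \<open>Genericity: polynomials that detect where both sides are defined\<close>

lemma poly_funs_sum: "finite S \<Longrightarrow> (\<And>s. s \<in> S \<Longrightarrow> f s \<in> poly_funs r) \<Longrightarrow> (\<lambda>A. \<Sum>s\<in>S. f s A) \<in> poly_funs r"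
  by (induction S rule: finite_induct) (auto intro: poly_funs.intros)

lemma poly_funs_prod: "finite S \<Longrightarrow> (\<And>s. s \<in> S \<Longrightarrow> f s \<in> poly_funs r) \<Longrightarrow> (\<lambda>A. \<Prod>s\<in>S. f s A) \<in> poly_funs r"
  by (induction S rule: finite_induct) (auto intro: poly_funs.intros)

lemma poly_funs_coord: "(\<lambda>A. coord r A m d) \<in> poly_funs r"
  by (cases "(m, d) \<in> index_pairs r") (auto simp: coord_def intro: poly_funs.intros cpos_index_set)

text \<open>\<open>weighted_sum\<close> multiplied by all the denominators of its jumps. These are
  nonzero on the torus, so both have the same zeros there, but this one is a polynomial.\<close>

definition cleared_sum :: "nat \<Rightarrow> complex \<Rightarrow> nat \<Rightarrow> nat \<Rightarrow> (int \<Rightarrow> complex) \<Rightarrow> complex" where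
  "cleared_sum r c d m A = (\<Sum>s = 1..Suc r - d. (if s \<le> m then c else 1) *
     (jump_num r A d s * (\<Prod>s'\<in>{1..Suc r - d} - {s}. jump_den r A d s')))"

lemma cleared_sum_eq:
  assumes A: "A \<in> cluster_torus r"
  shows "cleared_sum r c d m A = weighted_sum r c A d m * (\<Prod>s = 1..Suc r - d. jump_den r A d s)"
  unfolding weighted_sum_def cleared_sum_def sum_distrib_right
proof (rule sum.cong[OF refl])
  fix s assume s: "s \<in> {1..Suc r - d}"
  have "(\<Prod>s = 1..Suc r - d. jump_den r A d s)
      = jump_den r A d s * (\<Prod>s'\<in>{1..Suc r - d} - {s}. jump_den r A d s')"
    by (rule prod.remove) (use s in auto)
  thus "(if s \<le> m then c else 1) * (jump_num r A d s * (\<Prod>s'\<in>{1..Suc r - d} - {s}. jump_den r A d s'))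
      = (if s \<le> m then c else 1) * jump r A d s * (\<Prod>s = 1..Suc r - d. jump_den r A d s)"
    using jump_nonzero(2)[OF A] by (simp add: jump_def)
qed

lemma poly_funs_cleared_sum: "cleared_sum r c d m \<in> poly_funs r"
proof -
  have "(\<lambda>A. \<Sum>s = 1..Suc r - d. (if s \<le> m then c else 1) *
     (jump_num r A d s * (\<Prod>s'\<in>{1..Suc r - d} - {s}. jump_den r A d s'))) \<in> poly_funs r"
    unfolding jump_num_def jump_den_def
    by (intro poly_funs_sum poly_funs_prod poly_funs.mult poly_funs.const poly_funs_coord) auto
  thus ?thesis by (simp add: cleared_sum_def[abs_def])
qed

text \<open>With \<open>A\<^bsub>-d\<^esub> = 1/z\<close> and all other coordinates \<open>1\<close>, the first jump is \<open>z\<close> and the others are \<open>1\<close>.\<close>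

lemma generic_point:
  assumes d: "d \<in> {1..r}" and c: "c \<noteq> 0"
  shows "\<exists>A\<in>cluster_torus r. \<forall>m\<le>Suc r - d. weighted_sum r c A d m \<noteq> 0"
proof -
  let ?w = "\<lambda>m s::nat. if s \<le> m then c else 1"
  define K where "K m = (\<Sum>s = 2..Suc r - d. ?w m s)" for m
  \<comment> \<open>Each weighted sum is affine in z with nonzero slope, so it excludes one value of
    z; 0 is excluded because z has to be inverted.\<close>
  have "finite ((\<lambda>m. - K m / ?w m 1) ` {..Suc r - d} \<union> {0})" by simp
  then obtain z where z: "z \<notin> (\<lambda>m. - K m / ?w m 1) ` {..Suc r - d} \<union> {0}"
    using ex_new_if_finite[OF infinite_UNIV_char_0] by metis
  define A where "A = restrict (\<lambda>k. if k = - int d then 1 / z else 1) (index_set r)"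
  have T: "A \<in> cluster_torus r" using z by (auto simp: A_def cluster_torus_def)
  have co: "coord r A m e = (if m = 0 \<and> e = d then 1 / z else 1)" for m e
  proof (cases "(m, e) \<in> index_pairs r")
    case True
    have "cpos r m e = - int d \<longleftrightarrow> m = 0 \<and> e = d"
      using True cpos_valid(1)[of r m e] unfolding index_pairs_cases by (auto simp: cpos_def valid_pair_def)
    thus ?thesis using True cpos_index_set[OF True] by (simp add: coord_def A_def)
  next
    case False
    thus ?thesis using d by (auto simp: coord_def index_pairs_def)
  qed
  have j1: "jump r A d 1 = z" using d z by (simp add: jump_def jump_num_def jump_den_def co)
  have j2: "jump r A d s = 1" if "s \<ge> 2" for s
    using that d by (auto simp: jump_def jump_num_def jump_den_def co)
  have "weighted_sum r c A d m \<noteq> 0" if m: "m \<le> Suc r - d" for m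
  proof -
    have "weighted_sum r c A d m = ?w m 1 * z + K m"
      unfolding weighted_sum_def using d j2
      by (subst sum.atLeast_Suc_atMost) (auto simp: j1[simplified] K_def numeral_2_eq_2 intro!: sum.cong)
    moreover have "?w m 1 * z \<noteq> - K m"
    proof
      assume "?w m 1 * z = - K m"
      hence "z = - K m / ?w m 1" using c by (simp add: field_simps split: if_splits)
      thus False using z m by blast
    qed
    ultimately show ?thesis by (simp add: add_eq_0_iff2)
  qed
  thus ?thesis using T by blast
qed

theorem theorem7p3:
  fixes r j m d :: nat and c :: complex
  assumes "j \<in> {1..r}" and "c \<noteq> 0" and "m \<in> {1..r}" and "d \<in> {1..r - m + 1}"
  shows "rational_eq r
    (\<lambda>A. map_option (\<lambda>A'. A' (pos r m d)) (cluster_crystal r j c A))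
    (\<lambda>A. let P = (\<lambda>t. p_M r A (pos r t d)) in
       if j = d then
         quot_opt
           (A (pos r m d) *
             (c * (\<Sum>s = 1..m. \<Prod>t = s..r - d. P t)
              + (\<Sum>s = m + 1..r - d + 1. \<Prod>t = s..r - d. P t)))
           (\<Sum>s = 1..r - d + 1. \<Prod>t = s..r - d. P t)
       else Some (A (pos r m d)))" (is "rational_eq r ?F ?G")
proof -
  have d: "d \<in> {1..r}" and md: "m + d \<le> Suc r" and ip: "(m, d) \<in> index_pairs r"
    and cp: "pos r m d = cpos r m d" and rd: "r - d + 1 = Suc r - d"
    using assms(3,4) by (auto simp: index_pairs_def cpos_def)
  \<comment> \<open>Numerator and denominator both carry the last jump as divisor, which cancels
    between them.\<close>
  have G: "?G A = (if j = d then quot_opt (A (pos r m d) * (weighted_sum r c A d m / jump r A d (Suc r - d)))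
      (weighted_sum r c A d 0 / jump r A d (Suc r - d)) else Some (A (pos r m d)))"
    if A: "A \<in> cluster_torus r" for A
  proof -
    have "{1..m} \<subseteq> {1..Suc r - d}" "{m + 1..Suc r - d} \<subseteq> {1..Suc r - d}" using md by auto
    thus ?thesis
      unfolding Let_def rd using sum_prod_p_M[OF A d] weighted_sum_split[of m r d c A] md
      by (simp add: weighted_sum_0 add_divide_distrib)
  qed
  have F: "?F A = (if weighted_sum r c A j 0 \<noteq> 0 then map_option (\<lambda>A'. A' (pos r m d))
      (partial_inv (cluster_torus r) (a_cluster r)
        (a_cluster r A * y_gen r j ((c - 1) / chi_cr r j (twist_of r A)))) else None)"
    if A: "A \<in> cluster_torus r" for A
    using cluster_crystal_eq(1)[OF A assms(1,2)] chi_sum_jump[OF A assms(1)] by (simp add: weighted_sum_0)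
  \<comment> \<open>Definedness of the left side alone suffices: it forces \<chi>_j \<noteq> 0,
    which for j = d is the nonvanishing of the denominator on the right.\<close>
  have agree: "?F A = ?G A" if A: "A \<in> cluster_torus r" and FA: "?F A \<noteq> None" for A
  proof -
    obtain A' where A': "partial_inv (cluster_torus r) (a_cluster r)
        (a_cluster r A * y_gen r j ((c - 1) / chi_cr r j (twist_of r A))) = Some A'"
      and w: "weighted_sum r c A j 0 \<noteq> 0"
      using FA unfolding F[OF A] by (auto split: if_splits)
    have \<chi>: "chi_cr r j (twist_of r A) \<noteq> 0"
      using w chi_sum_jump[OF A assms(1)] by (simp add: weighted_sum_0)
    have "A' (pos r m d) = coord r A m d * (if j = d then weighted_sum r c A d m / weighted_sum r c A d 0 else 1)"
      using a_cluster_partial_inv_Some[OF A'] a_cluster_coordinate[OF _ ip] imin_crystal[OF A assms(1) ip \<chi>]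
      unfolding cp by metis
    also have "coord r A m d = A (pos r m d)" using ip cp by (simp add: coord_def)
    finally show ?thesis
      unfolding F[OF A] G[OF A] A' using w jump_nonzero(1)[OF A] by (auto simp: quot_opt_def)
  qed
  \<comment> \<open>The factor m' = 0 makes \<chi>_j nonzero, so that the crystal operator is
    defined; the other factors keep all changed coordinates, those with letter j, nonzero, so that
    the result lies again in the torus.\<close>
  define f where "f A = (\<Prod>m'\<le>Suc r - j. cleared_sum r c j m' A)" for A
  have f: "f A \<noteq> 0 \<longleftrightarrow> (\<forall>m'\<le>Suc r - j. weighted_sum r c A j m' \<noteq> 0)" if A: "A \<in> cluster_torus r" for A
    using jump_nonzero(2)[OF A] by (auto simp: f_def cleared_sum_eq[OF A])
  have "generically r (\<lambda>A. ?F A \<noteq> None \<and> ?G A \<noteq> None)"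
    unfolding generically_def
  proof (intro bexI[of _ f] conjI ballI impI)
    show "f \<in> poly_funs r"
      unfolding f_def[abs_def] by (intro poly_funs_prod poly_funs_cleared_sum) auto
    show "\<exists>A\<in>cluster_torus r. f A \<noteq> 0" using generic_point[OF assms(1,2)] f by blast
  next
    fix A assume A: "A \<in> cluster_torus r" and "f A \<noteq> 0"
    hence w: "weighted_sum r c A j m' \<noteq> 0" if "m' \<le> Suc r - j" for m' using f that by blast
    have \<chi>: "chi_cr r j (twist_of r A) \<noteq> 0"
      using w[of 0] chi_sum_jump[OF A assms(1)] by (simp add: weighted_sum_0)
    have "imin (a_cluster r A * y_gen r j ((c - 1) / chi_cr r j (twist_of r A))) k e \<noteq> 0"
      if ke: "(k, e) \<in> index_pairs r" for k e
    proof -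
      have "j = e \<Longrightarrow> k \<le> Suc r - j" using ke by (auto simp: index_pairs_def)
      thus ?thesis unfolding imin_crystal[OF A assms(1) ke \<chi>] using w w[of 0] coord_nonzero[OF A] by auto
    qed
    hence "partial_inv (cluster_torus r) (a_cluster r)
        (a_cluster r A * y_gen r j ((c - 1) / chi_cr r j (twist_of r A))) \<noteq> None"
      by (rule a_cluster_partial_inv_defined[OF cluster_crystal_eq(2)[OF A assms(1,2) \<chi>]])
    thus "?F A \<noteq> None" unfolding F[OF A] using w[of 0] by simp
    show "?G A \<noteq> None" unfolding G[OF A] using w[of 0] jump_nonzero(1)[OF A] by (auto simp: quot_opt_def)
  qed
  thus ?thesis using agree unfolding rational_eq_def by blast
qed

end
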